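(* Let $G$ be a finite abelian group (written multiplicatively). Let $X$ and $Y$ be Cantor sets, let $\phi$ be a minimal homeomorphism of $X$ and $\psi$ a minimal homeomorphism of $Y$, and let $\xi:X\to G$ and $\eta:Y\to G$ be two non-degenerate cocycles. Put $Z=X\times Y\times G$ and let $\omega$ be the $\mathbb{Z}^2$-action on $Z$ generated by the commuting homeomorphisms $\tilde\phi(x,y,g)=(\phi(x),y,g\xi(x))$ and $\tilde\psi(x,y,g)=(x,\psi(y),g\eta(y))$. Then the torsion part of the group of coinvariants $\operatorname{Coinv}(Z,\omega)$ is isomorphic to $T_G$.
   Context: Cocycles: a cocycle $\xi:X\to G$ is a continuous map; it is non-degenerate if the homeomorphism $\phi\times\xi$ of $X\times G$ defined by $(x,g)\mapsto(\phi(x),g\xi(x))$ is minimal (and similarly for $\eta$ with respect to $\psi$). Coinvariants: $C(Z,\mathbb{Z})$ is the group of integer-valued continuous functions on $Z$, and $$\operatorname{Coinv}(Z,\omega)=C(Z,\mathbb{Z})/\{f_1-f_1\circ\tilde\phi^{-1}+f_2-f_2\circ\tilde\psi^{-1}:f_1,f_2\in C(Z,\mathbb{Z})\}.$$ The group $T_G$: let $e$ be the identity of $G$. Let $A$ and $B$ be finite sets and $\mu:A\cup B\to G$ a map such that both $\mu(A)$ and $\mu(B)$ generate $G$. Put $\mathcal{M}(A,B)=\mathbb{Z}[G]\otimes\mathbb{Z}^A\otimes\mathbb{Z}^B$ (tensor products over $\mathbb{Z}$, the elements of $A$, $B$ being identified with the standard bases of $\mathbb{Z}^A$, $\mathbb{Z}^B$).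 Let $\mathcal{A}$ be the subgroup of all elements $\sum_{a\in A}\sum_{b\in B}\alpha(a)(e-\mu(b))\otimes a\otimes b$ with $\alpha:A\to\mathbb{Z}[G]$, and let $\mathcal{B}$ be the subgroup of all elements $\sum_{a\in A}\sum_{b\in B}\beta(b)(e-\mu(a))\otimes a\otimes b$ with $\beta:B\to\mathbb{Z}[G]$. Put $\mathcal{N}(A,B)=\mathcal{M}(A,B)/(\mathcal{A}+\mathcal{B})$ and let $T(\mathcal{N}(A,B))$ be its torsion subgroup. Up to isomorphism $T(\mathcal{N}(A,B))$ depends only on $G$ and not on $A$, $B$, $\mu$; this group is denoted $T_G$. *)

theory Defs
  imports "HOL-Analysis.Analysis" "HOL-Algebra.Free_Abelian_Groups"
begin

section \<open>Minimal Cantor systems and cocycles\<close>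

definition cantor_space :: "'a topology \<Rightarrow> bool" where
  "cantor_space X \<longleftrightarrow>
     X homeomorphic_space product_topology (\<lambda>n::nat. discrete_topology (UNIV :: bool set)) UNIV"

definition minimal_homeomorphism :: "'a topology \<Rightarrow> ('a \<Rightarrow> 'a) \<Rightarrow> bool" where
  "minimal_homeomorphism X f \<longleftrightarrow>
     homeomorphic_map X X f \<and>
     (\<forall>C. closedin X C \<longrightarrow> f ` C = C \<longrightarrow> C = {} \<or> C = topspace X)"

definition cocycle :: "'a topology \<Rightarrow> ('g, 'm) monoid_scheme \<Rightarrow> ('a \<Rightarrow> 'g) \<Rightarrow> bool" where
  "cocycle X G \<xi> \<longleftrightarrow> continuous_map X (discrete_topology (carrier G)) \<xi>"

definition skew_product ::
    "('g, 'm) monoid_scheme \<Rightarrow> ('a \<Rightarrow> 'a) \<Rightarrow> ('a \<Rightarrow> 'g) \<Rightarrow> 'a \<times> 'g \<Rightarrow> 'a \<times> 'g" where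
  "skew_product G \<phi> \<xi> = (\<lambda>(x, g). (\<phi> x, g \<otimes>\<^bsub>G\<^esub> \<xi> x))"

definition nondegenerate_cocycle ::
    "'a topology \<Rightarrow> ('g, 'm) monoid_scheme \<Rightarrow> ('a \<Rightarrow> 'a) \<Rightarrow> ('a \<Rightarrow> 'g) \<Rightarrow> bool" where
  "nondegenerate_cocycle X G \<phi> \<xi> \<longleftrightarrow>
     cocycle X G \<xi> \<and>
     minimal_homeomorphism (prod_topology X (discrete_topology (carrier G))) (skew_product G \<phi> \<xi>)"

definition product_space ::
    "'a topology \<Rightarrow> 'b topology \<Rightarrow> ('g, 'm) monoid_scheme \<Rightarrow> ('a \<times> 'b \<times> 'g) topology" where
  "product_space X Y G = prod_topology X (prod_topology Y (discrete_topology (carrier G)))"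

definition lift_first ::
    "('g, 'm) monoid_scheme \<Rightarrow> ('a \<Rightarrow> 'a) \<Rightarrow> ('a \<Rightarrow> 'g) \<Rightarrow> 'a \<times> 'b \<times> 'g \<Rightarrow> 'a \<times> 'b \<times> 'g" where
  "lift_first G \<phi> \<xi> = (\<lambda>(x, y, g). (\<phi> x, y, g \<otimes>\<^bsub>G\<^esub> \<xi> x))"

definition lift_second ::
    "('g, 'm) monoid_scheme \<Rightarrow> ('b \<Rightarrow> 'b) \<Rightarrow> ('b \<Rightarrow> 'g) \<Rightarrow> 'a \<times> 'b \<times> 'g \<Rightarrow> 'a \<times> 'b \<times> 'g" where
  "lift_second G \<psi> \<eta> = (\<lambda>(x, y, g). (x, \<psi> y, g \<otimes>\<^bsub>G\<^esub> \<eta> y))"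


section \<open>Coinvariants\<close>

text \<open>Functions on the space are represented by their extensional representatives, which are
  undefined off the space, so that equal functions are equal as elements of the group.\<close>

definition int_functions :: "'z topology \<Rightarrow> ('z \<Rightarrow> int) monoid" where
  "int_functions Z =
     \<lparr>carrier = {f \<in> extensional (topspace Z). continuous_map Z (discrete_topology UNIV) f},
      monoid.mult = (\<lambda>f1 f2. \<lambda>z\<in>topspace Z. f1 z + f2 z),
      one = (\<lambda>z\<in>topspace Z. 0)\<rparr>"

definition coboundaries :: "'z topology \<Rightarrow> ('z \<Rightarrow> 'z) \<Rightarrow> ('z \<Rightarrow> 'z) \<Rightarrow> ('z \<Rightarrow> int) set" where
  "coboundaries Z S T =
     {(\<lambda>z\<in>topspace Z. f1 z - f1 (inv_into (topspace Z) S z)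
                     + f2 z - f2 (inv_into (topspace Z) T z)) | f1 f2.
        f1 \<in> carrier (int_functions Z) \<and> f2 \<in> carrier (int_functions Z)}"

text \<open>The coinvariants of the action of \<open>\<int>\<^sup>2\<close> on \<open>Z\<close> generated by the commuting
  homeomorphisms \<open>S\<close> and \<open>T\<close>.\<close>

definition coinvariants :: "'z topology \<Rightarrow> ('z \<Rightarrow> 'z) \<Rightarrow> ('z \<Rightarrow> 'z) \<Rightarrow> ('z \<Rightarrow> int) set monoid" where
  "coinvariants Z S T = int_functions Z Mod coboundaries Z S T"

text \<open>The intended argument is an abelian group.\<close>

definition torsion_subgroup :: "('a, 'm) monoid_scheme \<Rightarrow> ('a, 'm) monoid_scheme" where
  "torsion_subgroup H =
     H\<lparr>carrier := {x \<in> carrier H. \<exists>n::nat. n > 0 \<and> x [^]\<^bsub>H\<^esub> n = \<one>\<^bsub>H\<^esub>}\<rparr>"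


section \<open>Tensor products of abelian groups\<close>

text \<open>The free abelian group on pairs modulo the bilinearity relations. The groups \<open>M\<close> and \<open>N\<close>
  are written multiplicatively, as always in \<^theory>\<open>HOL-Algebra.Group\<close>.\<close>

definition tensor_relations ::
    "('a, 'm) monoid_scheme \<Rightarrow> ('b, 'n) monoid_scheme \<Rightarrow> ('a \<times> 'b \<Rightarrow>\<^sub>0 int) set" where
  "tensor_relations M N =
     generate (free_Abelian_group (carrier M \<times> carrier N))
       ({frag_of (x \<otimes>\<^bsub>M\<^esub> x', y) - frag_of (x, y) - frag_of (x', y) | x x' y.
           x \<in> carrier M \<and> x' \<in> carrier M \<and> y \<in> carrier N} \<union>
        {frag_of (x, y \<otimes>\<^bsub>N\<^esub> y') - frag_of (x, y) - frag_of (x, y') | x y y'.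
           x \<in> carrier M \<and> y \<in> carrier N \<and> y' \<in> carrier N})"

definition tensor_product ::
    "('a, 'm) monoid_scheme \<Rightarrow> ('b, 'n) monoid_scheme \<Rightarrow> ('a \<times> 'b \<Rightarrow>\<^sub>0 int) set monoid" where
  "tensor_product M N =
     free_Abelian_group (carrier M \<times> carrier N) Mod tensor_relations M N"

definition pure_tensor ::
    "('a, 'm) monoid_scheme \<Rightarrow> ('b, 'n) monoid_scheme \<Rightarrow> 'a \<Rightarrow> 'b \<Rightarrow> ('a \<times> 'b \<Rightarrow>\<^sub>0 int) set" where
  "pure_tensor M N x y =
     tensor_relations M N #>\<^bsub>free_Abelian_group (carrier M \<times> carrier N)\<^esub> frag_of (x, y)"


section \<open>The groups whose torsion is \<open>T\<^sub>G\<close>\<close>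

text \<open>The additive group of the group ring \<open>\<int>[G]\<close> is \<^term>\<open>free_Abelian_group (carrier G)\<close>;
  its product extends that of \<open>G\<close> bilinearly.\<close>

definition group_ring_mult ::
    "('g, 'm) monoid_scheme \<Rightarrow> ('g \<Rightarrow>\<^sub>0 int) \<Rightarrow> ('g \<Rightarrow>\<^sub>0 int) \<Rightarrow> ('g \<Rightarrow>\<^sub>0 int)" where
  "group_ring_mult G p q = frag_extend (\<lambda>g. frag_extend (\<lambda>h. frag_of (g \<otimes>\<^bsub>G\<^esub> h)) q) p"

text \<open>The type of \<open>\<int>[G] \<otimes> \<int>\<^sup>A \<otimes> \<int>\<^sup>B\<close>, bracketed to the left.\<close>

type_synonym ('g, 'i) triple_tensor =
  "((('g \<Rightarrow>\<^sub>0 int) \<times> ('i \<Rightarrow>\<^sub>0 int) \<Rightarrow>\<^sub>0 int) set \<times> ('i \<Rightarrow>\<^sub>0 int) \<Rightarrow>\<^sub>0 int) set"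

definition M_group ::
    "('g, 'm) monoid_scheme \<Rightarrow> 'i set \<Rightarrow> 'i set \<Rightarrow> ('g, 'i) triple_tensor monoid" where
  "M_group G A B =
     tensor_product
       (tensor_product (free_Abelian_group (carrier G)) (free_Abelian_group A))
       (free_Abelian_group B)"

text \<open>The element \<open>p \<otimes> a \<otimes> b\<close> for \<open>p \<in> \<int>[G]\<close>, \<open>a \<in> A\<close> and \<open>b \<in> B\<close>.\<close>

definition M_tensor ::
    "('g, 'm) monoid_scheme \<Rightarrow> 'i set \<Rightarrow> 'i set \<Rightarrow> ('g \<Rightarrow>\<^sub>0 int) \<Rightarrow> 'i \<Rightarrow> 'i
       \<Rightarrow> ('g, 'i) triple_tensor" where
  "M_tensor G A B p a b =
     pure_tensor
       (tensor_product (free_Abelian_group (carrier G)) (free_Abelian_group A))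
       (free_Abelian_group B)
       (pure_tensor (free_Abelian_group (carrier G)) (free_Abelian_group A) p (frag_of a))
       (frag_of b)"

definition A_subgroup ::
    "('g, 'm) monoid_scheme \<Rightarrow> 'i set \<Rightarrow> 'i set \<Rightarrow> ('i \<Rightarrow> 'g) \<Rightarrow> ('g, 'i) triple_tensor set" where
  "A_subgroup G A B \<mu> =
     {(\<Otimes>\<^bsub>M_group G A B\<^esub>a\<in>A. \<Otimes>\<^bsub>M_group G A B\<^esub>b\<in>B.
         M_tensor G A B (group_ring_mult G (\<alpha> a) (frag_of \<one>\<^bsub>G\<^esub> - frag_of (\<mu> b))) a b) | \<alpha>.
        \<alpha> \<in> A \<rightarrow> carrier (free_Abelian_group (carrier G))}"

definition B_subgroup ::
    "('g, 'm) monoid_scheme \<Rightarrow> 'i set \<Rightarrow> 'i set \<Rightarrow> ('i \<Rightarrow> 'g) \<Rightarrow> ('g, 'i) triple_tensor set" where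
  "B_subgroup G A B \<mu> =
     {(\<Otimes>\<^bsub>M_group G A B\<^esub>a\<in>A. \<Otimes>\<^bsub>M_group G A B\<^esub>b\<in>B.
         M_tensor G A B (group_ring_mult G (\<beta> b) (frag_of \<one>\<^bsub>G\<^esub> - frag_of (\<mu> a))) a b) | \<beta>.
        \<beta> \<in> B \<rightarrow> carrier (free_Abelian_group (carrier G))}"

definition N_group ::
    "('g, 'm) monoid_scheme \<Rightarrow> 'i set \<Rightarrow> 'i set \<Rightarrow> ('i \<Rightarrow> 'g)
       \<Rightarrow> ('g, 'i) triple_tensor set monoid" where
  "N_group G A B \<mu> =
     M_group G A B Mod (A_subgroup G A B \<mu> <#>\<^bsub>M_group G A B\<^esub> B_subgroup G A B \<mu>)"

definition generating_data ::
    "('g, 'm) monoid_scheme \<Rightarrow> 'i set \<Rightarrow> 'i set \<Rightarrow> ('i \<Rightarrow> 'g) \<Rightarrow> bool" where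
  "generating_data G A B \<mu> \<longleftrightarrow>
     finite A \<and> finite B \<and> \<mu> \<in> A \<union> B \<rightarrow> carrier G \<and>
     generate G (\<mu> ` A) = carrier G \<and> generate G (\<mu> ` B) = carrier G"

text \<open>Up to isomorphism the following group is independent of the generating data; \<open>T\<^sub>G\<close> denotes
  this group for any choice of them. It is therefore to be used with universally quantified
  generating data.\<close>

definition T_group ::
    "('g, 'm) monoid_scheme \<Rightarrow> 'i set \<Rightarrow> 'i set \<Rightarrow> ('i \<Rightarrow> 'g)
       \<Rightarrow> ('g, 'i) triple_tensor set monoid" where
  "T_group G A B \<mu> = torsion_subgroup (N_group G A B \<mu>)"

end

theory Submission
  imports Defs "HOL-Library.Function_Algebras"
begin

text \<open>
  Both groups of the theorem have the same shape.  Let a \<^emph>\<open>labelled graph\<close> be a space of edges, a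
  space of vertices, two maps \<open>p\<close> and \<open>q\<close> from edges to vertices and a \<open>G\<close>-valued label on the
  edges.  If a \<open>G\<close>-module is presented as a quotient \<open>V/D\<close>, with numerator \<open>V\<close> and denominator \<open>D\<close>, the
  graph yields a new presented module: the numerator consists of the locally constant functions from
  edges to \<open>V\<close>, the denominator is spanned by the functions with values in \<open>D\<close> and by the twisted
  coboundaries \<open>i \<mapsto> h (p i) - lab i \<cdot> h (q i)\<close>.  A system \<open>(X, \<phi>, \<xi>)\<close> is a graph whose edges and
  vertices are the points of \<open>X\<close>; a family \<open>\<mu>\<close> of elements of \<open>G\<close> is a graph with one vertex.
  Starting from \<open>\<int>[G]\<close>, regarded as the integer functions on \<open>G\<close>, and applying the construction
  twice gives \<open>Coinv(Z, \<omega>)\<close> for the graphs of \<open>(Y, \<psi>, \<eta>)\<close> and \<open>(X, \<phi>, \<xi>)\<close>, and \<open>\<N>(A, B)\<close> for the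
  graphs of \<open>B\<close> and \<open>A\<close> (\<open>coinvariants_iso_double_quotient\<close>, \<open>N_group_iso_double_quotient\<close>).

  The argument rests on a form of connectedness of the graph: a clopen set of pairs
  (vertex, group element) that is compatible with the edges is empty or everything.  For a system this
  is the minimality of the skew product, for a family of group elements it says that they generate
  \<open>G\<close>.  It implies that a function whose twisted coboundary vanishes in \<open>V/D\<close>, or modulo \<open>n\<close> in \<open>V/D\<close>, is
  constant there with a \<open>G\<close>-invariant value (\<open>invariant_mod_constant\<close>).

  Suppose \<open>V/D\<close> is torsion-free, and let \<open>w\<close> represent an \<open>n\<close>-torsion element of the new quotient, so
  that \<open>n w\<close> is modulo \<open>D\<close> the coboundary of some \<open>h\<close>.  This coboundary vanishes modulo \<open>n\<close>, hence \<open>h\<close> is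
  modulo \<open>n\<close> a \<open>G\<close>-invariant constant \<open>v\<close>; conversely, if \<open>v\<close> is invariant modulo \<open>n\<close>, then the
  coboundary of the constant function \<open>v\<close> is divisible by \<open>n\<close>.  In this way the torsion of the new quotient is the
  group of the elements of \<open>V/D\<close> invariant modulo \<open>n\<close>, divided by those that are congruent to
  invariant ones modulo \<open>n\<close>, where \<open>n\<close> is the order of \<open>G\<close>.  This group, which is \<open>H\<^sup>1(G, V/D)\<close>, does not
  mention the graph at all (\<open>torsion_quotient_iso\<close>, \<open>graph_torsion\<close>).  The same argument, together with
  \<open>H\<^sup>1(G, \<int>[G]) = 0\<close>, shows that one application of the construction to \<open>\<int>[G]\<close> gives a torsion-free
  quotient (\<open>pure_relations\<close>), so that a second application is possible.

  Consequently the outer of two graphs can be replaced by any other one without changing the torsion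
  (\<open>outer_graph_independent\<close>).  The construction is also symmetric in the two graphs, because a
  locally constant function of two variables on compact spaces can be curried in either order
  (\<open>double_quotient_swap\<close>).  Replacing \<open>X\<close> by \<open>B\<close>, exchanging the two factors, and replacing \<open>Y\<close> by
  \<open>A\<close> therefore leads from \<open>Coinv(Z, \<omega>)\<close> to \<open>\<N>(A, B)\<close>.
\<close>

section \<open>Additive subgroups and their quotients\<close>

definition subgroup_add :: "'v::ab_group_add set \<Rightarrow> bool" where
  "subgroup_add V \<longleftrightarrow> 0 \<in> V \<and> (\<forall>v\<in>V. \<forall>w\<in>V. v - w \<in> V)"

definition additive_group :: "'v::ab_group_add set \<Rightarrow> 'v monoid" where
  "additive_group V = \<lparr>carrier = V, monoid.mult = (+), one = 0\<rparr>"

text \<open>The quotient \<open>V/D\<close> is torsion-free.  The elements live in a ring so that \<open>of_nat n * v\<close> is available as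
  the \<open>n\<close>-fold multiple; all modules below are groups of integer-valued functions.\<close>

definition pure_in :: "'v::comm_ring_1 set \<Rightarrow> 'v set \<Rightarrow> bool" where
  "pure_in D V \<longleftrightarrow> (\<forall>n>0. \<forall>v\<in>V. of_nat n * v \<in> D \<longrightarrow> v \<in> D)"

lemma additive_group_simps [simp]:
  "carrier (additive_group V) = V"
  "x \<otimes>\<^bsub>additive_group V\<^esub> y = x + y"
  "\<one>\<^bsub>additive_group V\<^esub> = 0"
  by (simp_all add: additive_group_def)

lemma subgroup_addD:
  assumes "subgroup_add V"
  shows "0 \<in> V" "v \<in> V \<Longrightarrow> w \<in> V \<Longrightarrow> v - w \<in> V" "v \<in> V \<Longrightarrow> - v \<in> V"
    "v \<in> V \<Longrightarrow> w \<in> V \<Longrightarrow> v + w \<in> V"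
proof -
  have z: "0 \<in> V" and d: "\<And>v w. v \<in> V \<Longrightarrow> w \<in> V \<Longrightarrow> v - w \<in> V"
    using assms by (auto simp: subgroup_add_def)
  have m: "- v \<in> V" if "v \<in> V" for v
    using d[OF z that] by simp
  show "0 \<in> V" "v \<in> V \<Longrightarrow> w \<in> V \<Longrightarrow> v - w \<in> V" "v \<in> V \<Longrightarrow> - v \<in> V"
    by (fact z d m)+
  show "v \<in> V \<Longrightarrow> w \<in> V \<Longrightarrow> v + w \<in> V"
    using d[OF _ m, of v w] by simp
qed

lemma subgroup_add_of_nat_mult:
  fixes V :: "'v::comm_ring_1 set"
  assumes "subgroup_add V" "v \<in> V"
  shows "of_nat n * v \<in> V"
  by (induction n) (auto simp: algebra_simps intro: subgroup_addD[OF assms(1)] assms(2))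

lemma subgroup_add_sum:
  assumes "subgroup_add V" "\<And>x. x \<in> S \<Longrightarrow> f x \<in> V"
  shows "sum f S \<in> V"
  using assms by (induction S rule: infinite_finite_induct) (auto intro: subgroup_addD)

lemma subgroup_add_cancel:
  assumes "subgroup_add D" "d \<in> D"
  shows "d + x \<in> D \<longleftrightarrow> x \<in> D" "x + d \<in> D \<longleftrightarrow> x \<in> D"
proof -
  show "x + d \<in> D \<longleftrightarrow> x \<in> D"
    using subgroup_addD(2)[OF assms(1) _ assms(2), of "x + d"]
      subgroup_addD(4)[OF assms(1) _ assms(2), of x] by auto
  then show "d + x \<in> D \<longleftrightarrow> x \<in> D" by (simp add: add.commute)
qed

lemma comm_group_additive_group:
  assumes "subgroup_add V" shows "comm_group (additive_group V)"
proof (rule comm_groupI)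
  fix x assume "x \<in> carrier (additive_group V)"
  then show "\<exists>y\<in>carrier (additive_group V). y \<otimes>\<^bsub>additive_group V\<^esub> x = \<one>\<^bsub>additive_group V\<^esub>"
    using subgroup_addD(3)[OF assms] by (intro bexI[of _ "- x"]) simp_all
qed (simp_all add: subgroup_addD[OF assms] add_ac)

lemma inv_additive_group:
  assumes "subgroup_add V" "v \<in> V" shows "inv\<^bsub>additive_group V\<^esub> v = - v"
proof -
  interpret comm_group "additive_group V" by (rule comm_group_additive_group) fact
  show ?thesis
    by (rule inv_equality) (simp_all add: subgroup_addD[OF assms(1)] assms(2))
qed

lemma subgroup_additive_group:
  assumes "subgroup_add V" "subgroup_add D" "D \<subseteq> V"
  shows "subgroup D (additive_group V)"
proof -
  interpret comm_group "additive_group V" by (rule comm_group_additive_group) fact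
  show ?thesis
    using subgroup_addD[OF assms(2)] assms
    by (intro subgroupI) (auto simp: inv_additive_group subset_iff)
qed

lemma normal_additive_group:
  assumes "subgroup_add V" "subgroup_add D" "D \<subseteq> V"
  shows "D \<lhd> additive_group V"
proof -
  interpret comm_group "additive_group V" by (rule comm_group_additive_group) fact
  show ?thesis by (rule subgroup_imp_normal) (rule subgroup_additive_group[OF assms])
qed

lemma pow_additive_group:
  fixes V :: "'v::comm_ring_1 set"
  shows "v [^]\<^bsub>additive_group V\<^esub> n = of_nat n * v"
  by (induction n) (auto simp: nat_pow_def algebra_simps)

lemma coset_eq_iff:
  assumes "subgroup_add V" "subgroup_add D" "D \<subseteq> V" "v \<in> V" "w \<in> V"
  shows "D #>\<^bsub>additive_group V\<^esub> v = D #>\<^bsub>additive_group V\<^esub> w \<longleftrightarrow> v - w \<in> D"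
proof -
  have *: "x \<in> D #>\<^bsub>additive_group V\<^esub> y \<longleftrightarrow> x - y \<in> D" for x y
    by (force simp: r_coset_def)
  show ?thesis
  proof
    assume "D #>\<^bsub>additive_group V\<^esub> v = D #>\<^bsub>additive_group V\<^esub> w"
    then show "v - w \<in> D"
      using * [of v v] * [of v w] subgroup_addD(1)[OF assms(2)] by auto
  next
    assume d: "v - w \<in> D"
    have "x - v \<in> D \<longleftrightarrow> x - w \<in> D" for x
      using subgroup_add_cancel(2)[OF assms(2) d, of "x - v"] by simp
    then show "D #>\<^bsub>additive_group V\<^esub> v = D #>\<^bsub>additive_group V\<^esub> w"
      using * by blast
  qed
qed

lemma nat_pow_coset:
  assumes "N \<lhd> H" "x \<in> carrier H"
  shows "(N #>\<^bsub>H\<^esub> x) [^]\<^bsub>H Mod N\<^esub> (n::nat) = N #>\<^bsub>H\<^esub> (x [^]\<^bsub>H\<^esub> n)"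
proof -
  interpret normal N H by fact
  have "(\<lambda>a. N #>\<^bsub>H\<^esub> a) \<in> hom H (H Mod N)"
    by (rule r_coset_hom_Mod)
  then interpret group_hom H "H Mod N" "\<lambda>a. N #>\<^bsub>H\<^esub> a"
    using factorgroup_is_group is_group by (auto simp: group_hom_def group_hom_axioms_def)
  show ?thesis using assms hom_nat_pow by simp
qed

lemma torsion_carrier_Mod:
  fixes W :: "'w::comm_ring_1 set"
  assumes "subgroup_add W" "subgroup_add E" "E \<subseteq> W"
  shows "carrier (torsion_subgroup (additive_group W Mod E)) =
    {E #>\<^bsub>additive_group W\<^esub> w | w. w \<in> W \<and> (\<exists>n>0. of_nat n * w \<in> E)}"
proof -
  note N = normal_additive_group[OF assms]
  interpret normal E "additive_group W" by fact
  have "(E #>\<^bsub>additive_group W\<^esub> w) [^]\<^bsub>additive_group W Mod E\<^esub> n = \<one>\<^bsub>additive_group W Mod E\<^esub>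
     \<longleftrightarrow> of_nat n * w \<in> E" if "w \<in> W" for w and n :: nat
  proof -
    have "of_nat n * w \<in> W" by (rule subgroup_add_of_nat_mult) (fact+)
    moreover have "\<one>\<^bsub>additive_group W Mod E\<^esub> = E #>\<^bsub>additive_group W\<^esub> 0"
      unfolding r_coset_def FactGroup_def by simp
    ultimately show ?thesis
      using that assms(1) coset_eq_iff[OF assms, of "of_nat n * w" 0] subgroup_addD(1)[OF assms(1)]
      by (simp add: nat_pow_coset[OF N] pow_additive_group)
  qed
  then have *: "(\<exists>n>0. (E #>\<^bsub>additive_group W\<^esub> w) [^]\<^bsub>additive_group W Mod E\<^esub> (n::nat)
      = \<one>\<^bsub>additive_group W Mod E\<^esub>) \<longleftrightarrow> (\<exists>n>0. of_nat n * w \<in> E)" if "w \<in> W" for w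
    using that by blast
  have "carrier (additive_group W Mod E) = (\<lambda>w. E #>\<^bsub>additive_group W\<^esub> w) ` W"
    by (auto simp: FactGroup_def RCOSETS_def)
  then have "carrier (torsion_subgroup (additive_group W Mod E)) =
    (\<lambda>w. E #>\<^bsub>additive_group W\<^esub> w) ` {w \<in> W. \<exists>n>0. (E #>\<^bsub>additive_group W\<^esub> w)
      [^]\<^bsub>additive_group W Mod E\<^esub> (n::nat) = \<one>\<^bsub>additive_group W Mod E\<^esub>}"
    unfolding torsion_subgroup_def by auto
  also have "\<dots> = (\<lambda>w. E #>\<^bsub>additive_group W\<^esub> w) ` {w \<in> W. \<exists>n>0. of_nat n * w \<in> E}"
    using * by (intro image_cong) auto
  finally show ?thesis by auto
qed

lemma torsion_subgroup_iso:
  assumes "group H" "group K" "H \<cong> K"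
  shows "torsion_subgroup H \<cong> torsion_subgroup K"
proof -
  obtain h where h: "h \<in> iso H K" using assms(3) by (auto simp: is_iso_def)
  then interpret group_hom H K h
    using assms by (auto simp: group_hom_def group_hom_axioms_def iso_def)
  have inj: "inj_on h (carrier H)" and surj: "h ` carrier H = carrier K"
    using h by (auto simp: iso_def bij_betw_def)
  have tors: "x [^]\<^bsub>H\<^esub> n = \<one>\<^bsub>H\<^esub> \<longleftrightarrow> h x [^]\<^bsub>K\<^esub> n = \<one>\<^bsub>K\<^esub>" if "x \<in> carrier H" for x and n :: nat
    using that inj hom_nat_pow[OF that, of n] by (metis G.nat_pow_closed G.one_closed hom_one inj_on_def)
  have "h ` {x \<in> carrier H. \<exists>n::nat. n > 0 \<and> x [^]\<^bsub>H\<^esub> n = \<one>\<^bsub>H\<^esub>} =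
    {x \<in> carrier K. \<exists>n::nat. n > 0 \<and> x [^]\<^bsub>K\<^esub> n = \<one>\<^bsub>K\<^esub>}"
    unfolding surj[symmetric] using tors by blast
  then have "h \<in> iso (torsion_subgroup H) (torsion_subgroup K)"
    using inj tors by (auto simp: torsion_subgroup_def iso_def hom_def bij_betw_def inj_on_def)
  then show ?thesis by (auto simp: is_iso_def)
qed

lemma Mod_iso:
  assumes "group H" "comm_group K" "h \<in> iso H K" "N \<subseteq> carrier H" "subgroup (h ` N) K"
  shows "H Mod N \<cong> K Mod (h ` N)"
proof -
  interpret K: comm_group K by fact
  have n: "h ` N \<lhd> K" by (rule K.subgroup_imp_normal) fact
  interpret n: normal "h ` N" K by fact
  have inj: "inj_on h (carrier H)" and surj: "h ` carrier H = carrier K" and hom: "h \<in> hom H K"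
    using assms(3) by (auto simp: iso_def bij_betw_def)
  define f where "f x = h ` N #>\<^bsub>K\<^esub> h x" for x
  have "f \<in> hom H (K Mod h ` N)"
    using hom_compose[OF hom n.r_coset_hom_Mod] by (simp add: f_def[abs_def] comp_def)
  then interpret f: group_hom H "K Mod h ` N" f
    using assms n.factorgroup_is_group by (auto simp: group_hom_def group_hom_axioms_def)
  have "carrier (K Mod h ` N) = (\<lambda>y. h ` N #>\<^bsub>K\<^esub> y) ` h ` carrier H"
    unfolding surj by (auto simp: FactGroup_def RCOSETS_def)
  then have "f ` carrier H = carrier (K Mod h ` N)"
    by (simp add: image_image f_def)
  then have iso: "H Mod kernel H (K Mod h ` N) f \<cong> K Mod h ` N"
    by (rule f.FactGroup_iso)
  have "f x = \<one>\<^bsub>K Mod h ` N\<^esub> \<longleftrightarrow> x \<in> N" if "x \<in> carrier H" for x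
  proof -
    have hx: "h x \<in> carrier K" using that surj by auto
    have "f x = h ` N \<longleftrightarrow> h x \<in> h ` N"
      unfolding f_def using K.coset_join1 K.coset_join2 assms(5) hx
      by (meson subgroup.subset)
    also have "\<dots> \<longleftrightarrow> x \<in> N"
      using inj that assms(4) by (auto simp: inj_on_def subset_iff)
    finally show ?thesis by (simp add: FactGroup_def)
  qed
  then have "kernel H (K Mod h ` N) f = N"
    using assms(4) by (auto simp: kernel_def)
  then show ?thesis using iso by simp
qed

section \<open>Torsion of a quotient and invariants modulo the group order\<close>

text \<open>A \<open>G\<close>-module without torsion, presented as \<open>V/D\<close>.  Working with representatives in \<open>V\<close> instead of
  cosets keeps iterated quotients inside ordinary function types.\<close>

locale torsion_free_module = comm_group G for G :: "('g, 'm) monoid_scheme" (structure) +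
  fixes V D :: "'v::comm_ring_1 set" and act :: "'g \<Rightarrow> 'v \<Rightarrow> 'v"
  assumes finite_G: "finite (carrier G)"
    and V: "subgroup_add V" and D: "subgroup_add D" and D_subset: "D \<subseteq> V"
    and pure: "pure_in D V"
    and act_V: "\<And>k v. k \<in> carrier G \<Longrightarrow> v \<in> V \<Longrightarrow> act k v \<in> V"
    and act_D: "\<And>k v. k \<in> carrier G \<Longrightarrow> v \<in> D \<Longrightarrow> act k v \<in> D"
    and act_diff: "\<And>k v w. k \<in> carrier G \<Longrightarrow> v \<in> V \<Longrightarrow> w \<in> V \<Longrightarrow> act k (v - w) = act k v - act k w"
    and act_act: "\<And>k l v. k \<in> carrier G \<Longrightarrow> l \<in> carrier G \<Longrightarrow> v \<in> V \<Longrightarrow> act k (act l v) = act (k \<otimes> l) v"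
    and act_one: "\<And>v. v \<in> V \<Longrightarrow> act \<one> v = v"
begin

lemma act_zero: "k \<in> carrier G \<Longrightarrow> act k 0 = 0"
  using act_diff[of k 0 0] subgroup_addD(1)[OF V] by simp

lemma act_uminus: "k \<in> carrier G \<Longrightarrow> v \<in> V \<Longrightarrow> act k (- v) = - act k v"
  using act_diff[of k 0 v] subgroup_addD(1)[OF V] by (simp add: act_zero)

lemma act_add: "k \<in> carrier G \<Longrightarrow> v \<in> V \<Longrightarrow> w \<in> V \<Longrightarrow> act k (v + w) = act k v + act k w"
  using act_diff[of k v "- w"] by (simp add: act_uminus subgroup_addD[OF V])

lemma act_sum:
  "k \<in> carrier G \<Longrightarrow> (\<And>x. x \<in> S \<Longrightarrow> f x \<in> V) \<Longrightarrow> act k (sum f S) = (\<Sum>x\<in>S. act k (f x))"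
  by (induction S rule: infinite_finite_induct)
    (simp_all add: act_zero act_add subgroup_add_sum[OF V])

lemma of_nat_mult_V: "v \<in> V \<Longrightarrow> of_nat n * v \<in> V"
  by (rule subgroup_add_of_nat_mult[OF V])

lemma act_of_nat_mult: "k \<in> carrier G \<Longrightarrow> v \<in> V \<Longrightarrow> act k (of_nat n * v) = of_nat n * act k v"
  by (induction n) (simp_all add: act_zero act_add of_nat_mult_V distrib_right)

text \<open>Congruence modulo \<open>n\<close> in \<open>V/D\<close>.  The case \<open>n = 0\<close> is included on purpose: it is equality in \<open>V/D\<close>, so
  that \<open>invariants_mod 0\<close> below consists of the representatives of the invariants of \<open>V/D\<close>, and
  statements about divisibility and about vanishing can be proved together.\<close>

definition cong_mod :: "nat \<Rightarrow> 'v \<Rightarrow> 'v \<Rightarrow> bool" where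
  "cong_mod n v w \<longleftrightarrow> (\<exists>u\<in>V. v - w - of_nat n * u \<in> D)"

definition invariants_mod :: "nat \<Rightarrow> 'v set" where
  "invariants_mod n = {v \<in> V. \<forall>k\<in>carrier G. cong_mod n v (act k v)}"

text \<open>The elements congruent modulo \<open>n\<close> to an invariant of \<open>V/D\<close>.  From the exact sequence of
  multiplication by \<open>n\<close> on \<open>V/D\<close>, the quotient of \<open>invariants_mod n\<close> by \<open>liftable_mod n\<close> is the
  \<open>n\<close>-torsion of \<open>H\<^sup>1(G, V/D)\<close>.\<close>

definition liftable_mod :: "nat \<Rightarrow> 'v set" where
  "liftable_mod n = {v \<in> V. \<exists>u\<in>V. v - of_nat n * u \<in> invariants_mod 0}"

lemma cong_mod_zero: "cong_mod 0 v w \<longleftrightarrow> v - w \<in> D"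
  using subgroup_addD(1)[OF V] by (auto simp: cong_mod_def)

lemma cong_mod_refl: "cong_mod n v v"
  unfolding cong_mod_def using subgroup_addD(1)[OF V] subgroup_addD(1)[OF D]
  by (intro bexI[of _ 0]) auto

lemma cong_mod_sym:
  assumes "cong_mod n v w" shows "cong_mod n w v"
proof -
  obtain u where u: "u \<in> V" "v - w - of_nat n * u \<in> D"
    using assms by (auto simp: cong_mod_def)
  have "w - v - of_nat n * (- u) = - (v - w - of_nat n * u)" by (simp add: algebra_simps)
  with u show ?thesis
    unfolding cong_mod_def using subgroup_addD(3)[OF V] subgroup_addD(3)[OF D] by metis
qed

lemma cong_mod_add:
  assumes "cong_mod n v w" "cong_mod n v' w'" shows "cong_mod n (v + v') (w + w')"
proof -
  obtain u u' where u: "u \<in> V" "v - w - of_nat n * u \<in> D" "u' \<in> V" "v' - w' - of_nat n * u' \<in> D"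
    using assms by (auto simp: cong_mod_def)
  have "(v + v') - (w + w') - of_nat n * (u + u') = (v - w - of_nat n * u) + (v' - w' - of_nat n * u')"
    by (simp add: algebra_simps)
  with u show ?thesis
    unfolding cong_mod_def using subgroup_addD(4)[OF V] subgroup_addD(4)[OF D] by metis
qed

lemma cong_mod_trans:
  assumes "cong_mod n v w" "cong_mod n w z" shows "cong_mod n v z"
  using cong_mod_add[OF assms] by (simp add: cong_mod_def algebra_simps)

lemma cong_mod_act:
  assumes "cong_mod n v w" "v \<in> V" "w \<in> V" "k \<in> carrier G"
  shows "cong_mod n (act k v) (act k w)"
proof -
  obtain u where u: "u \<in> V" "v - w - of_nat n * u \<in> D"
    using assms by (auto simp: cong_mod_def)
  have "act k (v - w - of_nat n * u) = act k v - act k w - of_nat n * act k u"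
    using u assms by (simp add: act_diff subgroup_addD[OF V] of_nat_mult_V act_of_nat_mult)
  with u assms show ?thesis
    unfolding cong_mod_def using act_D[OF assms(4) u(2)] act_V[OF assms(4) u(1)] by metis
qed

lemma D_invariant: "D \<subseteq> invariants_mod 0"
  using D_subset by (auto simp: invariants_mod_def cong_mod_zero intro: subgroup_addD[OF D] act_D)

lemma invariants_mod_0_iff: "v \<in> invariants_mod 0 \<longleftrightarrow> v \<in> V \<and> (\<forall>k\<in>carrier G. v - act k v \<in> D)"
  by (simp add: invariants_mod_def cong_mod_zero)

lemma subgroup_invariants_mod: "subgroup_add (invariants_mod n)"
  unfolding subgroup_add_def
proof (intro conjI ballI)
  show "0 \<in> invariants_mod n"
    by (auto simp: invariants_mod_def act_zero cong_mod_refl subgroup_addD[OF V])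
  fix v w assume vw: "v \<in> invariants_mod n" "w \<in> invariants_mod n"
  have "cong_mod n (v - w) (act k (v - w))" if k: "k \<in> carrier G" for k
  proof -
    have "cong_mod n v (act k v)" "cong_mod n (act k w) w"
      using vw k by (auto simp: invariants_mod_def intro: cong_mod_sym)
    then have "cong_mod n (v + act k w) (act k v + w)" by (rule cong_mod_add)
    moreover have "v - w - act k (v - w) = v + act k w - (act k v + w)"
      using vw k by (simp add: act_diff invariants_mod_def)
    ultimately show ?thesis unfolding cong_mod_def by (simp only:)
  qed
  then show "v - w \<in> invariants_mod n"
    using vw by (auto simp: invariants_mod_def intro: subgroup_addD[OF V])
qed

lemma subgroup_liftable_mod: "subgroup_add (liftable_mod n)"
  unfolding subgroup_add_def
proof (intro conjI ballI)
  show "0 \<in> liftable_mod n"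
    using subgroup_addD(1)[OF V] subgroup_addD(1)[OF subgroup_invariants_mod]
    by (auto simp: liftable_mod_def intro!: bexI[of _ 0])
  fix v w assume vw: "v \<in> liftable_mod n" "w \<in> liftable_mod n"
  then obtain x y where xy: "x \<in> V" "v - of_nat n * x \<in> invariants_mod 0"
    "y \<in> V" "w - of_nat n * y \<in> invariants_mod 0" by (auto simp: liftable_mod_def)
  have "v - w - of_nat n * (x - y) = (v - of_nat n * x) - (w - of_nat n * y)"
    by (simp add: algebra_simps)
  moreover have "(v - of_nat n * x) - (w - of_nat n * y) \<in> invariants_mod 0"
    by (rule subgroup_addD(2)[OF subgroup_invariants_mod xy(2,4)])
  ultimately have "v - w - of_nat n * (x - y) \<in> invariants_mod 0" by (simp only:)
  with vw xy show "v - w \<in> liftable_mod n"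
    unfolding liftable_mod_def using subgroup_addD(2)[OF V] by blast
qed

lemma norm_invariant:
  assumes "v \<in> V" shows "(\<Sum>k\<in>carrier G. act k v) \<in> invariants_mod 0"
proof -
  have "act l (\<Sum>k\<in>carrier G. act k v) = (\<Sum>k\<in>carrier G. act k v)" if l: "l \<in> carrier G" for l
  proof -
    have "act l (\<Sum>k\<in>carrier G. act k v) = (\<Sum>k\<in>carrier G. act (l \<otimes> k) v)"
      using l assms by (simp add: act_sum act_V act_act)
    also have "\<dots> = (\<Sum>k\<in>carrier G. act k v)"
      by (rule sum.reindex_bij_witness[where i = "\<lambda>k. inv l \<otimes> k" and j = "\<lambda>k. l \<otimes> k"])
        (use l in \<open>auto simp: m_assoc[symmetric]\<close>)
    finally show ?thesis .
  qed
  then show ?thesis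
    using assms by (auto simp: invariants_mod_def cong_mod_refl act_V intro: subgroup_add_sum[OF V])
qed

lemma liftable_subset: "liftable_mod n \<subseteq> invariants_mod n"
proof
  fix v assume "v \<in> liftable_mod n"
  then obtain u where u: "v \<in> V" "u \<in> V" "v - of_nat n * u \<in> invariants_mod 0"
    by (auto simp: liftable_mod_def)
  have "cong_mod n v (act k v)" if k: "k \<in> carrier G" for k
  proof -
    have "v - act k v - of_nat n * (u - act k u) = (v - of_nat n * u) - act k (v - of_nat n * u)"
    proof -
      have "act k (v - of_nat n * u) = act k v - of_nat n * act k u"
        using u k by (simp add: act_diff act_of_nat_mult of_nat_mult_V)
      then show ?thesis by (simp add: algebra_simps)
    qed
    also have "\<dots> \<in> D" using u(3) k by (simp add: invariants_mod_0_iff)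
    finally show ?thesis
      using subgroup_addD(2)[OF V u(2) act_V[OF k u(2)]] by (auto simp: cong_mod_def)
  qed
  then show "v \<in> invariants_mod n" using u by (auto simp: invariants_mod_def)
qed

text \<open>This is the fact that the order \<open>N\<close> of \<open>G\<close> annihilates \<open>H\<^sup>1\<close>, in terms of representatives.  If
  \<open>v - k \<cdot> v\<close> is in \<open>V/D\<close> equal to \<open>m\<close> times \<open>u k\<close> for every \<open>k\<close>, then summing over \<open>k\<close> shows that \<open>N v\<close> is \<open>m\<close> times
  \<open>w = (\<Sum>k. u k)\<close> plus the norm of \<open>v\<close>.  The norm is invariant; comparing \<open>w\<close> with its translates and
  cancelling \<open>m\<close> shows that \<open>w\<close> is invariant modulo \<open>N\<close>.\<close>

lemma change_modulus:
  assumes v: "v \<in> invariants_mod m" and m: "m > 0"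
  obtains w where "w \<in> invariants_mod (card (carrier G))"
    "of_nat (card (carrier G)) * v - of_nat m * w \<in> invariants_mod 0"
proof -
  let ?N = "card (carrier G)"
  have vV: "v \<in> V" using v by (simp add: invariants_mod_def)
  have "\<forall>k\<in>carrier G. \<exists>u. u \<in> V \<and> v - act k v - of_nat m * u \<in> D"
    using v by (auto simp: invariants_mod_def cong_mod_def)
  then obtain u where u: "\<And>k. k \<in> carrier G \<Longrightarrow> u k \<in> V"
    and uD: "\<And>k. k \<in> carrier G \<Longrightarrow> v - act k v - of_nat m * u k \<in> D" by metis
  define w where "w = (\<Sum>k\<in>carrier G. u k)"
  define s where "s = of_nat ?N * v - of_nat m * w"
  have wV: "w \<in> V" unfolding w_def by (rule subgroup_add_sum[OF V]) (fact u)
  have "s - (\<Sum>k\<in>carrier G. act k v) = (\<Sum>k\<in>carrier G. v - act k v - of_nat m * u k)"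
    by (simp add: s_def w_def sum_subtractf sum_distrib_left)
  also have "\<dots> \<in> D" by (rule subgroup_add_sum[OF D]) (fact uD)
  finally have "s - (\<Sum>k\<in>carrier G. act k v) + (\<Sum>k\<in>carrier G. act k v) \<in> invariants_mod 0"
    using D_invariant norm_invariant[OF vV] by (blast intro: subgroup_addD(4)[OF subgroup_invariants_mod])
  then have s: "s \<in> invariants_mod 0" by simp
  have "cong_mod ?N w (act k w)" if k: "k \<in> carrier G" for k
  proof -
    let ?t = "w - act k w - of_nat ?N * u k"
    have "of_nat m * ?t = of_nat ?N * (v - act k v - of_nat m * u k) - (s - act k s)"
    proof -
      have "act k s = of_nat ?N * act k v - of_nat m * act k w"
        using k vV wV by (simp add: s_def act_diff act_of_nat_mult of_nat_mult_V)
      then show ?thesis by (simp add: s_def algebra_simps)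
    qed
    also have "\<dots> \<in> D"
    proof (rule subgroup_addD(2)[OF D])
      show "of_nat ?N * (v - act k v - of_nat m * u k) \<in> D"
        by (rule subgroup_add_of_nat_mult[OF D uD[OF k]])
      show "s - act k s \<in> D" using s k by (simp add: invariants_mod_0_iff)
    qed
    finally have "?t \<in> D"
      using pure m k wV u[OF k] unfolding pure_in_def
      by (meson act_V of_nat_mult_V subgroup_addD(2)[OF V])
    then show ?thesis using u[OF k] by (auto simp: cong_mod_def)
  qed
  then have "w \<in> invariants_mod ?N" using wV by (simp add: invariants_mod_def)
  then show thesis using s that unfolding s_def by blast
qed

text \<open>The torsion of \<open>W/E\<close> is read off from \<open>V/D\<close> as follows.  An element \<open>v\<close> that is invariant modulo \<open>N\<close>
  has an image \<open>\<delta> v\<close> that is divisible by \<open>N\<close> modulo \<open>W\<^sub>0\<close>, and the class of the quotient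
  \<open>\<delta> v / N\<close> is a torsion element since \<open>\<delta> v\<close> is a relation.  The assumption \<open>lift\<close> says that all
  torsion of order \<open>n\<close> is of this form with \<open>N\<close> replaced by \<open>n\<close>, and the preceding lemma turns \<open>n\<close>
  into \<open>N\<close>.  The assumption \<open>kern\<close> identifies the kernel.  In the application \<open>W\<close> consists of the
  \<open>V\<close>-valued functions on the edges of a graph, \<open>W\<^sub>0\<close> of the \<open>D\<close>-valued ones, and \<open>\<delta> v\<close> is the
  coboundary of the constant function \<open>v\<close>.\<close>

theorem torsion_quotient_iso:
  fixes W W\<^sub>0 E :: "'w::comm_ring_1 set" and \<delta> :: "'v \<Rightarrow> 'w"
  defines "N \<equiv> card (carrier G)"
  assumes W: "subgroup_add W" and E: "subgroup_add E" and W\<^sub>0: "subgroup_add W\<^sub>0"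
    and W\<^sub>0E: "W\<^sub>0 \<subseteq> E" and EW: "E \<subseteq> W" and pureW: "pure_in W\<^sub>0 W"
    and \<delta>E: "\<And>v. v \<in> V \<Longrightarrow> \<delta> v \<in> E"
    and \<delta>diff: "\<And>v w. v \<in> V \<Longrightarrow> w \<in> V \<Longrightarrow> \<delta> (v - w) = \<delta> v - \<delta> w"
    and \<delta>inv: "\<And>v. v \<in> invariants_mod 0 \<Longrightarrow> \<delta> v \<in> W\<^sub>0"
    and \<delta>div: "\<And>v n. v \<in> invariants_mod n \<Longrightarrow> \<exists>w\<in>W. of_nat n * w - \<delta> v \<in> W\<^sub>0"
    and lift: "\<And>w n. n > 0 \<Longrightarrow> w \<in> W \<Longrightarrow> of_nat n * w \<in> E \<Longrightarrow>
       \<exists>v\<in>invariants_mod n. \<exists>e\<in>E. of_nat n * w - \<delta> v - of_nat n * e \<in> W\<^sub>0"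
    and kern: "\<And>e v n. e \<in> E \<Longrightarrow> v \<in> V \<Longrightarrow> of_nat n * e - \<delta> v \<in> W\<^sub>0 \<Longrightarrow> v \<in> liftable_mod n"
  shows "additive_group (invariants_mod N) Mod liftable_mod N \<cong>
    torsion_subgroup (additive_group W Mod E)"
proof -
  let ?I = "additive_group (invariants_mod N)" and ?Q = "additive_group W Mod E"
  note IV = subgroup_invariants_mod[of N]
  have N0: "N > 0" unfolding N_def using finite_G by (simp add: card_gt_0_iff) blast
  have \<delta>W: "\<delta> v \<in> W" if "v \<in> V" for v using \<delta>E EW that by blast
  have \<delta>0: "\<delta> 0 = 0" using \<delta>diff[of 0 0] subgroup_addD(1)[OF V] by simp
  have \<delta>m: "\<delta> (- v) = - \<delta> v" if "v \<in> V" for v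
    using \<delta>diff[of 0 v] subgroup_addD(1)[OF V] that by (simp add: \<delta>0)
  have \<delta>add: "\<delta> (v + w) = \<delta> v + \<delta> w" if "v \<in> V" "w \<in> V" for v w
    using \<delta>diff[of v "- w"] subgroup_addD(3)[OF V] that by (simp add: \<delta>m)
  have \<delta>n: "\<delta> (of_nat n * v) = of_nat n * \<delta> v" if "v \<in> V" for v and n :: nat
    using that by (induction n) (simp_all add: \<delta>0 \<delta>add of_nat_mult_V distrib_right)
  have Inv_V: "v \<in> V" if "v \<in> invariants_mod n" for v n
    using that by (simp add: invariants_mod_def)
  \<comment> \<open>Division by \<open>N\<close> is single-valued modulo \<open>W\<^sub>0\<close> because the latter is pure.\<close>
  have unique: "x \<in> W\<^sub>0" if "x \<in> W" "of_nat n * x \<in> W\<^sub>0" "n > 0" for x and n :: nat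
    using pureW that by (auto simp: pure_in_def)
  define r where "r v = (SOME w. w \<in> W \<and> of_nat N * w - \<delta> v \<in> W\<^sub>0)" for v
  have r: "r v \<in> W" "of_nat N * r v - \<delta> v \<in> W\<^sub>0" if "v \<in> invariants_mod N" for v
    using someI_ex[of "\<lambda>w. w \<in> W \<and> of_nat N * w - \<delta> v \<in> W\<^sub>0"] \<delta>div[OF that]
    unfolding r_def by blast+
  have r_eq: "r v - w \<in> W\<^sub>0" if "v \<in> invariants_mod N" "w \<in> W" "of_nat N * w - \<delta> v \<in> W\<^sub>0" for v w
  proof (rule unique[OF _ _ N0])
    show "r v - w \<in> W" using r[OF that(1)] that(2) by (intro subgroup_addD(2)[OF W])
    have "of_nat N * (r v - w) = (of_nat N * r v - \<delta> v) - (of_nat N * w - \<delta> v)"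
      by (simp add: algebra_simps)
    then show "of_nat N * (r v - w) \<in> W\<^sub>0"
      using r[OF that(1)] that(3) subgroup_addD(2)[OF W\<^sub>0] by metis
  qed
  define f where "f v = E #>\<^bsub>additive_group W\<^esub> r v" for v
  have f_eq: "f v = E #>\<^bsub>additive_group W\<^esub> w"
    if "v \<in> invariants_mod N" "w \<in> W" "of_nat N * w - \<delta> v \<in> W\<^sub>0" for v w
    unfolding f_def using coset_eq_iff[OF W E EW r(1)[OF that(1)] that(2)] r_eq[OF that] W\<^sub>0E
    by blast
  interpret I: comm_group ?I by (rule comm_group_additive_group) (fact IV)
  interpret normal E "additive_group W" by (rule normal_additive_group[OF W E EW])
  have "f \<in> hom ?I ?Q"
  proof (rule homI)
    fix v assume "v \<in> carrier ?I"
    then show "f v \<in> carrier ?Q"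
      using r(1)[of v] by (auto simp: f_def FactGroup_def RCOSETS_def)
  next
    fix v w assume "v \<in> carrier ?I" "w \<in> carrier ?I"
    then have v: "v \<in> invariants_mod N" and w: "w \<in> invariants_mod N" by auto
    have "f (v + w) = E #>\<^bsub>additive_group W\<^esub> (r v + r w)"
    proof (rule f_eq)
      show "v + w \<in> invariants_mod N" "r v + r w \<in> W"
        using v w r(1) subgroup_addD(4)[OF IV] subgroup_addD(4)[OF W] by auto
      have "of_nat N * (r v + r w) - \<delta> (v + w) = (of_nat N * r v - \<delta> v) + (of_nat N * r w - \<delta> w)"
        using v w by (simp add: \<delta>add Inv_V algebra_simps)
      then show "of_nat N * (r v + r w) - \<delta> (v + w) \<in> W\<^sub>0"
        using r(2) v w subgroup_addD(4)[OF W\<^sub>0] by metis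
    qed
    also have "\<dots> = f v \<otimes>\<^bsub>?Q\<^esub> f w"
      unfolding f_def using v w r(1) by (simp add: FactGroup_def rcos_sum)
    finally show "f (v \<otimes>\<^bsub>?I\<^esub> w) = f v \<otimes>\<^bsub>?Q\<^esub> f w" by simp
  qed
  then interpret f: group_hom ?I ?Q f
    using factorgroup_is_group I.is_group by (auto simp: group_hom_def group_hom_axioms_def)
  have img: "f ` invariants_mod N = carrier (torsion_subgroup ?Q)"
    unfolding torsion_carrier_Mod[OF W E EW]
  proof (intro equalityI subsetI)
    fix c assume "c \<in> f ` invariants_mod N"
    then obtain v where v: "v \<in> invariants_mod N" "c = f v" by auto
    have "of_nat N * r v = (of_nat N * r v - \<delta> v) + \<delta> v" by simp
    also have "\<dots> \<in> E"
      using r(2)[OF v(1)] W\<^sub>0E \<delta>E[OF Inv_V[OF v(1)]] by (intro subgroup_addD(4)[OF E]) auto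
    finally show "c \<in> {E #>\<^bsub>additive_group W\<^esub> w | w. w \<in> W \<and> (\<exists>n>0. of_nat n * w \<in> E)}"
      using v r(1)[OF v(1)] N0 unfolding f_def by blast
  next
    fix c assume "c \<in> {E #>\<^bsub>additive_group W\<^esub> w | w. w \<in> W \<and> (\<exists>n>0. of_nat n * w \<in> E)}"
    then obtain w and m :: nat where w: "c = E #>\<^bsub>additive_group W\<^esub> w" "w \<in> W" "m > 0" "of_nat m * w \<in> E"
      by auto
    obtain v e where v: "v \<in> invariants_mod m" "e \<in> E" "of_nat m * w - \<delta> v - of_nat m * e \<in> W\<^sub>0"
      using lift[OF w(3,2,4)] by blast
    obtain v' where v': "v' \<in> invariants_mod N" "of_nat N * v - of_nat m * v' \<in> invariants_mod 0"
      using change_modulus[OF v(1) w(3)] unfolding N_def by blast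
    have weW: "w - e \<in> W" using subsetD[OF EW v(2)] w(2) by (intro subgroup_addD(2)[OF W])
    have "of_nat N * (w - e) - \<delta> v' \<in> W\<^sub>0"
    proof (rule unique[OF _ _ w(3)])
      show "of_nat N * (w - e) - \<delta> v' \<in> W"
        by (rule subgroup_addD(2)[OF W subgroup_add_of_nat_mult[OF W weW] \<delta>W[OF Inv_V[OF v'(1)]]])
      have "\<delta> (of_nat N * v - of_nat m * v') = of_nat N * \<delta> v - of_nat m * \<delta> v'"
        using Inv_V[OF v'(1)] Inv_V[OF v(1)] by (simp add: \<delta>diff \<delta>n of_nat_mult_V)
      then have "of_nat m * (of_nat N * (w - e) - \<delta> v') =
        of_nat N * (of_nat m * w - \<delta> v - of_nat m * e) + \<delta> (of_nat N * v - of_nat m * v')"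
        by (simp add: algebra_simps)
      also have "\<dots> \<in> W\<^sub>0"
        using v(3) \<delta>inv[OF v'(2)] by (intro subgroup_addD(4)[OF W\<^sub>0] subgroup_add_of_nat_mult[OF W\<^sub>0])
      finally show "of_nat m * (of_nat N * (w - e) - \<delta> v') \<in> W\<^sub>0" .
    qed
    then have "f v' = E #>\<^bsub>additive_group W\<^esub> (w - e)" by (rule f_eq[OF v'(1) weW])
    also have "\<dots> = c"
      unfolding w(1) using coset_eq_iff[OF W E EW weW w(2)] subgroup_addD(3)[OF E v(2)] by simp
    finally show "c \<in> f ` invariants_mod N" using v'(1) by blast
  qed
  let ?T = "torsion_subgroup ?Q"
  have T: "?T = ?Q\<lparr>carrier := f ` carrier ?I\<rparr>"
    using img unfolding torsion_subgroup_def by simp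
  have "group ?T"
    unfolding T by (rule subgroup.subgroup_is_group[OF f.img_is_subgroup f.H.is_group])
  then interpret g: group_hom ?I ?T f
    using f.group_hom_axioms I.is_group
    by (auto simp: group_hom_def group_hom_axioms_def hom_def T)
  have one: "\<one>\<^bsub>?T\<^esub> = E" by (simp add: torsion_subgroup_def FactGroup_def)
  have "f v = E \<longleftrightarrow> v \<in> liftable_mod N" if v: "v \<in> invariants_mod N" for v
  proof
    assume "f v = E"
    then have "f v = E #>\<^bsub>additive_group W\<^esub> 0" by (simp add: r_coset_def)
    then have "r v \<in> E"
      unfolding f_def using coset_eq_iff[OF W E EW r(1)[OF v] subgroup_addD(1)[OF W]] by simp
    then show "v \<in> liftable_mod N" using r(2)[OF v] Inv_V[OF v] by (intro kern)
  next
    assume "v \<in> liftable_mod N"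
    then obtain u where u: "u \<in> V" "v - of_nat N * u \<in> invariants_mod 0"
      by (auto simp: liftable_mod_def)
    have "of_nat N * \<delta> u - \<delta> v = - \<delta> (v - of_nat N * u)"
      using u Inv_V[OF v] by (simp add: \<delta>diff \<delta>n of_nat_mult_V)
    then have "of_nat N * \<delta> u - \<delta> v \<in> W\<^sub>0"
      using subgroup_addD(3)[OF W\<^sub>0 \<delta>inv[OF u(2)]] by simp
    then have "f v = E #>\<^bsub>additive_group W\<^esub> \<delta> u" by (rule f_eq[OF v \<delta>W[OF u(1)]])
    also have "\<dots> = E #>\<^bsub>additive_group W\<^esub> 0"
      using coset_eq_iff[OF W E EW \<delta>W[OF u(1)] subgroup_addD(1)[OF W]] \<delta>E[OF u(1)] by simp
    finally show "f v = E" by (simp add: r_coset_def)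
  qed
  then have "kernel ?I ?T f = liftable_mod N"
    using liftable_subset[of N] by (auto simp: kernel_def one)
  moreover have "f ` carrier ?I = carrier ?T" using img by simp
  ultimately show ?thesis using g.FactGroup_iso by simp
qed

end

section \<open>Labelled graphs and locally constant cochains\<close>

text \<open>Functions vanish outside the space, so that pointwise addition makes them an additive subgroup of
  a function type.\<close>

definition locally_constant :: "'x topology \<Rightarrow> 'v::zero set \<Rightarrow> ('x \<Rightarrow> 'v) set" where
  "locally_constant T V = {f. continuous_map T (discrete_topology UNIV) f \<and>
     (\<forall>x\<in>topspace T. f x \<in> V) \<and> (\<forall>x. x \<notin> topspace T \<longrightarrow> f x = 0)}"

lemma locally_constantI:
  assumes "continuous_map T (discrete_topology UNIV) f" "\<And>x. x \<in> topspace T \<Longrightarrow> f x \<in> V"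
    "\<And>x. x \<notin> topspace T \<Longrightarrow> f x = 0"
  shows "f \<in> locally_constant T V"
  using assms by (simp add: locally_constant_def)

lemma locally_constantD:
  assumes "f \<in> locally_constant T V"
  shows "continuous_map T (discrete_topology UNIV) f" "x \<in> topspace T \<Longrightarrow> f x \<in> V"
    "x \<notin> topspace T \<Longrightarrow> f x = 0"
  using assms by (simp_all add: locally_constant_def)

lemma continuous_map_discrete_compose:
  assumes "continuous_map T (discrete_topology UNIV) f"
  shows "continuous_map T (discrete_topology UNIV) (\<lambda>x. F (f x))"
  using continuous_map_compose[OF assms, of "discrete_topology UNIV" F]
  by (simp add: comp_def)

lemma continuous_map_discrete_Pair:
  assumes "continuous_map T (discrete_topology UNIV) f" "continuous_map T (discrete_topology UNIV) g"
  shows "continuous_map T (discrete_topology UNIV) (\<lambda>x. (f x, g x))"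
proof -
  have "continuous_map T (prod_topology (discrete_topology UNIV) (discrete_topology UNIV)) (\<lambda>x. (f x, g x))"
    using assms by (simp add: continuous_map_pairedI)
  then show ?thesis by (simp add: prod_topology_discrete_topology[symmetric] UNIV_Times_UNIV)
qed

lemma continuous_map_discrete_compose2:
  assumes "continuous_map T (discrete_topology UNIV) f" "continuous_map T (discrete_topology UNIV) g"
  shows "continuous_map T (discrete_topology UNIV) (\<lambda>x. F (f x) (g x))"
  using continuous_map_discrete_compose[OF continuous_map_discrete_Pair[OF assms], of "\<lambda>(x, y). F x y"]
  by simp

lemma continuous_map_into_discrete_UNIV:
  assumes "continuous_map T (discrete_topology S) f"
  shows "continuous_map T (discrete_topology UNIV) f"
  using continuous_map_compose[OF assms, of "discrete_topology UNIV" id] by simp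

lemma continuous_map_discrete_iff:
  "continuous_map T (discrete_topology UNIV) f \<longleftrightarrow>
    (\<forall>x\<in>topspace T. \<exists>U. openin T U \<and> x \<in> U \<and> (\<forall>y\<in>U. f y = f x))"
proof
  assume f: "continuous_map T (discrete_topology UNIV) f"
  show "\<forall>x\<in>topspace T. \<exists>U. openin T U \<and> x \<in> U \<and> (\<forall>y\<in>U. f y = f x)"
  proof
    fix x assume "x \<in> topspace T"
    then show "\<exists>U. openin T U \<and> x \<in> U \<and> (\<forall>y\<in>U. f y = f x)"
      using openin_continuous_map_preimage[OF f, of "{f x}"]
      by (intro exI[of _ "{y \<in> topspace T. f y \<in> {f x}}"]) auto
  qed
next
  assume *: "\<forall>x\<in>topspace T. \<exists>U. openin T U \<and> x \<in> U \<and> (\<forall>y\<in>U. f y = f x)"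
  show "continuous_map T (discrete_topology UNIV) f"
    unfolding continuous_map_def
  proof (intro conjI allI impI)
    fix A :: "'b set"
    show "openin T {x \<in> topspace T. f x \<in> A}"
    proof (subst openin_subopen, intro ballI)
      fix x assume x: "x \<in> {x \<in> topspace T. f x \<in> A}"
      then obtain U where U: "openin T U" "x \<in> U" "\<forall>y\<in>U. f y = f x" using * by blast
      have "U \<subseteq> {x \<in> topspace T. f x \<in> A}"
      proof
        fix y assume "y \<in> U"
        then have "f y = f x" "y \<in> topspace T" using U openin_subset[OF U(1)] by blast+
        with x show "y \<in> {x \<in> topspace T. f x \<in> A}" by simp
      qed
      then show "\<exists>U. openin T U \<and> x \<in> U \<and> U \<subseteq> {x \<in> topspace T. f x \<in> A}"
        using U by blast
    qed
  qed auto
qed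

text \<open>A pointwise solvable condition that depends on \<open>x\<close> only through a locally constant \<open>f x\<close> has a locally
  constant solution, because one solution can be fixed for each value of \<open>f\<close>.\<close>

lemma locally_constant_choice:
  assumes "continuous_map T (discrete_topology UNIV) f" "\<And>x. x \<in> topspace T \<Longrightarrow> \<exists>u\<in>V. P (f x) u"
  obtains u where "u \<in> locally_constant T V" "\<And>x. x \<in> topspace T \<Longrightarrow> P (f x) (u x)"
proof -
  define c where "c y = (SOME u. u \<in> V \<and> P y u)" for y
  have c: "c (f x) \<in> V" "P (f x) (c (f x))" if "x \<in> topspace T" for x
    using someI_ex[of "\<lambda>u. u \<in> V \<and> P (f x) u"] assms(2)[OF that] unfolding c_def by blast+
  have "continuous_map T (discrete_topology UNIV) (\<lambda>x. if x \<in> topspace T then c (f x) else 0)"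
    using continuous_map_discrete_compose[OF assms(1), of c]
    by (rule continuous_map_eq) auto
  then show thesis using c that[of "\<lambda>x. if x \<in> topspace T then c (f x) else 0"]
    by (simp add: locally_constant_def)
qed

lemma subgroup_locally_constant:
  assumes "subgroup_add V" shows "subgroup_add (locally_constant T V)"
  using subgroup_addD[OF assms]
  by (auto simp: subgroup_add_def locally_constant_def fun_diff_def zero_fun_def
      intro: continuous_map_discrete_compose2)

lemma locally_constant_mono: "V \<subseteq> V' \<Longrightarrow> locally_constant T V \<subseteq> locally_constant T V'"
  by (auto simp: locally_constant_def)

lemma of_nat_fun_apply: "(of_nat n :: 'x \<Rightarrow> 'v::comm_ring_1) x = of_nat n"
  by (induction n) auto

text \<open>For \<open>p = id\<close>, \<open>q = \<phi>\<inverse>\<close> and \<open>lab = \<xi> \<circ> \<phi>\<inverse>\<close> this is \<open>h - h \<circ> \<Phi>\<inverse>\<close>, where \<open>\<Phi>\<close> is the skew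
  product and functions on \<open>X \<times> G\<close> are regarded as functions from \<open>X\<close> to functions on \<open>G\<close>.  For a
  single vertex it is the family of all \<open>v - lab i \<cdot> v\<close>.\<close>

definition graph_coboundary ::
    "'e topology \<Rightarrow> ('e \<Rightarrow> 'x) \<Rightarrow> ('e \<Rightarrow> 'x) \<Rightarrow> ('e \<Rightarrow> 'g) \<Rightarrow> ('g \<Rightarrow> 'v \<Rightarrow> 'v) \<Rightarrow> ('x \<Rightarrow> 'v) \<Rightarrow> 'e \<Rightarrow> 'v::ab_group_add"
  where "graph_coboundary I p q lab act h =
    (\<lambda>i. if i \<in> topspace I then h (p i) - act (lab i) (h (q i)) else 0)"

definition graph_relations ::
    "'x topology \<Rightarrow> 'e topology \<Rightarrow> ('e \<Rightarrow> 'x) \<Rightarrow> ('e \<Rightarrow> 'x) \<Rightarrow> ('e \<Rightarrow> 'g) \<Rightarrow> ('g \<Rightarrow> 'v \<Rightarrow> 'v) \<Rightarrow>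
      'v::ab_group_add set \<Rightarrow> 'v set \<Rightarrow> ('e \<Rightarrow> 'v) set"
  where "graph_relations J I p q lab act V D =
    {graph_coboundary I p q lab act h + c | h c. h \<in> locally_constant J V \<and> c \<in> locally_constant I D}"

text \<open>The last assumption is connectedness of the \<open>G\<close>-cover of the graph defined by the labels: its
  vertices are the pairs \<open>(x, g)\<close>, and the edge over \<open>i\<close> that starts at \<open>(q i, g)\<close> ends at
  \<open>(p i, g \<otimes> lab i)\<close>.\<close>

locale labelled_graph = comm_group G for G :: "('g, 'm) monoid_scheme" (structure) +
  fixes J :: "'x topology" and I :: "'e topology" and p q :: "'e \<Rightarrow> 'x" and lab :: "'e \<Rightarrow> 'g"
  assumes finite_group: "finite (carrier G)"
    and p: "continuous_map I J p" and q: "continuous_map I J q"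
    and lab: "continuous_map I (discrete_topology (carrier G)) lab"
    and nonempty: "topspace J \<noteq> {}"
    and compact_vertices: "compact_space J" and compact_edges: "compact_space I"
    and connected: "\<And>C. closedin (prod_topology J (discrete_topology (carrier G))) C \<Longrightarrow>
      openin (prod_topology J (discrete_topology (carrier G))) C \<Longrightarrow>
      (\<And>i g. i \<in> topspace I \<Longrightarrow> g \<in> carrier G \<Longrightarrow> (p i, g \<otimes> lab i) \<in> C \<longleftrightarrow> (q i, g) \<in> C) \<Longrightarrow>
      C = {} \<or> C = topspace J \<times> carrier G"
begin

lemma p_in: "i \<in> topspace I \<Longrightarrow> p i \<in> topspace J" and q_in: "i \<in> topspace I \<Longrightarrow> q i \<in> topspace J"
  and lab_in: "i \<in> topspace I \<Longrightarrow> lab i \<in> carrier G"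
  using p q lab by (auto simp: continuous_map_def)

lemma lab_discrete: "continuous_map I (discrete_topology UNIV) lab"
  by (rule continuous_map_into_discrete_UNIV[OF lab])

lemma graph_coboundary_locally_constant:
  assumes "h \<in> locally_constant J V" and "\<And>i. i \<in> topspace I \<Longrightarrow> h (p i) - act (lab i) (h (q i)) \<in> U"
  shows "graph_coboundary I p q lab act h \<in> locally_constant I U"
proof (rule locally_constantI)
  have "continuous_map I (discrete_topology UNIV) (\<lambda>i. h (p i))"
    "continuous_map I (discrete_topology UNIV) (\<lambda>i. h (q i))"
    using continuous_map_compose[OF p locally_constantD(1)[OF assms(1)]]
      continuous_map_compose[OF q locally_constantD(1)[OF assms(1)]] by (simp_all add: comp_def)
  then have "continuous_map I (discrete_topology UNIV) (\<lambda>i. h (p i) - act (lab i) (h (q i)))"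
    by (intro continuous_map_discrete_compose2[where F = minus]
        continuous_map_discrete_compose2[where F = act] lab_discrete)
  then show "continuous_map I (discrete_topology UNIV) (graph_coboundary I p q lab act h)"
    by (rule continuous_map_eq) (simp add: graph_coboundary_def)
qed (use assms in \<open>auto simp: graph_coboundary_def\<close>)

end

locale graph_module = labelled_graph G J I p q lab + torsion_free_module G V D act
  for G :: "('g, 'm) monoid_scheme" (structure) and J :: "'x topology" and I :: "'e topology"
    and p q lab and V D :: "'v::comm_ring_1 set" and act
begin

abbreviation "cob \<equiv> graph_coboundary I p q lab act"
abbreviation "cochains \<equiv> locally_constant I V"
abbreviation "relations \<equiv> graph_relations J I p q lab act V D"

definition const :: "'v \<Rightarrow> 'x \<Rightarrow> 'v" where
  "const v = (\<lambda>x. if x \<in> topspace J then v else 0)"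

lemma const_in:
  assumes "v \<in> V" shows "const v \<in> locally_constant J V"
proof (rule locally_constantI)
  have "continuous_map J (discrete_topology UNIV) (\<lambda>_. v)" by simp
  then show "continuous_map J (discrete_topology UNIV) (const v)"
    by (rule continuous_map_eq) (simp add: const_def)
qed (use assms in \<open>simp_all add: const_def\<close>)

lemma cob_in:
  assumes "h \<in> locally_constant J V" shows "cob h \<in> cochains"
  by (rule graph_coboundary_locally_constant[OF assms], rule subgroup_addD(2)[OF V])
    (use assms in \<open>simp_all add: p_in q_in lab_in locally_constantD(2)[OF assms] act_V\<close>)

lemma cob_in_D:
  assumes "h \<in> locally_constant J D" shows "cob h \<in> locally_constant I D"
  by (rule graph_coboundary_locally_constant[OF assms], rule subgroup_addD(2)[OF D])
    (use assms in \<open>simp_all add: p_in q_in lab_in locally_constantD(2)[OF assms] act_D\<close>)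

lemma cob_diff:
  assumes "h \<in> locally_constant J V" "h' \<in> locally_constant J V"
  shows "cob (h - h') = cob h - cob h'"
  using assms by (simp add: graph_coboundary_def fun_eq_iff act_diff lab_in locally_constantD(2)[OF assms(1)]
      locally_constantD(2)[OF assms(2)] q_in)

lemma cob_of_nat_mult:
  assumes "h \<in> locally_constant J V"
  shows "cob (of_nat n * h) = of_nat n * cob h"
  using assms by (simp add: graph_coboundary_def fun_eq_iff act_of_nat_mult lab_in locally_constantD(2)[OF assms] q_in
      of_nat_fun_apply algebra_simps)

lemma subgroup_relations: "subgroup_add relations"
  unfolding subgroup_add_def
proof (intro conjI ballI)
  note LV = subgroup_locally_constant[OF V, of J] and LD = subgroup_locally_constant[OF D, of I]
  have "cob 0 = 0" using cob_diff[of 0 0] subgroup_addD(1)[OF LV] by simp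
  then have "0 = cob 0 + 0" by simp
  then show "0 \<in> relations"
    unfolding graph_relations_def using subgroup_addD(1)[OF LV] subgroup_addD(1)[OF LD] by blast
  fix e e' assume "e \<in> relations" "e' \<in> relations"
  then obtain h c h' c' where *: "e = cob h + c" "e' = cob h' + c'" "h \<in> locally_constant J V"
    "h' \<in> locally_constant J V" "c \<in> locally_constant I D" "c' \<in> locally_constant I D"
    by (auto simp: graph_relations_def)
  have "e - e' = cob (h - h') + (c - c')" using * by (simp add: cob_diff)
  then show "e - e' \<in> relations"
    unfolding graph_relations_def using * subgroup_addD(2)[OF LV] subgroup_addD(2)[OF LD] by blast
qed

lemma cob_relations: "h \<in> locally_constant J V \<Longrightarrow> cob h \<in> relations"
  unfolding graph_relations_def using subgroup_addD(1)[OF subgroup_locally_constant[OF D, of I]]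
  by (metis (mono_tags, lifting) CollectI add.right_neutral)

lemma D_relations: "locally_constant I D \<subseteq> relations"
proof
  fix c assume "c \<in> locally_constant I D"
  moreover have "c = cob 0 + c"
    using cob_diff[of 0 0] subgroup_addD(1)[OF subgroup_locally_constant[OF V, of J]] by simp
  ultimately show "c \<in> relations"
    unfolding graph_relations_def using subgroup_addD(1)[OF subgroup_locally_constant[OF V, of J]] by blast
qed

lemma relations_subset: "relations \<subseteq> cochains"
  using locally_constant_mono[OF D_subset, of I]
  by (auto simp: graph_relations_def intro!: subgroup_addD(4)[OF subgroup_locally_constant[OF V]] cob_in)

lemma pure_cochains: "pure_in (locally_constant I D) cochains"
  unfolding pure_in_def
proof (intro allI impI ballI)
  fix n :: nat and w assume n: "n > 0" and w: "w \<in> cochains" "of_nat n * w \<in> locally_constant I D"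
  have "w i \<in> D" if "i \<in> topspace I" for i
    using pure n locally_constantD(2)[OF w(1) that] locally_constantD(2)[OF w(2) that]
    by (auto simp: pure_in_def of_nat_fun_apply)
  then show "w \<in> locally_constant I D" using w(1) by (simp add: locally_constant_def)
qed

text \<open>The use of connectedness.  The function \<open>(x, g) \<mapsto> g\<inverse> \<cdot> h x\<close> on the cover has the same value modulo
  \<open>n\<close> at the two ends of every edge, so the clopen set where it is congruent to \<open>h x\<^sub>0\<close> is everything.
  Varying \<open>x\<close> shows that \<open>h\<close> is constant modulo \<open>n\<close>, varying \<open>g\<close> that its value is invariant.\<close>

lemma invariant_mod_constant:
  assumes h: "h \<in> locally_constant J V" and x\<^sub>0: "x\<^sub>0 \<in> topspace J"
    and inv: "\<And>i. i \<in> topspace I \<Longrightarrow> cong_mod n (h (p i)) (act (lab i) (h (q i)))"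
  shows "h x\<^sub>0 \<in> invariants_mod n" "\<And>x. x \<in> topspace J \<Longrightarrow> cong_mod n (h x) (h x\<^sub>0)"
proof -
  let ?T = "prod_topology J (discrete_topology (carrier G))"
  have hV: "h x \<in> V" if "x \<in> topspace J" for x using locally_constantD(2)[OF h that] .
  define P where "P = (\<lambda>(v, g). cong_mod n (act (inv g) v) (h x\<^sub>0))"
  define C where "C = {z \<in> topspace ?T. P (h (fst z), snd z) \<in> {True}}"
  have C: "(x, g) \<in> C \<longleftrightarrow> x \<in> topspace J \<and> g \<in> carrier G \<and> cong_mod n (act (inv g) (h x)) (h x\<^sub>0)" for x g
    by (auto simp: C_def P_def)
  have "continuous_map ?T (discrete_topology UNIV) (\<lambda>z. h (fst z))"
    using continuous_map_compose[OF continuous_map_fst locally_constantD(1)[OF h]]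
    by (simp add: comp_def)
  moreover have "continuous_map ?T (discrete_topology UNIV) snd"
    by (rule continuous_map_into_discrete_UNIV[OF continuous_map_snd])
  ultimately have cont: "continuous_map ?T (discrete_topology UNIV) (\<lambda>z. P (h (fst z), snd z))"
    by (rule continuous_map_discrete_compose[OF continuous_map_discrete_Pair])
  have "closedin ?T C" "openin ?T C"
    unfolding C_def using closedin_continuous_map_preimage[OF cont, of "{True}"]
      openin_continuous_map_preimage[OF cont, of "{True}"] by auto
  moreover have "(p i, g \<otimes> lab i) \<in> C \<longleftrightarrow> (q i, g) \<in> C" if i: "i \<in> topspace I" and g: "g \<in> carrier G" for i g
  proof -
    note l = lab_in[OF i] and V' = hV[OF p_in[OF i]] hV[OF q_in[OF i]]
    have "cong_mod n (act (inv (g \<otimes> lab i)) (h (p i))) (act (inv (g \<otimes> lab i)) (act (lab i) (h (q i))))"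
      using l g V' by (intro cong_mod_act inv[OF i]) (auto intro: act_V)
    also have "act (inv (g \<otimes> lab i)) (act (lab i) (h (q i))) = act (inv g) (h (q i))"
      using l g V' by (simp add: act_act inv_mult m_assoc)
    finally show ?thesis
      using p_in[OF i] q_in[OF i] g l by (auto simp: C intro: cong_mod_trans cong_mod_sym)
  qed
  ultimately have "C = {} \<or> C = topspace J \<times> carrier G" by (rule connected)
  moreover have "(x\<^sub>0, \<one>) \<in> C" using x\<^sub>0 hV by (auto simp: C act_one cong_mod_refl)
  ultimately have all: "cong_mod n (act (inv g) (h x)) (h x\<^sub>0)" if "x \<in> topspace J" "g \<in> carrier G" for x g
    using C that by blast
  show "cong_mod n (h x) (h x\<^sub>0)" if "x \<in> topspace J" for x
    using all[OF that one_closed] hV[OF that] by (simp add: act_one)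
  show "h x\<^sub>0 \<in> invariants_mod n"
  proof -
    have "cong_mod n (h x\<^sub>0) (act k (h x\<^sub>0))" if "k \<in> carrier G" for k
      using cong_mod_sym[OF all[OF x\<^sub>0, of "inv k"]] that by simp
    then show ?thesis using hV[OF x\<^sub>0] by (simp add: invariants_mod_def)
  qed
qed

text \<open>If \<open>n w\<close> is the coboundary of \<open>h\<close>, then \<open>h = v + n u\<close> modulo \<open>D\<close> with a constant \<open>v\<close> by the previous
  lemma, so \<open>n w\<close> and the coboundary of \<open>v\<close> differ by \<open>n\<close> times the coboundary of \<open>u\<close>.\<close>

lemma lift_torsion:
  assumes w: "w \<in> cochains" "of_nat n * w \<in> relations"
  shows "\<exists>v\<in>invariants_mod n. \<exists>e\<in>relations. of_nat n * w - cob (const v) - of_nat n * e \<in> locally_constant I D"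
proof -
  obtain h c where h: "h \<in> locally_constant J V" and c: "c \<in> locally_constant I D"
    and nw: "of_nat n * w = cob h + c"
    using w(2) by (auto simp: graph_relations_def)
  obtain x\<^sub>0 where x\<^sub>0: "x\<^sub>0 \<in> topspace J" using nonempty by blast
  have "cong_mod n (h (p i)) (act (lab i) (h (q i)))" if i: "i \<in> topspace I" for i
  proof -
    have "of_nat n * w i = h (p i) - act (lab i) (h (q i)) + c i"
      using fun_cong[OF nw, of i] i by (simp add: of_nat_fun_apply graph_coboundary_def)
    then have "h (p i) - act (lab i) (h (q i)) - of_nat n * w i = - c i" by simp
    moreover have "- c i \<in> D" using subgroup_addD(3)[OF D] locally_constantD(2)[OF c i] by blast
    ultimately show ?thesis
      using locally_constantD(2)[OF w(1) i] unfolding cong_mod_def by metis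
  qed
  note const = invariant_mod_constant[OF h x\<^sub>0 this]
  obtain u where u: "u \<in> locally_constant J V"
    and uD: "\<And>x. x \<in> topspace J \<Longrightarrow> h x - h x\<^sub>0 - of_nat n * u x \<in> D"
    using locally_constant_choice[OF locally_constantD(1)[OF h],
        of V "\<lambda>y u. y - h x\<^sub>0 - of_nat n * u \<in> D"] const(2)
    unfolding cong_mod_def by blast
  note cv = const_in[OF locally_constantD(2)[OF h x\<^sub>0]]
  note LV = subgroup_locally_constant[OF V, of J]
  have nu: "of_nat n * u \<in> locally_constant J V" by (rule subgroup_add_of_nat_mult[OF LV u])
  have hc: "h - const (h x\<^sub>0) \<in> locally_constant J V" by (rule subgroup_addD(2)[OF LV h cv])
  have "h - const (h x\<^sub>0) - of_nat n * u \<in> locally_constant J D"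
    using subgroup_addD(2)[OF LV hc nu] uD
    by (auto simp: locally_constant_def const_def of_nat_fun_apply)
  then have "cob (h - const (h x\<^sub>0) - of_nat n * u) \<in> locally_constant I D" by (rule cob_in_D)
  moreover have "of_nat n * w - cob (const (h x\<^sub>0)) - of_nat n * cob u
    = cob (h - const (h x\<^sub>0) - of_nat n * u) + c"
    using u h cv nu hc by (simp add: nw cob_diff cob_of_nat_mult)
  ultimately have "of_nat n * w - cob (const (h x\<^sub>0)) - of_nat n * cob u \<in> locally_constant I D"
    using c by (simp add: subgroup_addD(4)[OF subgroup_locally_constant[OF D, of I]])
  then show ?thesis using const(1) cob_relations[OF u] by blast
qed

lemma const_diff: "const (v - v') = const v - const v'"
  by (auto simp: const_def)

lemma cob_const_invariant:
  assumes "v \<in> invariants_mod 0" shows "cob (const v) \<in> locally_constant I D"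
  using assms by (intro graph_coboundary_locally_constant[OF const_in])
    (auto simp: invariants_mod_0_iff const_def p_in q_in lab_in)

lemma cob_const_divisible:
  assumes "v \<in> invariants_mod n"
  shows "\<exists>w\<in>cochains. of_nat n * w - cob (const v) \<in> locally_constant I D"
proof -
  have v: "v \<in> V" using assms by (simp add: invariants_mod_def)
  obtain w where w: "w \<in> cochains" "\<And>i. i \<in> topspace I \<Longrightarrow> v - act (lab i) v - of_nat n * w i \<in> D"
    using locally_constant_choice[OF lab_discrete, of V "\<lambda>l w. v - act l v - of_nat n * w \<in> D"] assms lab_in
    unfolding invariants_mod_def cong_mod_def by blast
  have "of_nat n * w - cob (const v) \<in> cochains"
    by (intro subgroup_addD(2)[OF subgroup_locally_constant[OF V]]
        subgroup_add_of_nat_mult[OF subgroup_locally_constant[OF V]] w cob_in const_in v)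
  moreover have "of_nat n * w i - (v - act (lab i) v) \<in> D" if "i \<in> topspace I" for i
    using subgroup_addD(3)[OF D w(2)[OF that]] by (simp add: algebra_simps)
  ultimately have "of_nat n * w - cob (const v) \<in> locally_constant I D"
    by (auto simp: locally_constant_def graph_coboundary_def of_nat_fun_apply const_def p_in q_in)
  then show ?thesis using w(1) by blast
qed

text \<open>If \<open>n\<close> times the coboundary of \<open>h\<close> is the coboundary of the constant \<open>v\<close>, then \<open>n h - v\<close> has
  coboundary zero in \<open>V/D\<close> and is itself an invariant constant there.\<close>

lemma kernel_liftable:
  assumes e: "e \<in> relations" and v: "v \<in> V"
    and eD: "of_nat n * e - cob (const v) \<in> locally_constant I D"
  shows "v \<in> liftable_mod n"
proof -
  obtain h c where h: "h \<in> locally_constant J V" and c: "c \<in> locally_constant I D" and e: "e = cob h + c"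
    using e by (auto simp: graph_relations_def)
  obtain x\<^sub>0 where x\<^sub>0: "x\<^sub>0 \<in> topspace J" using nonempty by blast
  note LV = subgroup_locally_constant[OF V, of J] and LD = subgroup_locally_constant[OF D, of I]
  define t where "t = of_nat n * h - const v"
  have nh: "of_nat n * h \<in> locally_constant J V" by (rule subgroup_add_of_nat_mult[OF LV h])
  have t: "t \<in> locally_constant J V"
    unfolding t_def by (rule subgroup_addD(2)[OF LV nh const_in[OF v]])
  have "cob t = of_nat n * cob h - cob (const v)"
    using h v nh by (simp add: t_def cob_diff cob_of_nat_mult const_in)
  then have "cob t = (of_nat n * e - cob (const v)) - of_nat n * c"
    by (simp add: e algebra_simps)
  also have "\<dots> \<in> locally_constant I D"
    by (rule subgroup_addD(2)[OF LD eD subgroup_add_of_nat_mult[OF LD c]])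
  finally have tD: "cob t \<in> locally_constant I D" .
  have "cong_mod 0 (t (p i)) (act (lab i) (t (q i)))" if i: "i \<in> topspace I" for i
    using locally_constantD(2)[OF tD i] i by (simp add: cong_mod_zero graph_coboundary_def)
  then have "t x\<^sub>0 \<in> invariants_mod 0" by (rule invariant_mod_constant(1)[OF t x\<^sub>0])
  then have "- t x\<^sub>0 \<in> invariants_mod 0" by (rule subgroup_addD(3)[OF subgroup_invariants_mod])
  then have "v - of_nat n * h x\<^sub>0 \<in> invariants_mod 0"
    using x\<^sub>0 by (simp add: t_def const_def of_nat_fun_apply)
  then show ?thesis using v locally_constantD(2)[OF h x\<^sub>0] by (auto simp: liftable_mod_def)
qed

text \<open>The left-hand side depends on \<open>V\<close>, \<open>D\<close> and the action only, not on the graph.\<close>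

theorem graph_torsion:
  "additive_group (invariants_mod (card (carrier G))) Mod liftable_mod (card (carrier G)) \<cong>
    torsion_subgroup (additive_group cochains Mod relations)"
proof (rule torsion_quotient_iso[where W\<^sub>0 = "locally_constant I D" and \<delta> = "\<lambda>v. cob (const v)"])
  show "cob (const (v - w)) = cob (const v) - cob (const w)" if "v \<in> V" "w \<in> V" for v w
    using that by (simp add: const_diff cob_diff const_in)
  show "locally_constant I D \<subseteq> relations" by (fact D_relations)
  show "relations \<subseteq> cochains" by (fact relations_subset)
qed (auto intro: subgroup_locally_constant V D subgroup_relations
    pure_cochains cob_relations const_in cob_const_invariant cob_const_divisible lift_torsion kernel_liftable)

text \<open>When \<open>H\<^sup>1(G, V/D)\<close> vanishes, the representative \<open>v\<close> of a torsion element is \<open>n u\<close> plus an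
  invariant, so the element is zero.\<close>

lemma pure_relations:
  assumes acyclic: "\<And>n. n > 0 \<Longrightarrow> invariants_mod n \<subseteq> liftable_mod n"
  shows "pure_in relations cochains"
  unfolding pure_in_def
proof (intro allI impI ballI)
  fix n :: nat and w assume n: "n > 0" and w: "w \<in> cochains" "of_nat n * w \<in> relations"
  note LV = subgroup_locally_constant[OF V] and LD = subgroup_locally_constant[OF D, of I]
  obtain v e where v: "v \<in> invariants_mod n" and e: "e \<in> relations"
    and wve: "of_nat n * w - cob (const v) - of_nat n * e \<in> locally_constant I D"
    using lift_torsion[OF w] by blast
  obtain u where u: "v \<in> V" "u \<in> V" "v - of_nat n * u \<in> invariants_mod 0"
    using v acyclic[OF n] by (auto simp: liftable_mod_def)
  let ?x = "w - e - cob (const u)"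
  have "cob (const (v - of_nat n * u)) = cob (const v) - of_nat n * cob (const u)"
  proof -
    have "const (of_nat n * u) = of_nat n * const u"
      by (auto simp: const_def of_nat_fun_apply)
    then show ?thesis
      using u by (simp add: const_diff cob_diff const_in of_nat_mult_V
          cob_of_nat_mult subgroup_add_of_nat_mult[OF LV])
  qed
  then have "of_nat n * ?x = of_nat n * w - cob (const v) - of_nat n * e + cob (const (v - of_nat n * u))"
    by (simp add: algebra_simps)
  also have "\<dots> \<in> locally_constant I D"
    by (rule subgroup_addD(4)[OF LD wve cob_const_invariant[OF u(3)]])
  finally have nx: "of_nat n * ?x \<in> locally_constant I D" .
  have "?x \<in> cochains"
    using e relations_subset w(1) u by (intro subgroup_addD(2)[OF LV] cob_in const_in) auto
  then have "?x \<in> relations"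
    using nx n pure_cochains D_relations unfolding pure_in_def by blast
  then have "?x + cob (const u) + e \<in> relations"
    using e cob_relations[OF const_in[OF u(2)]] by (intro subgroup_addD(4)[OF subgroup_relations])
  then show "w \<in> relations" by simp
qed

lemma act_locally_constant:
  assumes "k \<in> carrier G" "f \<in> locally_constant T U" "\<And>v. v \<in> U \<Longrightarrow> act k v \<in> U"
  shows "(\<lambda>i. act k (f i)) \<in> locally_constant T U"
  using assms continuous_map_discrete_compose[of T f "act k"]
  by (simp add: locally_constant_def act_zero)

lemma cochain_module:
  assumes acyclic: "\<And>n. n > 0 \<Longrightarrow> invariants_mod n \<subseteq> liftable_mod n"
  shows "torsion_free_module G cochains relations (\<lambda>k f i. act k (f i))"
proof
  show "finite (carrier G)" by (fact finite_G)
  show "subgroup_add cochains" by (rule subgroup_locally_constant[OF V])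
  show "subgroup_add relations" by (fact subgroup_relations)
  show "relations \<subseteq> cochains" by (fact relations_subset)
  show "pure_in relations cochains" by (rule pure_relations[OF acyclic])
  have W: "f i \<in> V" if "f \<in> cochains" for f i
    using that subgroup_addD(1)[OF V] by (cases "i \<in> topspace I") (auto simp: locally_constant_def)
  show "(\<lambda>i. act \<one> (f i)) = f" if "f \<in> cochains" for f
    using that W by (simp add: fun_eq_iff act_one)
  fix k assume k: "k \<in> carrier G"
  show "(\<lambda>i. act k (f i)) \<in> cochains" if "f \<in> cochains" for f
    using that k by (intro act_locally_constant) (auto intro: act_V)
  show "(\<lambda>i. act k (e i)) \<in> relations" if e: "e \<in> relations" for e
  proof -
    obtain h c where h: "h \<in> locally_constant J V" and c: "c \<in> locally_constant I D" and eq: "e = cob h + c"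
      using e unfolding graph_relations_def by blast
    have h': "(\<lambda>x. act k (h x)) \<in> locally_constant J V" using h k by (intro act_locally_constant) (auto intro: act_V)
    have c': "(\<lambda>x. act k (c x)) \<in> locally_constant I D" using c k by (intro act_locally_constant) (auto intro: act_D)
    have cD: "c i \<in> V" if "i \<in> topspace I" for i using locally_constantD(2)[OF c that] D_subset by blast
    have "act k (e i) = cob (\<lambda>x. act k (h x)) i + act k (c i)" for i
    proof (cases "i \<in> topspace I")
      case True
      note V' = locally_constantD(2)[OF h p_in[OF True]] locally_constantD(2)[OF h q_in[OF True]]
      have "act k (act (lab i) (h (q i))) = act (lab i) (act k (h (q i)))"
        using k lab_in[OF True] V' by (simp add: act_act m_comm)
      moreover have "act k (h (p i) - act (lab i) (h (q i)) + c i) =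
        act k (h (p i)) - act k (act (lab i) (h (q i))) + act k (c i)"
        using k V' cD[OF True] lab_in[OF True]
        by (simp add: act_add act_diff act_V subgroup_addD(2)[OF V])
      ultimately show ?thesis using True by (simp add: eq graph_coboundary_def)
    next
      case False
      then show ?thesis using k locally_constantD(3)[OF c] by (simp add: eq graph_coboundary_def act_zero)
    qed
    then have "(\<lambda>i. act k (e i)) = cob (\<lambda>x. act k (h x)) + (\<lambda>i. act k (c i))" by (simp add: fun_eq_iff)
    then show ?thesis unfolding graph_relations_def using h' c' by blast
  qed
  show "(\<lambda>i. act k ((f - f') i)) = (\<lambda>i. act k (f i)) - (\<lambda>i. act k (f' i))"
    if "f \<in> cochains" "f' \<in> cochains" for f f'
    using that k W by (simp add: fun_eq_iff act_diff)
  show "(\<lambda>i. act k (act l (f i))) = (\<lambda>i. act (k \<otimes> l) (f i))" if "l \<in> carrier G" "f \<in> cochains" for l f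
    using that k W by (simp add: fun_eq_iff act_act)
qed

end

section \<open>Pairs of labelled graphs\<close>

lemma locally_constant_uncurry:
  assumes h: "h \<in> locally_constant T (locally_constant S V)"
  shows "(\<lambda>(x, y). h x y) \<in> locally_constant (prod_topology T S) V"
proof (rule locally_constantI)
  show "continuous_map (prod_topology T S) (discrete_topology UNIV) (\<lambda>(x, y). h x y)"
    unfolding continuous_map_discrete_iff
  proof
    fix z assume "z \<in> topspace (prod_topology T S)"
    then obtain x y where z: "z = (x, y)" "x \<in> topspace T" "y \<in> topspace S" by auto
    obtain U where U: "openin T U" "x \<in> U" "\<forall>x'\<in>U. h x' = h x"
      using bspec[OF locally_constantD(1)[OF h, unfolded continuous_map_discrete_iff] z(2)] by blast
    obtain U' where U': "openin S U'" "y \<in> U'" "\<forall>y'\<in>U'. h x y' = h x y"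
      using bspec[OF locally_constantD(1)[OF locally_constantD(2)[OF h z(2)],
            unfolded continuous_map_discrete_iff] z(3)] by blast
    have op: "openin (prod_topology T S) (U \<times> U')" using U(1) U'(1) by (simp add: openin_prod_Times_iff)
    have const: "(case w of (x, y) \<Rightarrow> h x y) = (case z of (x, y) \<Rightarrow> h x y)" if ww: "w \<in> U \<times> U'" for w
    proof -
      obtain x' y' where w: "w = (x', y')" "x' \<in> U" "y' \<in> U'" using ww by auto
      have "h x' = h x" by (rule bspec[OF U(3) w(2)])
      moreover have "h x y' = h x y" by (rule bspec[OF U'(3) w(3)])
      ultimately show ?thesis by (simp add: w z)
    qed
    show "\<exists>Q. openin (prod_topology T S) Q \<and> z \<in> Q \<and>
        (\<forall>w\<in>Q. (case w of (x, y) \<Rightarrow> h x y) = (case z of (x, y) \<Rightarrow> h x y))"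
      using U(2) U'(2) z(1) by (intro exI[of _ "U \<times> U'"] conjI ballI const op) simp_all
  qed
next
  fix z assume "z \<in> topspace (prod_topology T S)"
  then show "(case z of (x, y) \<Rightarrow> h x y) \<in> V"
    using locally_constantD(2)[OF locally_constantD(2)[OF h]] by auto
next
  fix z assume "z \<notin> topspace (prod_topology T S)"
  then show "(case z of (x, y) \<Rightarrow> h x y) = 0"
    using locally_constantD(3)[OF h] locally_constantD(3)[OF locally_constantD(2)[OF h]]
    by (cases z; cases "fst z \<in> topspace T") auto
qed

text \<open>Here compactness is needed: by the tube lemma, \<open>f\<close> does not change when \<open>x\<close> varies in a neighbourhood
  that works for all \<open>y\<close> simultaneously.\<close>

lemma locally_constant_curry:
  assumes S: "compact_space S" and f: "f \<in> locally_constant (prod_topology T S) V"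
  shows "(\<lambda>x y. f (x, y)) \<in> locally_constant T (locally_constant S V)"
proof (rule locally_constantI)
  note cont = locally_constantD(1)[OF f, unfolded continuous_map_discrete_iff]
  have out: "f (x, y) = 0" if "x \<notin> topspace T \<or> y \<notin> topspace S" for x y
    using locally_constantD(3)[OF f, of "(x, y)"] that by auto
  show "(\<lambda>y. f (x, y)) = 0" if "x \<notin> topspace T" for x
    using out that by (simp add: fun_eq_iff)
  show "continuous_map T (discrete_topology UNIV) (\<lambda>x y. f (x, y))"
    unfolding continuous_map_discrete_iff
  proof
    fix x assume x: "x \<in> topspace T"
    define Q where "Q = \<Union> {A. openin (prod_topology T S) A \<and> (\<forall>z\<in>A. f z = f (x, snd z))}"
    have "{x} \<times> topspace S \<subseteq> Q"
    proof
      fix z assume "z \<in> {x} \<times> topspace S"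
      then obtain y where z: "z = (x, y)" "y \<in> topspace S" by auto
      then obtain U where U: "openin (prod_topology T S) U" "(x, y) \<in> U" "\<forall>w\<in>U. f w = f (x, y)"
        using bspec[OF cont, of "(x, y)"] x z(2) by auto
      then obtain A B where AB: "openin T A" "openin S B" "x \<in> A" "y \<in> B" "A \<times> B \<subseteq> U"
        unfolding openin_prod_topology_alt by meson
      have "f w = f (x, snd w)" if "w \<in> A \<times> B" for w
      proof -
        have "w \<in> U" and xw: "(x, snd w) \<in> U" using that AB by auto
        then have "f w = f (x, y)" using U(3) by blast
        moreover have "f (x, snd w) = f (x, y)" by (rule bspec[OF U(3) xw])
        ultimately show ?thesis by simp
      qed
      then have "A \<times> B \<in> {A. openin (prod_topology T S) A \<and> (\<forall>z\<in>A. f z = f (x, snd z))}"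
        using AB by (simp add: openin_prod_Times_iff)
      then show "z \<in> Q" unfolding Q_def using AB z by blast
    qed
    moreover have "openin (prod_topology T S) Q" unfolding Q_def by blast
    ultimately obtain U B where "openin T U" "x \<in> U" "topspace S \<subseteq> B" "U \<times> B \<subseteq> Q"
      using tube_lemma_right[of T S Q "topspace S" x] S x unfolding compact_space_def by blast
    then have U: "openin T U" "x \<in> U" "U \<times> topspace S \<subseteq> Q" by blast+
    have "f (x', y) = f (x, y)" if "x' \<in> U" for x' y
    proof (cases "y \<in> topspace S")
      case True
      then have "(x', y) \<in> Q" using U that by blast
      then obtain A where "(x', y) \<in> A" "\<forall>z\<in>A. f z = f (x, snd z)" unfolding Q_def by blast
      then have "f (x', y) = f (x, snd (x', y))" by blast
      then show ?thesis by simp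
    qed (use out in auto)
    then show "\<exists>U. openin T U \<and> x \<in> U \<and> (\<forall>x'\<in>U. (\<lambda>y. f (x', y)) = (\<lambda>y. f (x, y)))"
      using U(1,2) by (intro exI[of _ U] conjI ballI ext)
  qed
  show "(\<lambda>y. f (x, y)) \<in> locally_constant S V" if x: "x \<in> topspace T" for x
  proof (rule locally_constantI)
    have "continuous_map S (prod_topology T S) (\<lambda>y. (x, y))"
      using x by (simp add: continuous_map_pairwise comp_def)
    from continuous_map_compose[OF this locally_constantD(1)[OF f]]
    show "continuous_map S (discrete_topology UNIV) (\<lambda>y. f (x, y))" by (simp add: comp_def)
    show "f (x, y) \<in> V" if "y \<in> topspace S" for y
      using locally_constantD(2)[OF f, of "(x, y)"] x that by simp
  qed (use out in auto)
qed

lemma locally_constant_swap: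
  assumes "compact_space T" "f \<in> locally_constant T (locally_constant S V)"
  shows "(\<lambda>y x. f x y) \<in> locally_constant S (locally_constant T V)"
proof -
  note u = locally_constant_uncurry[OF assms(2)]
  have "(\<lambda>(y, x). f x y) \<in> locally_constant (prod_topology S T) V"
  proof (rule locally_constantI)
    have "continuous_map (prod_topology S T) (prod_topology T S) (\<lambda>z. (snd z, fst z))"
      by (simp add: continuous_map_pairedI continuous_map_fst continuous_map_snd)
    from continuous_map_compose[OF this locally_constantD(1)[OF u]]
    show "continuous_map (prod_topology S T) (discrete_topology UNIV) (\<lambda>(y, x). f x y)"
      by (simp add: comp_def case_prod_unfold)
    show "(case z of (y, x) \<Rightarrow> f x y) \<in> V" if "z \<in> topspace (prod_topology S T)" for z
      using locally_constantD(2)[OF u, of "(snd z, fst z)"] that by auto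
    show "(case z of (y, x) \<Rightarrow> f x y) = 0" if "z \<notin> topspace (prod_topology S T)" for z
      using locally_constantD(3)[OF u, of "(snd z, fst z)"] that
      by (auto simp: case_prod_unfold mem_Times_iff)
  qed
  from locally_constant_curry[OF assms(1) this] show ?thesis by simp
qed

text \<open>The construction applied to the second graph with denominator \<open>0\<close>, and then to the first graph with
  the resulting pair.\<close>

definition double_relations where
  "double_relations J\<^sub>1 I\<^sub>1 p\<^sub>1 q\<^sub>1 l\<^sub>1 J\<^sub>2 I\<^sub>2 p\<^sub>2 q\<^sub>2 l\<^sub>2 act V =
    graph_relations J\<^sub>1 I\<^sub>1 p\<^sub>1 q\<^sub>1 l\<^sub>1 (\<lambda>k f i. act k (f i)) (locally_constant I\<^sub>2 V)
      (graph_relations J\<^sub>2 I\<^sub>2 p\<^sub>2 q\<^sub>2 l\<^sub>2 act V {0})"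

definition double_quotient where
  "double_quotient J\<^sub>1 I\<^sub>1 p\<^sub>1 q\<^sub>1 l\<^sub>1 J\<^sub>2 I\<^sub>2 p\<^sub>2 q\<^sub>2 l\<^sub>2 act V =
    additive_group (locally_constant I\<^sub>1 (locally_constant I\<^sub>2 V)) Mod
      double_relations J\<^sub>1 I\<^sub>1 p\<^sub>1 q\<^sub>1 l\<^sub>1 J\<^sub>2 I\<^sub>2 p\<^sub>2 q\<^sub>2 l\<^sub>2 act V"

text \<open>The condition is \<open>H\<^sup>1(G, V) = 0\<close>.\<close>

locale acyclic_module = torsion_free_module G V "{0}" act
  for G :: "('g, 'm) monoid_scheme" (structure) and V :: "'v::comm_ring_1 set" and act +
  assumes acyclic: "\<And>n. n > 0 \<Longrightarrow> invariants_mod n \<subseteq> liftable_mod n"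

locale two_graphs = acyclic_module G V act +
  G1: labelled_graph G J\<^sub>1 I\<^sub>1 p\<^sub>1 q\<^sub>1 l\<^sub>1 + G2: labelled_graph G J\<^sub>2 I\<^sub>2 p\<^sub>2 q\<^sub>2 l\<^sub>2
  for G :: "('g, 'm) monoid_scheme" (structure) and V :: "'v::comm_ring_1 set" and act
    and J\<^sub>1 :: "'x topology" and I\<^sub>1 :: "'e topology" and p\<^sub>1 q\<^sub>1 l\<^sub>1
    and J\<^sub>2 :: "'y topology" and I\<^sub>2 :: "'f topology" and p\<^sub>2 q\<^sub>2 l\<^sub>2
begin

sublocale M2: graph_module G J\<^sub>2 I\<^sub>2 p\<^sub>2 q\<^sub>2 l\<^sub>2 V "{0}" act by unfold_locales

lemma inner_module: "torsion_free_module G M2.cochains M2.relations (\<lambda>k f i. act k (f i))"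
  by (rule M2.cochain_module) (rule acyclic)

sublocale M1: graph_module G J\<^sub>1 I\<^sub>1 p\<^sub>1 q\<^sub>1 l\<^sub>1 M2.cochains M2.relations "\<lambda>k f i. act k (f i)"
  by (intro graph_module.intro G1.labelled_graph_axioms inner_module)

abbreviation "relations\<^sub>1\<^sub>2 \<equiv> double_relations J\<^sub>1 I\<^sub>1 p\<^sub>1 q\<^sub>1 l\<^sub>1 J\<^sub>2 I\<^sub>2 p\<^sub>2 q\<^sub>2 l\<^sub>2 act V"

lemma group_double_quotient: "comm_group (double_quotient J\<^sub>1 I\<^sub>1 p\<^sub>1 q\<^sub>1 l\<^sub>1 J\<^sub>2 I\<^sub>2 p\<^sub>2 q\<^sub>2 l\<^sub>2 act V)"
proof -
  interpret W: comm_group "additive_group M1.cochains"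
    by (intro comm_group_additive_group subgroup_locally_constant V)
  show ?thesis
    unfolding double_quotient_def double_relations_def
    by (intro W.abelian_FactGroup subgroup_additive_group subgroup_locally_constant V
        M1.subgroup_relations M1.relations_subset)
qed

text \<open>The relations are the sums of a coboundary in the first and a coboundary in the second variable.  In
  this form they are symmetric in the two graphs.\<close>

lemma double_relations_eq:
  "relations\<^sub>1\<^sub>2 = {M1.cob H + (\<lambda>i. M2.cob (k i)) | H k.
     H \<in> locally_constant J\<^sub>1 M2.cochains \<and> k \<in> locally_constant I\<^sub>1 (locally_constant J\<^sub>2 V)}"
proof -
  have "locally_constant I\<^sub>2 {0} = {0 :: 'f \<Rightarrow> 'v}"
    by (auto simp: locally_constant_def zero_fun_def fun_eq_iff)
  then have rel2: "M2.relations = {M2.cob h | h. h \<in> locally_constant J\<^sub>2 V}"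
    unfolding graph_relations_def by simp
  have cob0: "M2.cob 0 = 0" by (auto simp: graph_coboundary_def act_zero G2.lab_in)
  have "locally_constant I\<^sub>1 M2.relations = {\<lambda>i. M2.cob (k i) | k. k \<in> locally_constant I\<^sub>1 (locally_constant J\<^sub>2 V)}"
  proof (intro equalityI subsetI)
    fix c assume c: "c \<in> locally_constant I\<^sub>1 M2.relations"
    obtain k where k: "k \<in> locally_constant I\<^sub>1 (locally_constant J\<^sub>2 V)"
      "\<And>i. i \<in> topspace I\<^sub>1 \<Longrightarrow> c i = M2.cob (k i)"
      using locally_constant_choice[OF locally_constantD(1)[OF c], of "locally_constant J\<^sub>2 V"
          "\<lambda>y u. y = M2.cob u"] locally_constantD(2)[OF c] unfolding rel2 by blast
    have "c i = M2.cob (k i)" for i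
      using k locally_constantD(3)[OF c] locally_constantD(3)[OF k(1)] cob0
      by (cases "i \<in> topspace I\<^sub>1") simp_all
    then show "c \<in> {\<lambda>i. M2.cob (k i) | k. k \<in> locally_constant I\<^sub>1 (locally_constant J\<^sub>2 V)}"
      using k(1) by blast
  next
    fix c assume "c \<in> {\<lambda>i. M2.cob (k i) | k. k \<in> locally_constant I\<^sub>1 (locally_constant J\<^sub>2 V)}"
    then obtain k where k: "k \<in> locally_constant I\<^sub>1 (locally_constant J\<^sub>2 V)" "c = (\<lambda>i. M2.cob (k i))"
      by auto
    show "c \<in> locally_constant I\<^sub>1 M2.relations"
      unfolding k(2)
    proof (rule locally_constantI)
      show "continuous_map I\<^sub>1 (discrete_topology UNIV) (\<lambda>i. M2.cob (k i))"
        by (rule continuous_map_discrete_compose[OF locally_constantD(1)[OF k(1)]])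
      show "M2.cob (k i) \<in> M2.relations" if "i \<in> topspace I\<^sub>1" for i
        by (rule M2.cob_relations[OF locally_constantD(2)[OF k(1) that]])
      show "M2.cob (k i) = 0" if "i \<notin> topspace I\<^sub>1" for i
        using locally_constantD(3)[OF k(1) that] cob0 by simp
    qed
  qed
  then show ?thesis
    unfolding double_relations_def graph_relations_def[of J\<^sub>1] by (intro Collect_cong) auto
qed

lemma swap_relations_subset:
  "(\<lambda>f j i. f i j) ` relations\<^sub>1\<^sub>2 \<subseteq> double_relations J\<^sub>2 I\<^sub>2 p\<^sub>2 q\<^sub>2 l\<^sub>2 J\<^sub>1 I\<^sub>1 p\<^sub>1 q\<^sub>1 l\<^sub>1 act V"
proof
  interpret R: two_graphs G V act J\<^sub>2 I\<^sub>2 p\<^sub>2 q\<^sub>2 l\<^sub>2 J\<^sub>1 I\<^sub>1 p\<^sub>1 q\<^sub>1 l\<^sub>1 by unfold_locales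
  fix f assume "f \<in> (\<lambda>f j i. f i j) ` relations\<^sub>1\<^sub>2"
  then obtain H k where H: "H \<in> locally_constant J\<^sub>1 M2.cochains"
    and k: "k \<in> locally_constant I\<^sub>1 (locally_constant J\<^sub>2 V)"
    and f: "f = (\<lambda>j i. (M1.cob H + (\<lambda>i. M2.cob (k i))) i j)"
    unfolding double_relations_eq by auto
  have "f = R.M1.cob (\<lambda>j i. k i j) + (\<lambda>j. R.M2.cob (\<lambda>i. H i j))"
    unfolding f by (auto simp: graph_coboundary_def fun_eq_iff)
  moreover have "(\<lambda>j i. k i j) \<in> locally_constant J\<^sub>2 R.M2.cochains"
    by (rule locally_constant_swap[OF G1.compact_edges k])
  moreover have "(\<lambda>j i. H i j) \<in> locally_constant I\<^sub>2 (locally_constant J\<^sub>1 V)"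
    by (rule locally_constant_swap[OF G1.compact_vertices H])
  ultimately show "f \<in> double_relations J\<^sub>2 I\<^sub>2 p\<^sub>2 q\<^sub>2 l\<^sub>2 J\<^sub>1 I\<^sub>1 p\<^sub>1 q\<^sub>1 l\<^sub>1 act V"
    unfolding R.double_relations_eq
    by (intro CollectI exI[of _ "\<lambda>j i. k i j"] exI[of _ "\<lambda>j i. H i j"] conjI)
qed

theorem double_quotient_swap:
  "double_quotient J\<^sub>1 I\<^sub>1 p\<^sub>1 q\<^sub>1 l\<^sub>1 J\<^sub>2 I\<^sub>2 p\<^sub>2 q\<^sub>2 l\<^sub>2 act V \<cong>
   double_quotient J\<^sub>2 I\<^sub>2 p\<^sub>2 q\<^sub>2 l\<^sub>2 J\<^sub>1 I\<^sub>1 p\<^sub>1 q\<^sub>1 l\<^sub>1 act V"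
proof -
  interpret R: two_graphs G V act J\<^sub>2 I\<^sub>2 p\<^sub>2 q\<^sub>2 l\<^sub>2 J\<^sub>1 I\<^sub>1 p\<^sub>1 q\<^sub>1 l\<^sub>1 by unfold_locales
  let ?s = "\<lambda>f j i. f i j" and ?t = "\<lambda>f i j. f j i"
  have img: "?s ` relations\<^sub>1\<^sub>2 = R.relations\<^sub>1\<^sub>2"
  proof
    show "R.relations\<^sub>1\<^sub>2 \<subseteq> ?s ` relations\<^sub>1\<^sub>2"
    proof
      fix f assume "f \<in> R.relations\<^sub>1\<^sub>2"
      then have "?t f \<in> relations\<^sub>1\<^sub>2" using R.swap_relations_subset by blast
      then show "f \<in> ?s ` relations\<^sub>1\<^sub>2" by (rule rev_image_eqI) simp
    qed
  qed (rule swap_relations_subset)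
  have c12: "?s f \<in> R.M1.cochains" if "f \<in> M1.cochains" for f
    by (rule locally_constant_swap[OF G1.compact_edges that])
  have c21: "?t f \<in> M1.cochains" if "f \<in> R.M1.cochains" for f
    by (rule locally_constant_swap[OF G2.compact_edges that])
  have "bij_betw ?s M1.cochains R.M1.cochains"
    by (rule bij_betwI[of _ _ _ ?t]) (use c12 c21 in auto)
  then have "?s \<in> iso (additive_group M1.cochains) (additive_group R.M1.cochains)"
    using c12 by (auto simp: iso_def hom_def fun_eq_iff)
  then have "additive_group M1.cochains Mod relations\<^sub>1\<^sub>2 \<cong>
      additive_group R.M1.cochains Mod (?s ` relations\<^sub>1\<^sub>2)"
  proof (rule Mod_iso[rotated 2])
    show "group (additive_group M1.cochains)"
      by (intro comm_group.axioms(2) comm_group_additive_group subgroup_locally_constant V)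
    show "comm_group (additive_group R.M1.cochains)"
      by (intro comm_group_additive_group subgroup_locally_constant V)
    show "relations\<^sub>1\<^sub>2 \<subseteq> carrier (additive_group M1.cochains)"
      using M1.relations_subset by (simp add: double_relations_def)
    show "subgroup (?s ` relations\<^sub>1\<^sub>2) (additive_group R.M1.cochains)"
      unfolding img unfolding double_relations_def
      by (intro subgroup_additive_group subgroup_locally_constant V R.M1.subgroup_relations
          R.M1.relations_subset)
  qed
  then show ?thesis unfolding img double_quotient_def .
qed

end

text \<open>By \<open>graph_torsion\<close> both torsion groups are computed by the module that belongs to the common inner
  graph.\<close>

theorem outer_graph_independent:
  assumes "two_graphs G V act J\<^sub>1 I\<^sub>1 p\<^sub>1 q\<^sub>1 l\<^sub>1 J\<^sub>2 I\<^sub>2 p\<^sub>2 q\<^sub>2 l\<^sub>2"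
    and "two_graphs G V act J\<^sub>3 I\<^sub>3 p\<^sub>3 q\<^sub>3 l\<^sub>3 J\<^sub>2 I\<^sub>2 p\<^sub>2 q\<^sub>2 l\<^sub>2"
  shows "torsion_subgroup (double_quotient J\<^sub>1 I\<^sub>1 p\<^sub>1 q\<^sub>1 l\<^sub>1 J\<^sub>2 I\<^sub>2 p\<^sub>2 q\<^sub>2 l\<^sub>2 act V) \<cong>
    torsion_subgroup (double_quotient J\<^sub>3 I\<^sub>3 p\<^sub>3 q\<^sub>3 l\<^sub>3 J\<^sub>2 I\<^sub>2 p\<^sub>2 q\<^sub>2 l\<^sub>2 act V)"
proof -
  interpret A: two_graphs G V act J\<^sub>1 I\<^sub>1 p\<^sub>1 q\<^sub>1 l\<^sub>1 J\<^sub>2 I\<^sub>2 p\<^sub>2 q\<^sub>2 l\<^sub>2 by fact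
  interpret B: two_graphs G V act J\<^sub>3 I\<^sub>3 p\<^sub>3 q\<^sub>3 l\<^sub>3 J\<^sub>2 I\<^sub>2 p\<^sub>2 q\<^sub>2 l\<^sub>2 by fact
  let ?I = "A.M1.invariants_mod (card (carrier G))" and ?L = "A.M1.liftable_mod (card (carrier G))"
  have "group (additive_group ?I Mod ?L)"
    by (intro normal.factorgroup_is_group normal_additive_group A.M1.subgroup_invariants_mod
        A.M1.subgroup_liftable_mod A.M1.liftable_subset)
  then have "torsion_subgroup (double_quotient J\<^sub>1 I\<^sub>1 p\<^sub>1 q\<^sub>1 l\<^sub>1 J\<^sub>2 I\<^sub>2 p\<^sub>2 q\<^sub>2 l\<^sub>2 act V) \<cong>
      additive_group ?I Mod ?L"
    using A.M1.graph_torsion group.iso_sym unfolding double_quotient_def double_relations_def by blast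
  also have "\<dots> \<cong> torsion_subgroup (double_quotient J\<^sub>3 I\<^sub>3 p\<^sub>3 q\<^sub>3 l\<^sub>3 J\<^sub>2 I\<^sub>2 p\<^sub>2 q\<^sub>2 l\<^sub>2 act V)"
    using B.M1.graph_torsion unfolding double_quotient_def double_relations_def .
  finally show ?thesis .
qed

section \<open>The integral group ring, skew products and bouquets\<close>

definition group_functions :: "('g, 'm) monoid_scheme \<Rightarrow> ('g \<Rightarrow> int) set" where
  "group_functions G = locally_constant (discrete_topology (carrier G)) UNIV"

text \<open>In terms of coefficients, \<open>v \<mapsto> translate G k v\<close> is multiplication by \<open>k\<close> in the group ring.\<close>

definition translate :: "('g, 'm) monoid_scheme \<Rightarrow> 'g \<Rightarrow> ('g \<Rightarrow> int) \<Rightarrow> 'g \<Rightarrow> int" where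
  "translate G k v = (\<lambda>g. if g \<in> carrier G then v (inv\<^bsub>G\<^esub> k \<otimes>\<^bsub>G\<^esub> g) else 0)"

lemma group_functions_iff: "v \<in> group_functions G \<longleftrightarrow> (\<forall>g. g \<notin> carrier G \<longrightarrow> v g = 0)"
  by (simp add: group_functions_def locally_constant_def)

text \<open>Vanishing of \<open>H\<^sup>1\<close> for the group ring: a function on \<open>G\<close> that is translation invariant modulo \<open>n\<close>
  is modulo \<open>n\<close> equal to the constant function given by its value at the identity.\<close>

lemma acyclic_module_group_functions:
  assumes "comm_group G" "finite (carrier G)"
  shows "acyclic_module G (group_functions G) (translate G)"
proof -
  interpret G: comm_group G by fact
  interpret torsion_free_module G "group_functions G" "{0}" "translate G"
  proof
    show "pure_in {0} (group_functions G)"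
      by (auto simp: pure_in_def fun_eq_iff of_nat_fun_apply)
    fix k l v assume kl: "k \<in> carrier G" "l \<in> carrier G"
    have "inv\<^bsub>G\<^esub> l \<otimes>\<^bsub>G\<^esub> (inv\<^bsub>G\<^esub> k \<otimes>\<^bsub>G\<^esub> g) = inv\<^bsub>G\<^esub> (k \<otimes>\<^bsub>G\<^esub> l) \<otimes>\<^bsub>G\<^esub> g"
      if "g \<in> carrier G" for g
      using kl that by (simp add: G.inv_mult_group G.m_assoc)
    then show "translate G k (translate G l v) = translate G (k \<otimes>\<^bsub>G\<^esub> l) v"
      using kl by (auto simp: translate_def fun_eq_iff)
  qed (use assms(2) in \<open>auto simp: subgroup_add_def group_functions_iff translate_def fun_eq_iff\<close>)
  show ?thesis
  proof
    fix n :: nat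
    show "invariants_mod n \<subseteq> liftable_mod n"
    proof
      fix v assume v: "v \<in> invariants_mod n"
      then have vV: "v \<in> group_functions G" by (simp add: invariants_mod_def)
      have "\<forall>k\<in>carrier G. \<exists>u. v - translate G k v - of_nat n * u = 0"
        using v by (auto simp: invariants_mod_def cong_mod_def)
      then obtain u where u: "\<And>k. k \<in> carrier G \<Longrightarrow> v - translate G k v - of_nat n * u k = 0"
        by metis
      \<comment> \<open>Evaluated at the identity, invariance modulo \<open>n\<close> compares all values of \<open>v\<close> with \<open>v \<one>\<close>.\<close>
      have u1: "v \<one>\<^bsub>G\<^esub> - v (inv\<^bsub>G\<^esub> k) = int n * u k \<one>\<^bsub>G\<^esub>" if "k \<in> carrier G" for k
        using fun_cong[OF u[OF that], of "\<one>\<^bsub>G\<^esub>"] that by (simp add: translate_def of_nat_fun_apply)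
      define d where "d g = (if g \<in> carrier G then - u (inv\<^bsub>G\<^esub> g) \<one>\<^bsub>G\<^esub> else 0)" for g
      have "(v - of_nat n * d) g = v \<one>\<^bsub>G\<^esub>" if "g \<in> carrier G" for g
        using u1[of "inv\<^bsub>G\<^esub> g"] that by (simp add: d_def of_nat_fun_apply algebra_simps)
      moreover have "(v - of_nat n * d) g = 0" if "g \<notin> carrier G" for g
        using vV that by (simp add: d_def of_nat_fun_apply group_functions_iff)
      ultimately have "v - of_nat n * d \<in> invariants_mod 0"
        by (auto simp: invariants_mod_0_iff group_functions_iff translate_def fun_eq_iff)
      moreover have "d \<in> group_functions G" by (simp add: group_functions_iff d_def)
      ultimately show "v \<in> liftable_mod n" using vV by (auto simp: liftable_mod_def)
    qed
  qed
qed

lemma cantor_space_compact: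
  assumes "cantor_space X" shows "compact_space X" "topspace X \<noteq> {}"
proof -
  let ?C = "product_topology (\<lambda>n::nat. discrete_topology (UNIV :: bool set)) UNIV"
  have h: "X homeomorphic_space ?C" using assms by (simp add: cantor_space_def)
  have "compact_space ?C" by (simp add: compact_space_product_topology compact_space_discrete_topology)
  then show "compact_space X" using homeomorphic_compact_space[OF h] by simp
  have "topspace ?C \<noteq> {}" by simp
  then show "topspace X \<noteq> {}" using homeomorphic_empty_space[OF h]
    by (metis null_topspace_iff_trivial)
qed

lemma minimal_homeomorphism_inverse:
  assumes "minimal_homeomorphism X f"
  shows "continuous_map X X (inv_into (topspace X) f)" "inj_on f (topspace X)" "f ` topspace X = topspace X"
proof -
  have hom: "homeomorphic_map X X f" using assms by (simp add: minimal_homeomorphism_def)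
  show inj: "inj_on f (topspace X)" and surj: "f ` topspace X = topspace X"
    using homeomorphic_imp_injective_map[OF hom] homeomorphic_imp_surjective_map[OF hom] .
  obtain g where g: "homeomorphic_maps X X f g" using hom homeomorphic_map_maps by blast
  have "g x = inv_into (topspace X) f x" if "x \<in> topspace X" for x
  proof (rule inv_into_f_eq[OF inj, symmetric])
    show "g x \<in> topspace X" "f (g x) = x"
      using g that by (auto simp: homeomorphic_maps_def continuous_map_def)
  qed
  moreover have "continuous_map X X g" using g by (simp add: homeomorphic_maps_def)
  ultimately show "continuous_map X X (inv_into (topspace X) f)"
    by (metis continuous_map_eq)
qed

text \<open>A clopen set in the cover that is compatible with the edges is exactly a clopen set invariant under
  the skew product, so minimality of the latter is the required connectedness.\<close>

lemma labelled_graph_skew_product: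
  fixes G :: "('g, 'm) monoid_scheme" (structure)
  assumes "comm_group G" "finite (carrier G)" "cantor_space X" "minimal_homeomorphism X \<phi>"
    "nondegenerate_cocycle X G \<phi> \<xi>"
  shows "labelled_graph G X X (\<lambda>x. x) (inv_into (topspace X) \<phi>) (\<lambda>x. \<xi> (inv_into (topspace X) \<phi> x))"
proof -
  interpret comm_group G by fact
  let ?P = "prod_topology X (discrete_topology (carrier G))" and ?\<phi>' = "inv_into (topspace X) \<phi>"
  note \<phi> = minimal_homeomorphism_inverse[OF assms(4)]
  have \<xi>: "continuous_map X (discrete_topology (carrier G)) \<xi>"
    and min: "minimal_homeomorphism ?P (skew_product G \<phi> \<xi>)"
    using assms(5) by (simp_all add: nondegenerate_cocycle_def cocycle_def)
  have \<xi>_in: "\<xi> x \<in> carrier G" if "x \<in> topspace X" for x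
    using \<xi> that by (auto simp: continuous_map_def)
  show ?thesis
  proof
    show "continuous_map X (discrete_topology (carrier G)) (\<lambda>x. \<xi> (?\<phi>' x))"
      using continuous_map_compose[OF \<phi>(1) \<xi>] by (simp add: comp_def)
    fix C assume "closedin ?P C" "openin ?P C"
      and inv: "\<And>i g. i \<in> topspace X \<Longrightarrow> g \<in> carrier G \<Longrightarrow> (i, g \<otimes> \<xi> (?\<phi>' i)) \<in> C \<longleftrightarrow> (?\<phi>' i, g) \<in> C"
    have sub: "C \<subseteq> topspace X \<times> carrier G" using closedin_subset[OF \<open>closedin ?P C\<close>] by simp
    have step: "skew_product G \<phi> \<xi> (x, g) \<in> C \<longleftrightarrow> (x, g) \<in> C" if "x \<in> topspace X" "g \<in> carrier G" for x g
      using inv[of "\<phi> x" g] that \<phi> by (auto simp: skew_product_def inv_into_f_f)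
    have "skew_product G \<phi> \<xi> ` C = C"
    proof (intro equalityI subsetI)
      fix z assume "z \<in> skew_product G \<phi> \<xi> ` C"
      then show "z \<in> C" using step sub by blast
    next
      fix z assume z: "z \<in> C"
      then have "z \<in> skew_product G \<phi> \<xi> ` (topspace X \<times> carrier G)"
        using minimal_homeomorphism_inverse(3)[OF min] sub by auto
      then obtain x g where "x \<in> topspace X" "g \<in> carrier G" "z = skew_product G \<phi> \<xi> (x, g)" by blast
      then show "z \<in> skew_product G \<phi> \<xi> ` C" using step[of x g] z by blast
    qed
    then show "C = {} \<or> C = topspace X \<times> carrier G"
      using min \<open>closedin ?P C\<close> by (auto simp: minimal_homeomorphism_def)
  qed (use assms(2) \<phi>(1) cantor_space_compact[OF assms(3)] in auto)
qed

text \<open>The group elements that stabilise a compatible subset of the single fibre \<open>G\<close> form a subgroup that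
  contains all labels.\<close>

lemma labelled_graph_bouquet:
  fixes G :: "('g, 'm) monoid_scheme" (structure)
  assumes "comm_group G" "finite (carrier G)" "finite A" "\<mu> \<in> A \<rightarrow> carrier G"
    and gen: "generate G (\<mu> ` A) = carrier G"
  shows "labelled_graph G (discrete_topology {()}) (discrete_topology A) (\<lambda>_. ()) (\<lambda>_. ()) \<mu>"
proof -
  interpret comm_group G by fact
  let ?P = "prod_topology (discrete_topology {()}) (discrete_topology (carrier G))"
  show ?thesis
  proof
    fix C assume "closedin ?P C" "openin ?P C"
      and inv: "\<And>i g. i \<in> topspace (discrete_topology A) \<Longrightarrow> g \<in> carrier G \<Longrightarrow>
        ((), g \<otimes> \<mu> i) \<in> C \<longleftrightarrow> ((), g) \<in> C"
    have sub: "C \<subseteq> {()} \<times> carrier G" using closedin_subset[OF \<open>closedin ?P C\<close>] by simp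
    define S where "S = {h \<in> carrier G. \<forall>g\<in>carrier G. ((), g \<otimes> h) \<in> C \<longleftrightarrow> ((), g) \<in> C}"
    have "subgroup S G"
    proof (rule subgroupI)
      show "S \<subseteq> carrier G" by (auto simp: S_def)
      show "S \<noteq> {}" using one_closed by (auto simp: S_def intro!: exI[of _ \<one>])
      fix a assume a: "a \<in> S"
      show "inv a \<in> S"
      proof -
        have aG: "a \<in> carrier G" and a': "\<And>g. g \<in> carrier G \<Longrightarrow> ((), g \<otimes> a) \<in> C \<longleftrightarrow> ((), g) \<in> C"
          using a by (auto simp: S_def)
        have "((), g \<otimes> inv a) \<in> C \<longleftrightarrow> ((), g) \<in> C" if "g \<in> carrier G" for g
          using a'[of "g \<otimes> inv a"] that aG by (simp add: m_assoc)
        then show ?thesis using aG by (simp add: S_def)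
      qed
      fix b assume b: "b \<in> S"
      show "a \<otimes> b \<in> S" using a b by (auto simp: S_def m_assoc[symmetric])
    qed
    moreover have "\<mu> ` A \<subseteq> S" using inv assms(4) by (auto simp: S_def)
    ultimately have "carrier G \<subseteq> S" using generate_subgroup_incl[of "\<mu> ` A" S] gen by blast
    then have *: "((), \<one> \<otimes> h) \<in> C \<longleftrightarrow> ((), \<one>) \<in> C" if "h \<in> carrier G" for h
      using that one_closed unfolding S_def by blast
    have "((), h) \<in> C \<longleftrightarrow> ((), \<one>) \<in> C" if "h \<in> carrier G" for h
      using *[OF that] by (simp only: l_one[OF that])
    then show "C = {} \<or> C = topspace (discrete_topology {()}) \<times> carrier G"
      using sub by (cases "((), \<one>) \<in> C") auto
  qed (use assms in \<open>auto simp: compact_space_discrete_topology\<close>)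
qed

section \<open>Coinvariants as a double quotient\<close>

lemma restrict_int_functions:
  assumes "continuous_map Z (discrete_topology UNIV) h"
  shows "(\<lambda>z\<in>topspace Z. h z) \<in> carrier (int_functions Z)"
proof -
  have "continuous_map Z (discrete_topology UNIV) (\<lambda>z\<in>topspace Z. h z)"
    by (rule continuous_map_eq[OF assms]) simp
  then show ?thesis by (simp add: int_functions_def)
qed

lemma comm_group_int_functions: "comm_group (int_functions Z)"
proof (rule comm_groupI)
  have cont: "continuous_map Z (discrete_topology UNIV) f" if "f \<in> carrier (int_functions Z)" for f
    using that by (simp add: int_functions_def)
  have add: "f \<otimes>\<^bsub>int_functions Z\<^esub> g = (\<lambda>z\<in>topspace Z. f z + g z)" for f g
    by (simp add: int_functions_def)
  have zero: "\<one>\<^bsub>int_functions Z\<^esub> = (\<lambda>z\<in>topspace Z. 0)"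
    by (simp add: int_functions_def)
  show "\<one>\<^bsub>int_functions Z\<^esub> \<in> carrier (int_functions Z)"
    unfolding zero by (rule restrict_int_functions) simp
  fix f assume f: "f \<in> carrier (int_functions Z)"
  show "\<one>\<^bsub>int_functions Z\<^esub> \<otimes>\<^bsub>int_functions Z\<^esub> f = f"
    using f by (auto simp: int_functions_def extensional_def fun_eq_iff)
  have "(\<lambda>z\<in>topspace Z. - f z) \<in> carrier (int_functions Z)"
    by (rule restrict_int_functions[OF continuous_map_discrete_compose[OF cont[OF f]]])
  then show "\<exists>g\<in>carrier (int_functions Z). g \<otimes>\<^bsub>int_functions Z\<^esub> f = \<one>\<^bsub>int_functions Z\<^esub>"
    by (rule rev_bexI) (auto simp: add zero fun_eq_iff)
  fix g assume g: "g \<in> carrier (int_functions Z)"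
  show "f \<otimes>\<^bsub>int_functions Z\<^esub> g \<in> carrier (int_functions Z)"
    unfolding add
    by (rule restrict_int_functions[OF continuous_map_discrete_compose2[OF cont[OF f] cont[OF g]]])
  show "f \<otimes>\<^bsub>int_functions Z\<^esub> g = g \<otimes>\<^bsub>int_functions Z\<^esub> f"
    by (auto simp: add fun_eq_iff)
  fix h
  show "f \<otimes>\<^bsub>int_functions Z\<^esub> g \<otimes>\<^bsub>int_functions Z\<^esub> h = f \<otimes>\<^bsub>int_functions Z\<^esub> (g \<otimes>\<^bsub>int_functions Z\<^esub> h)"
    by (auto simp: add fun_eq_iff)
qed

lemma locally_constant_compose:
  assumes "f \<in> locally_constant T V" "\<And>v. v \<in> V \<Longrightarrow> c v \<in> V'" "c 0 = 0"
  shows "(\<lambda>x. c (f x)) \<in> locally_constant T V'"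
  using assms continuous_map_discrete_compose[of T f c] by (simp add: locally_constant_def)

lemma (in group_hom) subgroup_preimage:
  assumes "subgroup S H" shows "subgroup {x \<in> carrier G. h x \<in> S} G"
  by (rule G.subgroupI)
    (use subgroup.one_closed[OF assms] subgroup.m_closed[OF assms] subgroup.m_inv_closed[OF assms]
      in \<open>auto intro: exI[of _ "\<one>\<^bsub>G\<^esub>"]\<close>)

lemma lift_first_inverse:
  fixes G :: "('g, 'm) monoid_scheme" (structure)
  assumes "group G" "inj_on \<phi> (topspace X)" "\<phi> ` topspace X = topspace X"
    and \<xi>: "\<And>x. x \<in> topspace X \<Longrightarrow> \<xi> x \<in> carrier G"
    and z: "x \<in> topspace X" "y \<in> topspace Y" "g \<in> carrier G"
  shows "inv_into (topspace (product_space X Y G)) (lift_first G \<phi> \<xi>) (x, y, g) =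
    (inv_into (topspace X) \<phi> x, y, g \<otimes>\<^bsub>G\<^esub> inv\<^bsub>G\<^esub> \<xi> (inv_into (topspace X) \<phi> x))"
proof -
  interpret group G by fact
  let ?x = "inv_into (topspace X) \<phi> x"
  have x: "?x \<in> topspace X" "\<phi> ?x = x"
    using assms(3) z(1) by (metis inv_into_into, metis f_inv_into_f)
  show ?thesis
  proof (rule inv_into_f_eq)
    show "inj_on (lift_first G \<phi> \<xi>) (topspace (product_space X Y G))"
      using assms(2) \<xi> by (auto simp: inj_on_def lift_first_def product_space_def)
    show "(?x, y, g \<otimes> inv \<xi> ?x) \<in> topspace (product_space X Y G)"
      using x \<xi> z by (simp add: product_space_def)
    show "lift_first G \<phi> \<xi> (?x, y, g \<otimes> inv \<xi> ?x) = (x, y, g)"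
      using x \<xi> z by (simp add: lift_first_def m_assoc)
  qed
qed

lemma lift_second_inverse:
  fixes G :: "('g, 'm) monoid_scheme" (structure)
  assumes "group G" "inj_on \<psi> (topspace Y)" "\<psi> ` topspace Y = topspace Y"
    and \<eta>: "\<And>y. y \<in> topspace Y \<Longrightarrow> \<eta> y \<in> carrier G"
    and z: "x \<in> topspace X" "y \<in> topspace Y" "g \<in> carrier G"
  shows "inv_into (topspace (product_space X Y G)) (lift_second G \<psi> \<eta>) (x, y, g) =
    (x, inv_into (topspace Y) \<psi> y, g \<otimes>\<^bsub>G\<^esub> inv\<^bsub>G\<^esub> \<eta> (inv_into (topspace Y) \<psi> y))"
proof -
  interpret group G by fact
  let ?y = "inv_into (topspace Y) \<psi> y"
  have y: "?y \<in> topspace Y" "\<psi> ?y = y"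
    using assms(3) z(2) by (metis inv_into_into, metis f_inv_into_f)
  show ?thesis
  proof (rule inv_into_f_eq)
    show "inj_on (lift_second G \<psi> \<eta>) (topspace (product_space X Y G))"
      using assms(2) \<eta> by (auto simp: inj_on_def lift_second_def product_space_def)
    show "(x, ?y, g \<otimes> inv \<eta> ?y) \<in> topspace (product_space X Y G)"
      using y \<eta> z by (simp add: product_space_def)
    show "lift_second G \<psi> \<eta> (x, ?y, g \<otimes> inv \<eta> ?y) = (x, y, g)"
      using y \<eta> z by (simp add: lift_second_def m_assoc)
  qed
qed

text \<open>From extensional functions on the product to iterated functions that are zero outside.\<close>

definition curry_extend where
  "curry_extend X Y G f = (\<lambda>x y g. if (x, y, g) \<in> topspace (product_space X Y G) then f (x, y, g) else (0::int))"

lemma iso_curry_extend: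
  assumes "compact_space Y" "finite (carrier G)"
  shows "curry_extend X Y G \<in> iso (int_functions (product_space X Y G))
    (additive_group (locally_constant X (locally_constant Y (group_functions G))))"
proof -
  let ?Z = "product_space X Y G" and ?Y = "prod_topology Y (discrete_topology (carrier G))"
  let ?W = "locally_constant X (locally_constant Y (group_functions G))"
  have cG: "compact_space (discrete_topology (carrier G))"
    using assms(2) by (simp add: compact_space_discrete_topology)
  have cY: "compact_space ?Y" using assms(1) cG by (simp add: compact_space_prod_topology)
  have into: "curry_extend X Y G f \<in> ?W" if "f \<in> carrier (int_functions ?Z)" for f
  proof -
    have f: "continuous_map ?Z (discrete_topology UNIV) f" using that by (simp add: int_functions_def)
    have "continuous_map ?Z (discrete_topology UNIV) (\<lambda>z. if z \<in> topspace ?Z then f z else 0)"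
      by (rule continuous_map_eq[OF f]) simp
    then have "(\<lambda>z. if z \<in> topspace ?Z then f z else 0) \<in> locally_constant (prod_topology X ?Y) UNIV"
      by (simp add: locally_constant_def product_space_def)
    from locally_constant_curry[OF cY this]
    have "(\<lambda>x w. if (x, w) \<in> topspace ?Z then f (x, w) else 0) \<in> locally_constant X (locally_constant ?Y UNIV)" .
    from locally_constant_compose[OF this, of "\<lambda>u y g. u (y, g)", OF locally_constant_curry[OF cG]]
    show ?thesis unfolding curry_extend_def group_functions_def by (auto simp: zero_fun_def)
  qed
  have bij: "bij_betw (curry_extend X Y G) (carrier (int_functions ?Z)) ?W"
  proof (rule bij_betwI)
    let ?u = "\<lambda>w. \<lambda>(x, y, g)\<in>topspace ?Z. w x y g"
    show "curry_extend X Y G \<in> carrier (int_functions ?Z) \<rightarrow> ?W" using into by blast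
    show "?u \<in> ?W \<rightarrow> carrier (int_functions ?Z)"
    proof
      fix w assume w: "w \<in> ?W"
      have "(\<lambda>x (y, g). w x y g) \<in> locally_constant X (locally_constant ?Y UNIV)"
        by (rule locally_constant_compose[OF w[unfolded group_functions_def],
              of "\<lambda>u (y, g). u y g", OF locally_constant_uncurry]) (auto simp: fun_eq_iff)
      from locally_constantD(1)[OF locally_constant_uncurry[OF this]]
      have "continuous_map ?Z (discrete_topology UNIV) (\<lambda>(x, y, g). w x y g)"
        by (simp add: product_space_def)
      then have "continuous_map ?Z (discrete_topology UNIV) (?u w)"
        by (rule continuous_map_eq) simp
      then show "?u w \<in> carrier (int_functions ?Z)"
        unfolding int_functions_def by simp
    qed
    show "?u (curry_extend X Y G f) = f" if "f \<in> carrier (int_functions ?Z)" for f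
      using that by (auto simp: curry_extend_def int_functions_def extensional_def fun_eq_iff)
    show "curry_extend X Y G (?u w) = w" if w: "w \<in> ?W" for w
    proof (intro ext)
      fix x y g
      have "w x y g = 0" if "x \<notin> topspace X \<or> y \<notin> topspace Y \<or> g \<notin> carrier G"
      proof (cases "x \<in> topspace X \<and> y \<in> topspace Y")
        case True
        then show ?thesis
          using that locally_constantD(2)[OF locally_constantD(2)[OF w]] by (auto simp: group_functions_iff)
      next
        case False
        then show ?thesis
          using locally_constantD(3)[OF w]
            locally_constantD(3)[OF locally_constantD(2)[OF w]]
          by (cases "x \<in> topspace X") auto
      qed
      then show "curry_extend X Y G (?u w) x y g = w x y g"
        by (auto simp: curry_extend_def product_space_def)
    qed
  qed
  have "curry_extend X Y G \<in> hom (int_functions ?Z) (additive_group ?W)"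
    using into by (auto simp: hom_def int_functions_def curry_extend_def fun_eq_iff)
  then show ?thesis using bij by (simp add: iso_def)
qed

text \<open>Under currying, \<open>f \<mapsto> f - f \<circ> \<Phi>\<inverse>\<close> for the two lifted homeomorphisms becomes the coboundary in the first
  and in the second variable.  The translation by the label appears because \<open>\<Phi>\<inverse>\<close> multiplies the
  group coordinate by the inverse of the cocycle.\<close>

theorem coinvariants_iso_double_quotient:
  assumes "comm_group G" "finite (carrier G)" "cantor_space X" "cantor_space Y"
    "minimal_homeomorphism X \<phi>" "minimal_homeomorphism Y \<psi>"
    "nondegenerate_cocycle X G \<phi> \<xi>" "nondegenerate_cocycle Y G \<psi> \<eta>"
  defines "\<phi>' \<equiv> inv_into (topspace X) \<phi>" and "\<psi>' \<equiv> inv_into (topspace Y) \<psi>"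
  shows "coinvariants (product_space X Y G) (lift_first G \<phi> \<xi>) (lift_second G \<psi> \<eta>) \<cong>
    double_quotient X X (\<lambda>x. x) \<phi>' (\<lambda>x. \<xi> (\<phi>' x)) Y Y (\<lambda>y. y) \<psi>' (\<lambda>y. \<eta> (\<psi>' y))
      (translate G) (group_functions G)" (is ?iso)
    and "group (coinvariants (product_space X Y G) (lift_first G \<phi> \<xi>) (lift_second G \<psi> \<eta>))" (is ?group)
proof -
  interpret G: comm_group G by fact
  interpret A: acyclic_module G "group_functions G" "translate G"
    by (rule acyclic_module_group_functions) fact+
  interpret GX: labelled_graph G X X "\<lambda>x. x" \<phi>' "\<lambda>x. \<xi> (\<phi>' x)"
    unfolding \<phi>'_def by (rule labelled_graph_skew_product) fact+
  interpret GY: labelled_graph G Y Y "\<lambda>y. y" \<psi>' "\<lambda>y. \<eta> (\<psi>' y)"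
    unfolding \<psi>'_def by (rule labelled_graph_skew_product) fact+
  interpret D: two_graphs G "group_functions G" "translate G"
    X X "\<lambda>x. x" \<phi>' "\<lambda>x. \<xi> (\<phi>' x)" Y Y "\<lambda>y. y" \<psi>' "\<lambda>y. \<eta> (\<psi>' y)"
    by unfold_locales
  let ?Z = "product_space X Y G" and ?S = "lift_first G \<phi> \<xi>" and ?T = "lift_second G \<psi> \<eta>"
  let ?F = "curry_extend X Y G"
  note \<phi> = minimal_homeomorphism_inverse[OF assms(5)] and \<psi> = minimal_homeomorphism_inverse[OF assms(6)]
  have \<xi>: "\<xi> x \<in> carrier G" if "x \<in> topspace X" for x
    using assms(7) that by (auto simp: nondegenerate_cocycle_def cocycle_def continuous_map_def)
  have \<eta>: "\<eta> y \<in> carrier G" if "y \<in> topspace Y" for y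
    using assms(8) that by (auto simp: nondegenerate_cocycle_def cocycle_def continuous_map_def)
  have S': "inv_into (topspace ?Z) ?S (x, y, g) = (\<phi>' x, y, g \<otimes>\<^bsub>G\<^esub> inv\<^bsub>G\<^esub> \<xi> (\<phi>' x))"
    if "x \<in> topspace X" "y \<in> topspace Y" "g \<in> carrier G" for x y g
    unfolding \<phi>'_def by (rule lift_first_inverse[OF G.is_group \<phi>(2,3) \<xi> that])
  have T': "inv_into (topspace ?Z) ?T (x, y, g) = (x, \<psi>' y, g \<otimes>\<^bsub>G\<^esub> inv\<^bsub>G\<^esub> \<eta> (\<psi>' y))"
    if "x \<in> topspace X" "y \<in> topspace Y" "g \<in> carrier G" for x y g
    unfolding \<psi>'_def by (rule lift_second_inverse[OF G.is_group \<psi>(2,3) \<eta> that])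
  have F: "?F \<in> iso (int_functions ?Z) (additive_group D.M1.cochains)"
    by (rule iso_curry_extend[OF cantor_space_compact(1)[OF assms(4)] assms(2)])
  then have bij: "?F ` carrier (int_functions ?Z) = D.M1.cochains"
    by (auto simp: iso_def bij_betw_def)
  have mem: "(x, y, g) \<in> topspace ?Z \<longleftrightarrow> x \<in> topspace X \<and> y \<in> topspace Y \<and> g \<in> carrier G" for x y g
    by (simp add: product_space_def)
  have cob: "?F (\<lambda>z\<in>topspace ?Z. f1 z - f1 (inv_into (topspace ?Z) ?S z) + f2 z - f2 (inv_into (topspace ?Z) ?T z))
    = D.M1.cob (?F f1) + (\<lambda>x. D.M2.cob (?F f2 x))" for f1 f2
  proof (intro ext)
    fix x y g
    let ?l = "?F (\<lambda>z\<in>topspace ?Z. f1 z - f1 (inv_into (topspace ?Z) ?S z) + f2 z - f2 (inv_into (topspace ?Z) ?T z)) x y g"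
    let ?r = "(D.M1.cob (?F f1) + (\<lambda>x. D.M2.cob (?F f2 x))) x y g"
    show "?l = ?r"
    proof (cases "x \<in> topspace X \<and> y \<in> topspace Y \<and> g \<in> carrier G")
      case True
      then show ?thesis
        using GX.q_in[of x] GY.q_in[of y] \<xi>[of "\<phi>' x"] \<eta>[of "\<psi>' y"]
        by (simp add: curry_extend_def graph_coboundary_def translate_def mem S' T' G.m_comm)
    next
      case False
      then show ?thesis
        by (auto simp: curry_extend_def graph_coboundary_def translate_def product_space_def)
    qed
  qed
  have img: "?F ` coboundaries ?Z ?S ?T = D.relations\<^sub>1\<^sub>2"
  proof (intro equalityI subsetI)
    fix w assume "w \<in> ?F ` coboundaries ?Z ?S ?T"
    then obtain f1 f2 where "f1 \<in> carrier (int_functions ?Z)" "f2 \<in> carrier (int_functions ?Z)"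
      "w = D.M1.cob (?F f1) + (\<lambda>x. D.M2.cob (?F f2 x))"
      unfolding coboundaries_def by (auto simp only: cob)
    then show "w \<in> D.relations\<^sub>1\<^sub>2"
      unfolding D.double_relations_eq bij[symmetric] by blast
  next
    fix w assume "w \<in> D.relations\<^sub>1\<^sub>2"
    then obtain H k where Hk: "H \<in> D.M1.cochains" "k \<in> D.M1.cochains"
      and w: "w = D.M1.cob H + (\<lambda>x. D.M2.cob (k x))"
      unfolding D.double_relations_eq by auto
    obtain f1 f2 where f: "f1 \<in> carrier (int_functions ?Z)" "f2 \<in> carrier (int_functions ?Z)"
      "H = ?F f1" "k = ?F f2"
      using Hk unfolding bij[symmetric] by auto
    show "w \<in> ?F ` coboundaries ?Z ?S ?T"
      unfolding w f(3,4) cob[symmetric] coboundaries_def using f(1,2) by blast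
  qed
  have sub: "subgroup D.relations\<^sub>1\<^sub>2 (additive_group D.M1.cochains)"
    unfolding double_relations_def
    by (intro subgroup_additive_group subgroup_locally_constant A.V D.M1.subgroup_relations
        D.M1.relations_subset)
  have comm: "comm_group (additive_group D.M1.cochains)"
    by (intro comm_group_additive_group subgroup_locally_constant A.V)
  interpret int_functions: comm_group "int_functions ?Z" by (rule comm_group_int_functions)
  interpret F: group_hom "int_functions ?Z" "additive_group D.M1.cochains" ?F
    using F comm_group.axioms(2)[OF comm] int_functions.is_group
    by (auto simp: group_hom_def group_hom_axioms_def iso_def)
  have inj: "f = f'" if "f \<in> extensional (topspace ?Z)" "f' \<in> extensional (topspace ?Z)" "?F f = ?F f'" for f f'
  proof (rule extensionalityI[OF that(1,2)])
    show "f z = f' z" if "z \<in> topspace ?Z" for z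
      using fun_cong[OF fun_cong[OF fun_cong[OF \<open>?F f = ?F f'\<close>, of "fst z"], of "fst (snd z)"], of "snd (snd z)"] that
      by (simp add: curry_extend_def)
  qed
  have ext: "f \<in> extensional (topspace ?Z)" if "f \<in> carrier (int_functions ?Z) \<or> f \<in> coboundaries ?Z ?S ?T" for f
    using that by (auto simp: coboundaries_def int_functions_def)
  have "coboundaries ?Z ?S ?T = {f \<in> carrier (int_functions ?Z). ?F f \<in> D.relations\<^sub>1\<^sub>2}"
  proof (intro equalityI subsetI)
    fix f assume f: "f \<in> coboundaries ?Z ?S ?T"
    then have Ff: "?F f \<in> D.relations\<^sub>1\<^sub>2" using img by blast
    then obtain f' where f': "f' \<in> carrier (int_functions ?Z)" "?F f = ?F f'"
      using subgroup.subset[OF sub] bij by auto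
    then have "f = f'" using f by (intro inj ext) auto
    then show "f \<in> {f \<in> carrier (int_functions ?Z). ?F f \<in> D.relations\<^sub>1\<^sub>2}" using f' Ff by simp
  next
    fix f assume f: "f \<in> {f \<in> carrier (int_functions ?Z). ?F f \<in> D.relations\<^sub>1\<^sub>2}"
    then obtain f' where f': "f' \<in> coboundaries ?Z ?S ?T" "?F f = ?F f'"
      unfolding img[symmetric] by auto
    then have "f = f'" using f by (intro inj ext) auto
    then show "f \<in> coboundaries ?Z ?S ?T" using f' by simp
  qed
  then have cob_sub: "subgroup (coboundaries ?Z ?S ?T) (int_functions ?Z)"
    using F.subgroup_preimage[OF sub] by simp
  have "int_functions ?Z Mod coboundaries ?Z ?S ?T \<cong>
    additive_group D.M1.cochains Mod ?F ` coboundaries ?Z ?S ?T"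
    by (rule Mod_iso[OF int_functions.is_group comm F subgroup.subset[OF cob_sub]]) (unfold img, rule sub)
  then show ?iso unfolding coinvariants_def img double_quotient_def .
  show ?group
    unfolding coinvariants_def
    by (rule comm_group.axioms(2)[OF int_functions.abelian_FactGroup[OF cob_sub]])
qed

section \<open>Tensor products and the group N(A, B)\<close>

text \<open>Three facts about the tensor product are needed to compute it on free groups: bilinearity of pure
  tensors, the universal property, and generation by pure tensors.\<close>

locale tensor_of_groups = M: comm_group M + N: comm_group N
  for M :: "('a, 'm) monoid_scheme" and N :: "('b, 'n) monoid_scheme"
begin

abbreviation "F \<equiv> free_Abelian_group (carrier M \<times> carrier N)"

lemma tensor_relations_subgroup: "subgroup (tensor_relations M N) F"
  unfolding tensor_relations_def
proof (rule group.generate_is_subgroup[OF group_free_Abelian_group], intro Un_least subsetI)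
  fix r assume "r \<in> {frag_of (x \<otimes>\<^bsub>M\<^esub> x', y) - frag_of (x, y) - frag_of (x', y) | x x' y.
           x \<in> carrier M \<and> x' \<in> carrier M \<and> y \<in> carrier N}"
  then obtain x x' y where "r = frag_of (x \<otimes>\<^bsub>M\<^esub> x', y) - frag_of (x, y) - frag_of (x', y)"
    "x \<in> carrier M" "x' \<in> carrier M" "y \<in> carrier N" by blast
  then show "r \<in> carrier F"
    using keys_diff[of "frag_of (x \<otimes>\<^bsub>M\<^esub> x', y) - frag_of (x, y)" "frag_of (x', y)"]
      keys_diff[of "frag_of (x \<otimes>\<^bsub>M\<^esub> x', y)" "frag_of (x, y)"] by fastforce
next
  fix r assume "r \<in> {frag_of (x, y \<otimes>\<^bsub>N\<^esub> y') - frag_of (x, y) - frag_of (x, y') | x y y'.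
           x \<in> carrier M \<and> y \<in> carrier N \<and> y' \<in> carrier N}"
  then obtain x y y' where "r = frag_of (x, y \<otimes>\<^bsub>N\<^esub> y') - frag_of (x, y) - frag_of (x, y')"
    "x \<in> carrier M" "y \<in> carrier N" "y' \<in> carrier N" by blast
  then show "r \<in> carrier F"
    using keys_diff[of "frag_of (x, y \<otimes>\<^bsub>N\<^esub> y') - frag_of (x, y)" "frag_of (x, y')"]
      keys_diff[of "frag_of (x, y \<otimes>\<^bsub>N\<^esub> y')" "frag_of (x, y)"] by fastforce
qed

sublocale F: comm_group F by (rule abelian_free_Abelian_group)

lemma tensor_relations_normal: "tensor_relations M N \<lhd> F"
  by (rule F.subgroup_imp_normal[OF tensor_relations_subgroup])

lemma comm_group_tensor_product: "comm_group (tensor_product M N)"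
  unfolding tensor_product_def by (rule F.abelian_FactGroup[OF tensor_relations_subgroup])

lemma pure_tensor_closed:
  "x \<in> carrier M \<Longrightarrow> y \<in> carrier N \<Longrightarrow> pure_tensor M N x y \<in> carrier (tensor_product M N)"
  by (auto simp: pure_tensor_def tensor_product_def FactGroup_def RCOSETS_def)

lemma coset_sum:
  assumes "u \<in> carrier F" "v \<in> carrier F" "w \<in> carrier F" "u - v - w \<in> tensor_relations M N"
  shows "tensor_relations M N #>\<^bsub>F\<^esub> u =
    (tensor_relations M N #>\<^bsub>F\<^esub> v) \<otimes>\<^bsub>tensor_product M N\<^esub> (tensor_relations M N #>\<^bsub>F\<^esub> w)"
proof -
  have vw: "v + w \<in> carrier F" using F.m_closed[OF assms(2,3)] by simp
  have "u = (u - v - w) \<otimes>\<^bsub>F\<^esub> (v + w)" by simp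
  then have "u \<in> tensor_relations M N #>\<^bsub>F\<^esub> (v + w)"
    using assms(4) unfolding r_coset_def by blast
  then have "tensor_relations M N #>\<^bsub>F\<^esub> u = tensor_relations M N #>\<^bsub>F\<^esub> (v + w)"
    using F.repr_independence[OF _ vw tensor_relations_subgroup] by simp
  also have "\<dots> = (tensor_relations M N #>\<^bsub>F\<^esub> v) <#>\<^bsub>F\<^esub> (tensor_relations M N #>\<^bsub>F\<^esub> w)"
    using normal.rcos_sum[OF tensor_relations_normal assms(2,3)] by simp
  finally show ?thesis by (simp add: tensor_product_def FactGroup_def)
qed

lemma pure_tensor_add_left:
  assumes "x \<in> carrier M" "x' \<in> carrier M" "y \<in> carrier N"
  shows "pure_tensor M N (x \<otimes>\<^bsub>M\<^esub> x') y =
    pure_tensor M N x y \<otimes>\<^bsub>tensor_product M N\<^esub> pure_tensor M N x' y"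
  unfolding pure_tensor_def
proof (rule coset_sum)
  show "frag_of (x \<otimes>\<^bsub>M\<^esub> x', y) - frag_of (x, y) - frag_of (x', y) \<in> tensor_relations M N"
    unfolding tensor_relations_def by (rule generate.incl) (use assms in blast)
qed (use assms in auto)

lemma pure_tensor_add_right:
  assumes "x \<in> carrier M" "y \<in> carrier N" "y' \<in> carrier N"
  shows "pure_tensor M N x (y \<otimes>\<^bsub>N\<^esub> y') =
    pure_tensor M N x y \<otimes>\<^bsub>tensor_product M N\<^esub> pure_tensor M N x y'"
  unfolding pure_tensor_def
proof (rule coset_sum)
  show "frag_of (x, y \<otimes>\<^bsub>N\<^esub> y') - frag_of (x, y) - frag_of (x, y') \<in> tensor_relations M N"
    unfolding tensor_relations_def by (rule generate.incl) (use assms in blast)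
qed (use assms in auto)

lemma tensor_product_universal:
  assumes "comm_group K"
    and closed: "\<And>x y. x \<in> carrier M \<Longrightarrow> y \<in> carrier N \<Longrightarrow> b x y \<in> carrier K"
    and left: "\<And>x x' y. x \<in> carrier M \<Longrightarrow> x' \<in> carrier M \<Longrightarrow> y \<in> carrier N \<Longrightarrow>
      b (x \<otimes>\<^bsub>M\<^esub> x') y = b x y \<otimes>\<^bsub>K\<^esub> b x' y"
    and right: "\<And>x y y'. x \<in> carrier M \<Longrightarrow> y \<in> carrier N \<Longrightarrow> y' \<in> carrier N \<Longrightarrow>
      b x (y \<otimes>\<^bsub>N\<^esub> y') = b x y \<otimes>\<^bsub>K\<^esub> b x y'"
  obtains h where "h \<in> hom (tensor_product M N) K"
    "\<And>x y. x \<in> carrier M \<Longrightarrow> y \<in> carrier N \<Longrightarrow> h (pure_tensor M N x y) = b x y"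
proof -
  interpret K: comm_group K by fact
  have "(\<lambda>(x, y). b x y) ` (carrier M \<times> carrier N) \<subseteq> carrier K" using closed by auto
  from K.free_Abelian_group_universal[OF this]
  obtain f where f: "f \<in> hom F K" and f_of: "\<And>z. z \<in> carrier M \<times> carrier N \<Longrightarrow> f (frag_of z) = (case z of (x, y) \<Rightarrow> b x y)"
    by blast
  interpret f: group_hom F K f
    using f F.is_group K.is_group by (auto simp: group_hom_def group_hom_axioms_def)
  have ker: "u - v - w \<in> kernel F K f"
    if uvw: "u \<in> carrier F" "v \<in> carrier F" "w \<in> carrier F" "f u = f v \<otimes>\<^bsub>K\<^esub> f w" for u v w
  proof -
    have e: "u - v - w = u \<otimes>\<^bsub>F\<^esub> inv\<^bsub>F\<^esub> (v \<otimes>\<^bsub>F\<^esub> w)"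
      using F.m_closed[OF uvw(2,3)] by simp
    have "v \<otimes>\<^bsub>F\<^esub> w \<in> carrier F" by (rule F.m_closed[OF uvw(2,3)])
    then show ?thesis
      using uvw unfolding kernel_def e by (auto simp del: mult_free_Abelian_group inv_free_Abelian_group carrier_free_Abelian_group_iff)
  qed
  have "tensor_relations M N \<subseteq> kernel F K f"
    unfolding tensor_relations_def
  proof (rule F.generate_subgroup_incl[OF _ f.subgroup_kernel], intro Un_least subsetI)
    fix r assume "r \<in> {frag_of (x \<otimes>\<^bsub>M\<^esub> x', y) - frag_of (x, y) - frag_of (x', y) | x x' y.
             x \<in> carrier M \<and> x' \<in> carrier M \<and> y \<in> carrier N}"
    then obtain x x' y where r: "r = frag_of (x \<otimes>\<^bsub>M\<^esub> x', y) - frag_of (x, y) - frag_of (x', y)"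
      "x \<in> carrier M" "x' \<in> carrier M" "y \<in> carrier N" by blast
    show "r \<in> kernel F K f"
      unfolding r(1) by (rule ker) (use r(2-4) in \<open>simp_all add: f_of left\<close>)
  next
    fix r assume "r \<in> {frag_of (x, y \<otimes>\<^bsub>N\<^esub> y') - frag_of (x, y) - frag_of (x, y') | x y y'.
             x \<in> carrier M \<and> y \<in> carrier N \<and> y' \<in> carrier N}"
    then obtain x y y' where r: "r = frag_of (x, y \<otimes>\<^bsub>N\<^esub> y') - frag_of (x, y) - frag_of (x, y')"
      "x \<in> carrier M" "y \<in> carrier N" "y' \<in> carrier N" by blast
    show "r \<in> kernel F K f"
      unfolding r(1) by (rule ker) (use r(2-4) in \<open>simp_all add: f_of right\<close>)
  qed
  then obtain h where "h \<in> hom (F Mod tensor_relations M N) K"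
    and h: "\<And>z. z \<in> carrier F \<Longrightarrow> h (tensor_relations M N #>\<^bsub>F\<^esub> z) = f z"
    using f.FactGroup_universal_kernel[OF tensor_relations_normal] by blast
  moreover have "h (pure_tensor M N x y) = b x y" if "x \<in> carrier M" "y \<in> carrier N" for x y
    unfolding pure_tensor_def using h[of "frag_of (x, y)"] f_of[of "(x, y)"] that by simp
  ultimately show thesis using that unfolding tensor_product_def by blast
qed

lemma tensor_product_generated:
  assumes K: "subgroup K (tensor_product M N)"
    and pure: "\<And>x y. x \<in> carrier M \<Longrightarrow> y \<in> carrier N \<Longrightarrow> pure_tensor M N x y \<in> K"
  shows "carrier (tensor_product M N) \<subseteq> K"
proof
  interpret T: comm_group "tensor_product M N" by (rule comm_group_tensor_product)
  let ?q = "\<lambda>z. tensor_relations M N #>\<^bsub>F\<^esub> z"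
  have "?q \<in> hom F (tensor_product M N)"
    unfolding tensor_product_def by (rule normal.r_coset_hom_Mod[OF tensor_relations_normal])
  then interpret q: group_hom F "tensor_product M N" ?q
    using F.is_group T.is_group by (auto simp: group_hom_def group_hom_axioms_def)
  have q: "?q z \<in> K" if "Poly_Mapping.keys z \<subseteq> carrier M \<times> carrier N" for z
  proof (rule free_Abelian_group_induct[OF that])
    show "?q 0 \<in> K" using q.hom_one subgroup.one_closed[OF K] by simp
    show "?q (frag_of a) \<in> K" if "a \<in> carrier M \<times> carrier N" for a
      using that pure by (auto simp: pure_tensor_def)
    fix z w assume *: "Poly_Mapping.keys z \<subseteq> carrier M \<times> carrier N"
      "Poly_Mapping.keys w \<subseteq> carrier M \<times> carrier N" "?q z \<in> K" "?q w \<in> K"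
    have "?q (z \<otimes>\<^bsub>F\<^esub> inv\<^bsub>F\<^esub> w) = ?q z \<otimes>\<^bsub>tensor_product M N\<^esub> inv\<^bsub>tensor_product M N\<^esub> ?q w"
      using * by (metis F.inv_closed carrier_free_Abelian_group_iff q.hom_inv q.hom_mult)
    then show "?q (z - w) \<in> K"
      using * subgroup.m_closed[OF K] subgroup.m_inv_closed[OF K] by simp
  qed
  fix t assume "t \<in> carrier (tensor_product M N)"
  then obtain z where "z \<in> carrier F" "t = ?q z"
    by (auto simp: tensor_product_def FactGroup_def RCOSETS_def)
  then show "t \<in> K" using q by simp
qed

end

definition function_frag :: "'g set \<Rightarrow> ('g \<Rightarrow> int) \<Rightarrow> 'g \<Rightarrow>\<^sub>0 int" where
  "function_frag S v = (\<Sum>g\<in>S. frag_cmul (v g) (frag_of g))"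

lemma lookup_function_frag:
  "finite S \<Longrightarrow> poly_mapping.lookup (function_frag S v) g = (if g \<in> S then v g else 0)"
  by (simp add: function_frag_def lookup_sum if_distrib[of "times _"] cong: if_cong)

lemma keys_function_frag: "Poly_Mapping.keys (function_frag S v) \<subseteq> S"
  unfolding function_frag_def using keys_sum[of "\<lambda>g. frag_cmul (v g) (frag_of g)" S]
  by (auto dest!: subsetD[OF keys_cmul])

lemma function_frag_add: "function_frag S (v + w) = function_frag S v + function_frag S w"
  by (simp add: function_frag_def frag_cmul_distrib sum.distrib)

lemma function_frag_zero: "function_frag S 0 = 0"
  by (simp add: function_frag_def)

lemma function_frag_lookup:
  assumes "finite S" "Poly_Mapping.keys p \<subseteq> S" shows "function_frag S (poly_mapping.lookup p) = p"
  using assms by (intro poly_mapping_eqI) (auto simp: lookup_function_frag in_keys_iff)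

text \<open>This matches the elements \<open>p (e - k)\<close> in the definition of \<open>\<A>\<close> and \<open>\<B>\<close> with the
  coboundaries \<open>v - k \<cdot> v\<close> of a graph with one vertex.\<close>

lemma group_ring_mult_difference:
  assumes "comm_group G" "finite (carrier G)" "k \<in> carrier G"
  shows "group_ring_mult G (function_frag (carrier G) v) (frag_of \<one>\<^bsub>G\<^esub> - frag_of k) =
    function_frag (carrier G) (v - translate G k v)"
proof -
  interpret G: comm_group G by fact
  have "group_ring_mult G (function_frag (carrier G) v) (frag_of \<one>\<^bsub>G\<^esub> - frag_of k) =
    (\<Sum>g\<in>carrier G. frag_cmul (v g) (frag_of (g \<otimes>\<^bsub>G\<^esub> \<one>\<^bsub>G\<^esub>) - frag_of (g \<otimes>\<^bsub>G\<^esub> k)))"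
    unfolding group_ring_mult_def function_frag_def
    by (subst frag_extend_sum) (simp_all add: assms(2) comp_def frag_extend_cmul frag_extend_diff)
  also have "\<dots> = (\<Sum>g\<in>carrier G. frag_cmul (v g) (frag_of g)) -
      (\<Sum>g\<in>carrier G. frag_cmul (v g) (frag_of (g \<otimes>\<^bsub>G\<^esub> k)))"
    unfolding sum_subtractf[symmetric]
    by (intro sum.cong refl poly_mapping_eqI) (simp add: lookup_minus algebra_simps)
  also have "(\<Sum>g\<in>carrier G. frag_cmul (v g) (frag_of (g \<otimes>\<^bsub>G\<^esub> k))) =
      (\<Sum>g\<in>carrier G. frag_cmul (translate G k v g) (frag_of g))"
    by (rule sum.reindex_bij_witness[where i = "\<lambda>g. inv\<^bsub>G\<^esub> k \<otimes>\<^bsub>G\<^esub> g" and j = "\<lambda>g. g \<otimes>\<^bsub>G\<^esub> k"])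
      (use assms(3) in \<open>simp_all add: translate_def G.m_assoc G.m_comm[of _ k] G.m_assoc[symmetric]\<close>)
  finally show ?thesis
    by (simp add: function_frag_def sum_subtractf[symmetric] frag_cmul_diff_distrib)
qed

lemma locally_constant_discrete_iff:
  "f \<in> locally_constant (discrete_topology S) V \<longleftrightarrow> (\<forall>x\<in>S. f x \<in> V) \<and> (\<forall>x. x \<notin> S \<longrightarrow> f x = 0)"
  by (simp add: locally_constant_def)

lemma hom_finprod:
  assumes "comm_group H" "comm_group K" "h \<in> hom H K" "f \<in> S \<rightarrow> carrier H"
  shows "h (finprod H f S) = finprod K (\<lambda>x. h (f x)) S"
proof -
  interpret H: comm_group H by fact
  interpret K: comm_group K by fact
  interpret group_hom H K h
    using assms(3) H.is_group K.is_group by (auto simp: group_hom_def group_hom_axioms_def)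
  show ?thesis
    using assms(4)
  proof (induction S rule: infinite_finite_induct)
    case (insert x S)
    then have "f \<in> S \<rightarrow> carrier H" "f x \<in> carrier H" "(\<lambda>x. h (f x)) \<in> S \<rightarrow> carrier K" "h (f x) \<in> carrier K"
      by (auto simp: Pi_iff)
    with insert show ?case by simp
  qed simp_all
qed

lemma free_Abelian_group_generated:
  assumes "subgroup K (free_Abelian_group S)" "\<And>a. a \<in> S \<Longrightarrow> frag_of a \<in> K" "Poly_Mapping.keys x \<subseteq> S"
  shows "x \<in> K"
proof (rule free_Abelian_group_induct[OF assms(3)])
  show "0 \<in> K" using subgroup.one_closed[OF assms(1)] by simp
  fix z w assume *: "Poly_Mapping.keys z \<subseteq> S" "Poly_Mapping.keys w \<subseteq> S" "z \<in> K" "w \<in> K"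
  have "z \<otimes>\<^bsub>free_Abelian_group S\<^esub> inv\<^bsub>free_Abelian_group S\<^esub> w \<in> K"
    by (intro subgroup.m_closed[OF assms(1)] subgroup.m_inv_closed[OF assms(1)] *)
  then show "z - w \<in> K" using * by simp
qed (fact assms(2))

context tensor_of_groups
begin

lemma pure_tensor_hom_left:
  assumes "y \<in> carrier N"
  shows "group_hom M (tensor_product M N) (\<lambda>x. pure_tensor M N x y)"
  using assms comm_group.axioms(2)[OF comm_group_tensor_product] M.is_group
  by (auto simp: group_hom_def group_hom_axioms_def hom_def pure_tensor_closed pure_tensor_add_left)

lemma pure_tensor_hom_right:
  assumes "x \<in> carrier M"
  shows "group_hom N (tensor_product M N) (\<lambda>y. pure_tensor M N x y)"
  using assms comm_group.axioms(2)[OF comm_group_tensor_product] N.is_group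
  by (auto simp: group_hom_def group_hom_axioms_def hom_def pure_tensor_closed pure_tensor_add_right)

end

locale group_ring_tensor = comm_group G for G :: "('g, 'm) monoid_scheme" (structure) +
  fixes A B :: "'i set"
  assumes finite_G: "finite (carrier G)" and finite_A: "finite A" and finite_B: "finite B"
begin

abbreviation "R \<equiv> free_Abelian_group (carrier G)"
abbreviation "RA \<equiv> tensor_product R (free_Abelian_group A)"

sublocale R: comm_group R by (rule abelian_free_Abelian_group)

sublocale T1: tensor_of_groups R "free_Abelian_group A"
  by (intro tensor_of_groups.intro abelian_free_Abelian_group)

sublocale T2: tensor_of_groups RA "free_Abelian_group B"
  by (intro tensor_of_groups.intro abelian_free_Abelian_group T1.comm_group_tensor_product)

sublocale M: comm_group "M_group G A B"
  unfolding M_group_def by (rule T2.comm_group_tensor_product)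

lemma M_tensor_closed:
  assumes "p \<in> carrier R" "a \<in> A" "b \<in> B"
  shows "M_tensor G A B p a b \<in> carrier (M_group G A B)"
  unfolding M_tensor_def M_group_def
  by (intro T2.pure_tensor_closed T1.pure_tensor_closed) (use assms in auto)

lemma M_tensor_hom:
  assumes "a \<in> A" "b \<in> B"
  shows "group_hom R (M_group G A B) (\<lambda>p. M_tensor G A B p a b)"
proof -
  interpret f: group_hom R RA "\<lambda>p. pure_tensor R (free_Abelian_group A) p (frag_of a)"
    using assms by (intro T1.pure_tensor_hom_left) simp
  interpret g: group_hom RA "M_group G A B" "\<lambda>t. pure_tensor RA (free_Abelian_group B) t (frag_of b)"
    unfolding M_group_def using assms by (intro T2.pure_tensor_hom_left) simp
  show ?thesis
    using Group.hom_compose[OF f.homh g.homh] R.is_group M.is_group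
    by (simp add: group_hom_def group_hom_axioms_def M_tensor_def comp_def)
qed

text \<open>The general element of \<open>\<int>[G] \<otimes> \<int>\<^sup>A \<otimes> \<int>\<^sup>B\<close> with prescribed coefficients in \<open>\<int>[G]\<close>.\<close>

definition tensor_sum :: "('i \<Rightarrow> 'i \<Rightarrow> 'g \<Rightarrow> int) \<Rightarrow> ('g, 'i) triple_tensor" where
  "tensor_sum w = (\<Otimes>\<^bsub>M_group G A B\<^esub>a\<in>A. \<Otimes>\<^bsub>M_group G A B\<^esub>b\<in>B.
     M_tensor G A B (function_frag (carrier G) (w a b)) a b)"

abbreviation "W \<equiv> locally_constant (discrete_topology A) (locally_constant (discrete_topology B) (group_functions G))"

lemma W_iff: "w \<in> W \<longleftrightarrow> (\<forall>a b g. \<not> (a \<in> A \<and> b \<in> B \<and> g \<in> carrier G) \<longrightarrow> w a b g = 0)"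
proof -
  have "w \<in> W \<longleftrightarrow> (\<forall>a\<in>A. (\<forall>b\<in>B. \<forall>g. g \<notin> carrier G \<longrightarrow> w a b g = 0) \<and> (\<forall>b. b \<notin> B \<longrightarrow> w a b = 0))
      \<and> (\<forall>a. a \<notin> A \<longrightarrow> w a = 0)"
    by (simp add: locally_constant_discrete_iff group_functions_iff)
  then show ?thesis unfolding fun_eq_iff zero_fun_apply by blast
qed

lemma function_frag_closed: "function_frag (carrier G) v \<in> carrier R"
  by (simp add: keys_function_frag)

lemma M_tensor_function_closed:
  "a \<in> A \<Longrightarrow> b \<in> B \<Longrightarrow> M_tensor G A B (function_frag (carrier G) v) a b \<in> carrier (M_group G A B)"
  by (rule M_tensor_closed[OF function_frag_closed])

lemma inner_closed:
  "a \<in> A \<Longrightarrow> (\<Otimes>\<^bsub>M_group G A B\<^esub>b\<in>B. M_tensor G A B (function_frag (carrier G) (w a b)) a b) \<in> carrier (M_group G A B)"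
  by (intro M.finprod_closed) (auto intro: M_tensor_function_closed)

lemma tensor_sum_closed: "tensor_sum w \<in> carrier (M_group G A B)"
  unfolding tensor_sum_def by (intro M.finprod_closed) (auto intro: inner_closed)

lemma tensor_sum_add: "tensor_sum (w + w') = tensor_sum w \<otimes>\<^bsub>M_group G A B\<^esub> tensor_sum w'"
proof -
  have add: "M_tensor G A B (function_frag (carrier G) ((w + w') a b)) a b =
      M_tensor G A B (function_frag (carrier G) (w a b)) a b \<otimes>\<^bsub>M_group G A B\<^esub>
      M_tensor G A B (function_frag (carrier G) (w' a b)) a b" if "a \<in> A" "b \<in> B" for a b
    using group_hom.hom_mult[OF M_tensor_hom[OF that] function_frag_closed function_frag_closed]
    by (simp add: function_frag_add)
  have "tensor_sum (w + w') = (\<Otimes>\<^bsub>M_group G A B\<^esub>a\<in>A.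
      (\<Otimes>\<^bsub>M_group G A B\<^esub>b\<in>B. M_tensor G A B (function_frag (carrier G) (w a b)) a b) \<otimes>\<^bsub>M_group G A B\<^esub>
      (\<Otimes>\<^bsub>M_group G A B\<^esub>b\<in>B. M_tensor G A B (function_frag (carrier G) (w' a b)) a b))"
    unfolding tensor_sum_def
  proof (rule M.finprod_cong'[OF refl])
    fix a assume a: "a \<in> A"
    show "(\<Otimes>\<^bsub>M_group G A B\<^esub>b\<in>B. M_tensor G A B (function_frag (carrier G) ((w + w') a b)) a b) =
      (\<Otimes>\<^bsub>M_group G A B\<^esub>b\<in>B. M_tensor G A B (function_frag (carrier G) (w a b)) a b) \<otimes>\<^bsub>M_group G A B\<^esub>
      (\<Otimes>\<^bsub>M_group G A B\<^esub>b\<in>B. M_tensor G A B (function_frag (carrier G) (w' a b)) a b)"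
    proof (subst M.finprod_multf[symmetric])
      show "(\<Otimes>\<^bsub>M_group G A B\<^esub>b\<in>B. M_tensor G A B (function_frag (carrier G) ((w + w') a b)) a b) =
        (\<Otimes>\<^bsub>M_group G A B\<^esub>b\<in>B. M_tensor G A B (function_frag (carrier G) (w a b)) a b \<otimes>\<^bsub>M_group G A B\<^esub>
          M_tensor G A B (function_frag (carrier G) (w' a b)) a b)"
        by (rule M.finprod_cong'[OF refl _ add[OF a]]) (auto intro: M_tensor_function_closed[OF a])
    qed (auto intro: M_tensor_function_closed[OF a])
  qed (auto intro: inner_closed)
  also have "\<dots> = tensor_sum w \<otimes>\<^bsub>M_group G A B\<^esub> tensor_sum w'"
    unfolding tensor_sum_def by (rule M.finprod_multf) (auto intro: inner_closed)
  finally show ?thesis .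
qed

lemma subgroup_W: "subgroup_add W"
  by (auto simp: subgroup_add_def W_iff)

lemma tensor_sum_hom: "group_hom (additive_group W) (M_group G A B) tensor_sum"
  using comm_group.axioms(2)[OF comm_group_additive_group[OF subgroup_W]] M.is_group
  by (auto simp: group_hom_def group_hom_axioms_def hom_def tensor_sum_closed tensor_sum_add)

text \<open>The coefficient of \<open>a\<^sub>0 \<otimes> b\<^sub>0\<close> is a well-defined homomorphism by two applications of the universal
  property; it is what makes \<open>tensor_sum\<close> injective.\<close>

lemma coordinate_hom:
  assumes "a\<^sub>0 \<in> A" "b\<^sub>0 \<in> B"
  obtains c where "c \<in> hom (M_group G A B) R"
    "\<And>p a b. p \<in> carrier R \<Longrightarrow> a \<in> A \<Longrightarrow> b \<in> B \<Longrightarrow>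
      c (M_tensor G A B p a b) = (if a = a\<^sub>0 \<and> b = b\<^sub>0 then p else 0)"
proof -
  have cmul: "frag_cmul n p \<in> carrier R" if "p \<in> carrier R" for n p
    using that keys_cmul[of n p] by auto
  obtain d where d: "d \<in> hom RA R" "\<And>p x. p \<in> carrier R \<Longrightarrow> x \<in> carrier (free_Abelian_group A) \<Longrightarrow>
      d (pure_tensor R (free_Abelian_group A) p x) = frag_cmul (poly_mapping.lookup x a\<^sub>0) p"
    using T1.tensor_product_universal[of R "\<lambda>p x. frag_cmul (poly_mapping.lookup x a\<^sub>0) p"]
      R.comm_group_axioms cmul
    by (auto simp: frag_cmul_distrib frag_cmul_distrib2 lookup_add)
  have dR: "d t \<in> carrier R" if "t \<in> carrier RA" for t
    by (rule hom_in_carrier[OF d(1) that])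
  have d_mult: "d (t \<otimes>\<^bsub>RA\<^esub> t') = d t + d t'" if "t \<in> carrier RA" "t' \<in> carrier RA" for t t'
    using hom_mult[OF d(1) that] by simp
  obtain c where c: "c \<in> hom (M_group G A B) R" "\<And>t y. t \<in> carrier RA \<Longrightarrow> y \<in> carrier (free_Abelian_group B) \<Longrightarrow>
      c (pure_tensor RA (free_Abelian_group B) t y) = frag_cmul (poly_mapping.lookup y b\<^sub>0) (d t)"
    unfolding M_group_def
    using T2.tensor_product_universal[of R "\<lambda>t y. frag_cmul (poly_mapping.lookup y b\<^sub>0) (d t)"]
      R.comm_group_axioms cmul dR d_mult
    by (auto simp: frag_cmul_distrib frag_cmul_distrib2 lookup_add)
  show thesis
  proof (rule that[OF c(1)])
    fix p a b assume *: "p \<in> carrier R" "a \<in> A" "b \<in> B"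
    have "pure_tensor R (free_Abelian_group A) p (frag_of a) \<in> carrier RA"
      using * by (intro T1.pure_tensor_closed) auto
    then show "c (M_tensor G A B p a b) = (if a = a\<^sub>0 \<and> b = b\<^sub>0 then p else 0)"
      using * by (auto simp: M_tensor_def c(2) d(2))
  qed
qed

lemma inj_tensor_sum: "inj_on tensor_sum W"
proof (rule inj_onI)
  fix w w' assume w: "w \<in> W" "w' \<in> W" and eq: "tensor_sum w = tensor_sum w'"
  have "w a\<^sub>0 b\<^sub>0 g = w' a\<^sub>0 b\<^sub>0 g" if ab: "a\<^sub>0 \<in> A" "b\<^sub>0 \<in> B" and g: "g \<in> carrier G" for a\<^sub>0 b\<^sub>0 g
  proof -
    obtain c where c: "c \<in> hom (M_group G A B) R"
      "\<And>p a b. p \<in> carrier R \<Longrightarrow> a \<in> A \<Longrightarrow> b \<in> B \<Longrightarrow>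
        c (M_tensor G A B p a b) = (if a = a\<^sub>0 \<and> b = b\<^sub>0 then p else 0)"
      using coordinate_hom[OF ab] by blast
    note hom_prod = hom_finprod[OF M.comm_group_axioms R.comm_group_axioms c(1)]
    have "c (tensor_sum u) = function_frag (carrier G) (u a\<^sub>0 b\<^sub>0)" for u
    proof -
      let ?f = "\<lambda>a b. function_frag (carrier G) (u a b)"
      have inner: "c (\<Otimes>\<^bsub>M_group G A B\<^esub>b\<in>B. M_tensor G A B (?f a b) a b) = (if a = a\<^sub>0 then ?f a b\<^sub>0 else \<one>\<^bsub>R\<^esub>)"
        if a: "a \<in> A" for a
      proof -
        have "c (\<Otimes>\<^bsub>M_group G A B\<^esub>b\<in>B. M_tensor G A B (?f a b) a b) = (\<Otimes>\<^bsub>R\<^esub>b\<in>B. c (M_tensor G A B (?f a b) a b))"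
          using a by (intro hom_prod) (auto intro: M_tensor_function_closed)
        also have "\<dots> = (\<Otimes>\<^bsub>R\<^esub>b\<in>B. if b = b\<^sub>0 then (if a = a\<^sub>0 then ?f a b else \<one>\<^bsub>R\<^esub>) else \<one>\<^bsub>R\<^esub>)"
          using a by (intro R.finprod_cong') (auto simp: c(2) keys_function_frag)
        also have "\<dots> = (if a = a\<^sub>0 then ?f a b\<^sub>0 else \<one>\<^bsub>R\<^esub>)"
          by (rule R.finprod_singleton_swap[OF ab(2) finite_B]) (auto simp: keys_function_frag)
        finally show ?thesis .
      qed
      have "c (tensor_sum u) = (\<Otimes>\<^bsub>R\<^esub>a\<in>A. c (\<Otimes>\<^bsub>M_group G A B\<^esub>b\<in>B. M_tensor G A B (?f a b) a b))"
        unfolding tensor_sum_def by (intro hom_prod) (auto intro: inner_closed)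
      also have "\<dots> = (\<Otimes>\<^bsub>R\<^esub>a\<in>A. if a = a\<^sub>0 then ?f a b\<^sub>0 else \<one>\<^bsub>R\<^esub>)"
        by (intro R.finprod_cong') (auto simp: inner keys_function_frag)
      also have "\<dots> = ?f a\<^sub>0 b\<^sub>0"
        by (rule R.finprod_singleton_swap[OF ab(1) finite_A]) (auto simp: keys_function_frag)
      finally show ?thesis .
    qed
    then have "function_frag (carrier G) (w a\<^sub>0 b\<^sub>0) = function_frag (carrier G) (w' a\<^sub>0 b\<^sub>0)"
      using eq by metis
    then show ?thesis using lookup_function_frag[OF finite_G] g by metis
  qed
  then show "w = w'" using w unfolding W_iff by (intro ext) metis
qed

lemma M_tensor_in_image:
  assumes p: "p \<in> carrier R" and ab: "a\<^sub>0 \<in> A" "b\<^sub>0 \<in> B"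
  shows "M_tensor G A B p a\<^sub>0 b\<^sub>0 \<in> tensor_sum ` W"
proof -
  define w where "w a b = (if a = a\<^sub>0 \<and> b = b\<^sub>0 then poly_mapping.lookup p else 0)" for a b
  have pk: "function_frag (carrier G) (poly_mapping.lookup p) = p"
    using p by (intro function_frag_lookup finite_G) simp
  have wW: "w \<in> W" using p ab by (auto simp: W_iff w_def in_keys_iff subset_iff)
  have zero: "M_tensor G A B 0 a b = \<one>\<^bsub>M_group G A B\<^esub>" if "a \<in> A" "b \<in> B" for a b
    using group_hom.hom_one[OF M_tensor_hom[OF that]] by simp
  let ?f = "\<lambda>a b. M_tensor G A B (function_frag (carrier G) (w a b)) a b"
  have inner: "(\<Otimes>\<^bsub>M_group G A B\<^esub>b\<in>B. ?f a b) = (if a = a\<^sub>0 then M_tensor G A B p a b\<^sub>0 else \<one>\<^bsub>M_group G A B\<^esub>)"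
    if a: "a \<in> A" for a
  proof -
    have "(\<Otimes>\<^bsub>M_group G A B\<^esub>b\<in>B. ?f a b) = (\<Otimes>\<^bsub>M_group G A B\<^esub>b\<in>B.
        if b = b\<^sub>0 then (if a = a\<^sub>0 then M_tensor G A B p a b else \<one>\<^bsub>M_group G A B\<^esub>) else \<one>\<^bsub>M_group G A B\<^esub>)"
      using a by (intro M.finprod_cong') (auto simp: w_def pk function_frag_zero zero intro: M_tensor_closed[OF p])
    also have "\<dots> = (if a = a\<^sub>0 then M_tensor G A B p a b\<^sub>0 else \<one>\<^bsub>M_group G A B\<^esub>)"
      using a by (intro M.finprod_singleton_swap[OF ab(2) finite_B]) (auto intro: M_tensor_closed[OF p])
    finally show ?thesis .
  qed
  have "tensor_sum w = (\<Otimes>\<^bsub>M_group G A B\<^esub>a\<in>A. if a = a\<^sub>0 then M_tensor G A B p a b\<^sub>0 else \<one>\<^bsub>M_group G A B\<^esub>)"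
    unfolding tensor_sum_def using ab by (intro M.finprod_cong') (auto simp: inner intro: M_tensor_closed[OF p])
  also have "\<dots> = M_tensor G A B p a\<^sub>0 b\<^sub>0"
    using ab by (intro M.finprod_singleton_swap[OF ab(1) finite_A]) (auto intro: M_tensor_closed[OF p])
  finally show ?thesis using wW by blast
qed

text \<open>The image is a subgroup that contains \<open>p \<otimes> a \<otimes> b\<close> for basis elements \<open>a\<close> and \<open>b\<close>.  By linearity in
  one factor at a time it contains all pure tensors.\<close>

lemma surj_tensor_sum: "tensor_sum ` W = carrier (M_group G A B)"
proof
  show "tensor_sum ` W \<subseteq> carrier (M_group G A B)" using tensor_sum_closed by blast
  interpret s: group_hom "additive_group W" "M_group G A B" tensor_sum by (rule tensor_sum_hom)
  have sub: "subgroup (tensor_sum ` W) (M_group G A B)" using s.img_is_subgroup by simp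
  let ?FA = "free_Abelian_group A" and ?FB = "free_Abelian_group B"
  have 1: "pure_tensor RA ?FB (pure_tensor R ?FA p x) (frag_of b) \<in> tensor_sum ` W"
    if p: "p \<in> carrier R" and x: "x \<in> carrier ?FA" and b: "b \<in> B" for p x b
  proof -
    interpret f: group_hom ?FA RA "\<lambda>x. pure_tensor R ?FA p x" by (rule T1.pure_tensor_hom_right[OF p])
    interpret g: group_hom RA "M_group G A B" "\<lambda>t. pure_tensor RA ?FB t (frag_of b)"
      unfolding M_group_def using b by (intro T2.pure_tensor_hom_left) simp
    have "x \<in> {x \<in> carrier ?FA. pure_tensor R ?FA p x \<in> {t \<in> carrier RA. pure_tensor RA ?FB t (frag_of b) \<in> tensor_sum ` W}}"
    proof (rule free_Abelian_group_generated[OF f.subgroup_preimage[OF g.subgroup_preimage[OF sub]]])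
      fix a assume a: "a \<in> A"
      then show "frag_of a \<in> {x \<in> carrier ?FA. pure_tensor R ?FA p x \<in> {t \<in> carrier RA. pure_tensor RA ?FB t (frag_of b) \<in> tensor_sum ` W}}"
        using M_tensor_in_image[OF p a b] f.hom_closed[of "frag_of a"] by (simp add: M_tensor_def)
    qed (use x in simp)
    then show ?thesis by simp
  qed
  have 2: "pure_tensor RA ?FB t (frag_of b) \<in> tensor_sum ` W" if t: "t \<in> carrier RA" and b: "b \<in> B" for t b
  proof -
    interpret g: group_hom RA "M_group G A B" "\<lambda>t. pure_tensor RA ?FB t (frag_of b)"
      unfolding M_group_def using b by (intro T2.pure_tensor_hom_left) simp
    have "carrier RA \<subseteq> {t \<in> carrier RA. pure_tensor RA ?FB t (frag_of b) \<in> tensor_sum ` W}"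
      by (rule T1.tensor_product_generated[OF g.subgroup_preimage[OF sub]])
        (use 1 b T1.pure_tensor_closed in auto)
    then show ?thesis using t by blast
  qed
  have 3: "pure_tensor RA ?FB t y \<in> tensor_sum ` W" if t: "t \<in> carrier RA" and y: "y \<in> carrier ?FB" for t y
  proof -
    interpret g: group_hom ?FB "M_group G A B" "\<lambda>y. pure_tensor RA ?FB t y"
      unfolding M_group_def using t by (intro T2.pure_tensor_hom_right)
    have "y \<in> {y \<in> carrier ?FB. pure_tensor RA ?FB t y \<in> tensor_sum ` W}"
      by (rule free_Abelian_group_generated[OF g.subgroup_preimage[OF sub]]) (use 2 t y in auto)
    then show ?thesis by simp
  qed
  show "carrier (M_group G A B) \<subseteq> tensor_sum ` W"
    using T2.tensor_product_generated[of "tensor_sum ` W"] sub 3 unfolding M_group_def by blast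
qed

lemma tensor_sum_iso: "tensor_sum \<in> iso (additive_group W) (M_group G A B)"
  using group_hom.homh[OF tensor_sum_hom] inj_tensor_sum surj_tensor_sum
  by (simp add: iso_def bij_betw_def)

end

lemma (in group_ring_tensor) tensor_sum_eq:
  assumes "\<And>a b. a \<in> A \<Longrightarrow> b \<in> B \<Longrightarrow> P a b = function_frag (carrier G) (w a b)"
  shows "(\<Otimes>\<^bsub>M_group G A B\<^esub>a\<in>A. \<Otimes>\<^bsub>M_group G A B\<^esub>b\<in>B. M_tensor G A B (P a b) a b) = tensor_sum w"
  unfolding tensor_sum_def
proof (rule M.finprod_cong'[OF refl])
  fix a assume a: "a \<in> A"
  show "(\<Otimes>\<^bsub>M_group G A B\<^esub>b\<in>B. M_tensor G A B (P a b) a b) =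
      (\<Otimes>\<^bsub>M_group G A B\<^esub>b\<in>B. M_tensor G A B (function_frag (carrier G) (w a b)) a b)"
  proof (rule M.finprod_cong'[OF refl])
    show "M_tensor G A B (P a b) a b = M_tensor G A B (function_frag (carrier G) (w a b)) a b" if "b \<in> B" for b
      by (simp only: assms[OF a that])
  qed (auto intro: M_tensor_function_closed[OF a])
qed (auto intro: inner_closed)

text \<open>The graphs are the bouquets with one vertex and loops labelled by \<open>\<mu>\<close> on \<open>A\<close> and on \<open>B\<close>.\<close>

theorem N_group_iso_double_quotient:
  fixes G :: "('g, 'm) monoid_scheme" and A B :: "'i set"
  assumes "comm_group G" "finite (carrier G)" "generating_data G A B \<mu>"
  shows "double_quotient (discrete_topology {()}) (discrete_topology A) (\<lambda>_. ()) (\<lambda>_. ()) \<mu>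
      (discrete_topology {()}) (discrete_topology B) (\<lambda>_. ()) (\<lambda>_. ()) \<mu> (translate G) (group_functions G)
    \<cong> N_group G A B \<mu>" (is ?iso)
    and "group (N_group G A B \<mu>)" (is ?group)
proof -
  have fin: "finite A" "finite B" and \<mu>: "\<mu> \<in> A \<rightarrow> carrier G" "\<mu> \<in> B \<rightarrow> carrier G"
    and gen: "generate G (\<mu> ` A) = carrier G" "generate G (\<mu> ` B) = carrier G"
    using assms(3) by (auto simp: generating_data_def)
  interpret G: comm_group G by fact
  interpret T: group_ring_tensor G A B by unfold_locales (fact assms(2) fin)+
  interpret acyclic_module G "group_functions G" "translate G"
    by (rule acyclic_module_group_functions) fact+
  interpret GA: labelled_graph G "discrete_topology {()}" "discrete_topology A" "\<lambda>_. ()" "\<lambda>_. ()" \<mu>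
    by (rule labelled_graph_bouquet) fact+
  interpret GB: labelled_graph G "discrete_topology {()}" "discrete_topology B" "\<lambda>_. ()" "\<lambda>_. ()" \<mu>
    by (rule labelled_graph_bouquet) fact+
  interpret D: two_graphs G "group_functions G" "translate G"
    "discrete_topology {()}" "discrete_topology A" "\<lambda>_. ()" "\<lambda>_. ()" \<mu>
    "discrete_topology {()}" "discrete_topology B" "\<lambda>_. ()" "\<lambda>_. ()" \<mu>
    by unfold_locales
  let ?M = "M_group G A B" and ?F = "function_frag (carrier G)"
  let ?LK = "locally_constant (discrete_topology A) (locally_constant (discrete_topology {()}) (group_functions G))"
  let ?LH = "locally_constant (discrete_topology {()}) D.M2.cochains"
  have lookup: "poly_mapping.lookup p \<in> group_functions G" "?F (poly_mapping.lookup p) = p"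
    if "p \<in> carrier (free_Abelian_group (carrier G))" for p
    using that function_frag_lookup[OF assms(2), of p]
    by (auto simp: group_functions_iff in_keys_iff subset_iff)
  have F_closed: "?F v \<in> carrier (free_Abelian_group (carrier G))" for v
    by (rule T.function_frag_closed)
  have multA: "group_ring_mult G (?F v) (frag_of \<one>\<^bsub>G\<^esub> - frag_of (\<mu> a)) = ?F (v - translate G (\<mu> a) v)"
    if "a \<in> A" for a v
    using \<mu>(1) that by (intro group_ring_mult_difference assms) blast
  have multB: "group_ring_mult G (?F v) (frag_of \<one>\<^bsub>G\<^esub> - frag_of (\<mu> b)) = ?F (v - translate G (\<mu> b) v)"
    if "b \<in> B" for b v
    using \<mu>(2) that by (intro group_ring_mult_difference assms) blast
  \<comment> \<open>The relations \<open>\<A>\<close> and \<open>\<B>\<close> are the coboundaries in the second and in the first direction.\<close>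
  have sumA: "(\<Otimes>\<^bsub>?M\<^esub>a\<in>A. \<Otimes>\<^bsub>?M\<^esub>b\<in>B. M_tensor G A B
      (group_ring_mult G (?F (k a ())) (frag_of \<one>\<^bsub>G\<^esub> - frag_of (\<mu> b))) a b) = T.tensor_sum (\<lambda>a. D.M2.cob (k a))"
    for k by (rule T.tensor_sum_eq) (simp add: multB graph_coboundary_def)
  have sumB: "(\<Otimes>\<^bsub>?M\<^esub>a\<in>A. \<Otimes>\<^bsub>?M\<^esub>b\<in>B. M_tensor G A B
      (group_ring_mult G (?F (H () b)) (frag_of \<one>\<^bsub>G\<^esub> - frag_of (\<mu> a))) a b) = T.tensor_sum (D.M1.cob H)"
    for H by (rule T.tensor_sum_eq) (simp add: multA graph_coboundary_def fun_diff_def)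
  have A_eq: "A_subgroup G A B \<mu> = {T.tensor_sum (\<lambda>a. D.M2.cob (k a)) | k. k \<in> ?LK}"
  proof (intro equalityI subsetI)
    fix x assume "x \<in> A_subgroup G A B \<mu>"
    then obtain \<alpha> where \<alpha>: "\<alpha> \<in> A \<rightarrow> carrier (free_Abelian_group (carrier G))"
      and x: "x = (\<Otimes>\<^bsub>?M\<^esub>a\<in>A. \<Otimes>\<^bsub>?M\<^esub>b\<in>B. M_tensor G A B
        (group_ring_mult G (\<alpha> a) (frag_of \<one>\<^bsub>G\<^esub> - frag_of (\<mu> b))) a b)"
      unfolding A_subgroup_def by blast
    define k where "k a = (if a \<in> A then \<lambda>_::unit. poly_mapping.lookup (\<alpha> a) else 0)" for a
    have \<alpha>k: "\<alpha> a = ?F (k a ())" if "a \<in> A" for a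
      using lookup(2)[of "\<alpha> a"] funcset_mem[OF \<alpha> that] that by (simp add: k_def)
    have "x = T.tensor_sum (\<lambda>a. D.M2.cob (k a))"
      unfolding x by (rule T.tensor_sum_eq) (simp add: \<alpha>k multB graph_coboundary_def)
    moreover have "k \<in> ?LK"
      using lookup(1) funcset_mem[OF \<alpha>] by (simp add: locally_constant_discrete_iff k_def)
    ultimately show "x \<in> {T.tensor_sum (\<lambda>a. D.M2.cob (k a)) | k. k \<in> ?LK}" by blast
  next
    fix x assume "x \<in> {T.tensor_sum (\<lambda>a. D.M2.cob (k a)) | k. k \<in> ?LK}"
    then obtain k where "x = T.tensor_sum (\<lambda>a. D.M2.cob (k a))" by blast
    then show "x \<in> A_subgroup G A B \<mu>"
      unfolding A_subgroup_def sumA[symmetric] using F_closed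
      by (intro CollectI exI[of _ "\<lambda>a. ?F (k a ())"]) simp
  qed
  have B_eq: "B_subgroup G A B \<mu> = {T.tensor_sum (D.M1.cob H) | H. H \<in> ?LH}"
  proof (intro equalityI subsetI)
    fix x assume "x \<in> B_subgroup G A B \<mu>"
    then obtain \<beta> where \<beta>: "\<beta> \<in> B \<rightarrow> carrier (free_Abelian_group (carrier G))"
      and x: "x = (\<Otimes>\<^bsub>?M\<^esub>a\<in>A. \<Otimes>\<^bsub>?M\<^esub>b\<in>B. M_tensor G A B
        (group_ring_mult G (\<beta> b) (frag_of \<one>\<^bsub>G\<^esub> - frag_of (\<mu> a))) a b)"
      unfolding B_subgroup_def by blast
    define H where "H u b = (if b \<in> B then poly_mapping.lookup (\<beta> b) else 0)" for u :: unit and b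
    have \<beta>H: "\<beta> b = ?F (H () b)" if "b \<in> B" for b
      using lookup(2)[of "\<beta> b"] funcset_mem[OF \<beta> that] that by (simp add: H_def)
    have "x = T.tensor_sum (D.M1.cob H)"
      unfolding x by (rule T.tensor_sum_eq) (simp add: \<beta>H multA graph_coboundary_def fun_diff_def)
    moreover have "H \<in> ?LH"
      using lookup(1) funcset_mem[OF \<beta>] by (simp add: locally_constant_discrete_iff H_def)
    ultimately show "x \<in> {T.tensor_sum (D.M1.cob H) | H. H \<in> ?LH}" by blast
  next
    fix x assume "x \<in> {T.tensor_sum (D.M1.cob H) | H. H \<in> ?LH}"
    then obtain H where "x = T.tensor_sum (D.M1.cob H)" by blast
    then show "x \<in> B_subgroup G A B \<mu>"
      unfolding B_subgroup_def sumB[symmetric] using F_closed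
      by (intro CollectI exI[of _ "\<lambda>b. ?F (H () b)"]) simp
  qed
  have img: "T.tensor_sum ` D.relations\<^sub>1\<^sub>2 = A_subgroup G A B \<mu> <#>\<^bsub>?M\<^esub> B_subgroup G A B \<mu>"
  proof -
    have "T.tensor_sum (D.M1.cob H + (\<lambda>a. D.M2.cob (k a))) =
        T.tensor_sum (\<lambda>a. D.M2.cob (k a)) \<otimes>\<^bsub>?M\<^esub> T.tensor_sum (D.M1.cob H)" for H k
      by (simp add: T.tensor_sum_add T.M.m_comm T.tensor_sum_closed)
    then show ?thesis
      unfolding D.double_relations_eq A_eq B_eq set_mult_def by (auto simp: image_iff; metis)
  qed
  interpret s: group_hom "additive_group T.W" ?M T.tensor_sum by (rule T.tensor_sum_hom)
  have sub: "subgroup D.relations\<^sub>1\<^sub>2 (additive_group T.W)"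
    unfolding double_relations_def
    by (intro subgroup_additive_group T.subgroup_W D.M1.subgroup_relations D.M1.relations_subset)
  have subM: "subgroup (T.tensor_sum ` D.relations\<^sub>1\<^sub>2) ?M"
    by (rule s.subgroup_img_is_subgroup[OF sub])
  have "additive_group T.W Mod D.relations\<^sub>1\<^sub>2 \<cong> ?M Mod T.tensor_sum ` D.relations\<^sub>1\<^sub>2"
    by (rule Mod_iso[OF s.G.is_group T.M.comm_group_axioms T.tensor_sum_iso subgroup.subset[OF sub] subM])
  then show ?iso unfolding double_quotient_def N_group_def img .
  show ?group
    unfolding N_group_def img[symmetric]
    by (rule comm_group.axioms(2)[OF T.M.abelian_FactGroup[OF subM]])
qed

section \<open>The torsion of the coinvariants\<close>

theorem theorem3p3:
  fixes G :: "('g, 'm) monoid_scheme"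
    and X :: "'a topology" and Y :: "'b topology"
    and \<phi> :: "'a \<Rightarrow> 'a" and \<psi> :: "'b \<Rightarrow> 'b"
    and \<xi> :: "'a \<Rightarrow> 'g" and \<eta> :: "'b \<Rightarrow> 'g"
    and A B :: "'i set" and \<mu> :: "'i \<Rightarrow> 'g"
  assumes "comm_group G" and "finite (carrier G)"
    and "cantor_space X" and "cantor_space Y"
    and "minimal_homeomorphism X \<phi>" and "minimal_homeomorphism Y \<psi>"
    and "nondegenerate_cocycle X G \<phi> \<xi>" and "nondegenerate_cocycle Y G \<psi> \<eta>"
    and "generating_data G A B \<mu>"
  shows "torsion_subgroup
           (coinvariants (product_space X Y G) (lift_first G \<phi> \<xi>) (lift_second G \<psi> \<eta>))
         \<cong> T_group G A B \<mu>"
proof -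
  define \<phi>' where "\<phi>' = inv_into (topspace X) \<phi>"
  define \<psi>' where "\<psi>' = inv_into (topspace Y) \<psi>"
  let ?act = "translate G" and ?V = "group_functions G"
  let ?pt = "discrete_topology {()}" and ?c = "\<lambda>_. ()"
  let ?Q = "\<lambda>A B. double_quotient ?pt (discrete_topology A) ?c ?c \<mu> ?pt (discrete_topology B) ?c ?c \<mu> ?act ?V"
  have fin: "finite A" "finite B" and \<mu>: "\<mu> \<in> A \<rightarrow> carrier G" "\<mu> \<in> B \<rightarrow> carrier G"
    and gen: "generate G (\<mu> ` A) = carrier G" "generate G (\<mu> ` B) = carrier G"
    using assms(9) by (auto simp: generating_data_def)
  interpret module: acyclic_module G ?V ?act
    by (rule acyclic_module_group_functions) fact+
  interpret GX: labelled_graph G X X "\<lambda>x. x" \<phi>' "\<lambda>x. \<xi> (\<phi>' x)"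
    unfolding \<phi>'_def by (rule labelled_graph_skew_product) fact+
  interpret GY: labelled_graph G Y Y "\<lambda>y. y" \<psi>' "\<lambda>y. \<eta> (\<psi>' y)"
    unfolding \<psi>'_def by (rule labelled_graph_skew_product) fact+
  interpret GA: labelled_graph G ?pt "discrete_topology A" ?c ?c \<mu>
    by (rule labelled_graph_bouquet) fact+
  interpret GB: labelled_graph G ?pt "discrete_topology B" ?c ?c \<mu>
    by (rule labelled_graph_bouquet) fact+
  interpret XY: two_graphs G ?V ?act X X "\<lambda>x. x" \<phi>' "\<lambda>x. \<xi> (\<phi>' x)" Y Y "\<lambda>y. y" \<psi>' "\<lambda>y. \<eta> (\<psi>' y)"
    by unfold_locales
  interpret BY: two_graphs G ?V ?act ?pt "discrete_topology B" ?c ?c \<mu> Y Y "\<lambda>y. y" \<psi>' "\<lambda>y. \<eta> (\<psi>' y)"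
    by unfold_locales
  interpret YB: two_graphs G ?V ?act Y Y "\<lambda>y. y" \<psi>' "\<lambda>y. \<eta> (\<psi>' y)" ?pt "discrete_topology B" ?c ?c \<mu>
    by unfold_locales
  interpret AB: two_graphs G ?V ?act ?pt "discrete_topology A" ?c ?c \<mu> ?pt "discrete_topology B" ?c ?c \<mu>
    by unfold_locales
  note group = comm_group.axioms(2)
  let ?Z = "product_space X Y G"
  have coinv: "coinvariants ?Z (lift_first G \<phi> \<xi>) (lift_second G \<psi> \<eta>) \<cong>
    double_quotient X X (\<lambda>x. x) \<phi>' (\<lambda>x. \<xi> (\<phi>' x)) Y Y (\<lambda>y. y) \<psi>' (\<lambda>y. \<eta> (\<psi>' y)) ?act ?V"
    unfolding \<phi>'_def \<psi>'_def by (rule coinvariants_iso_double_quotient(1)) fact+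
  have "group (coinvariants ?Z (lift_first G \<phi> \<xi>) (lift_second G \<psi> \<eta>))"
    by (rule coinvariants_iso_double_quotient(2)) fact+
  then have "torsion_subgroup (coinvariants ?Z (lift_first G \<phi> \<xi>) (lift_second G \<psi> \<eta>)) \<cong>
    torsion_subgroup (double_quotient X X (\<lambda>x. x) \<phi>' (\<lambda>x. \<xi> (\<phi>' x)) Y Y (\<lambda>y. y) \<psi>' (\<lambda>y. \<eta> (\<psi>' y)) ?act ?V)"
    by (rule torsion_subgroup_iso[OF _ group[OF XY.group_double_quotient] coinv])
  also have "\<dots> \<cong> torsion_subgroup
      (double_quotient ?pt (discrete_topology B) ?c ?c \<mu> Y Y (\<lambda>y. y) \<psi>' (\<lambda>y. \<eta> (\<psi>' y)) ?act ?V)"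
    by (rule outer_graph_independent[OF XY.two_graphs_axioms BY.two_graphs_axioms])
  also have "\<dots> \<cong> torsion_subgroup
      (double_quotient Y Y (\<lambda>y. y) \<psi>' (\<lambda>y. \<eta> (\<psi>' y)) ?pt (discrete_topology B) ?c ?c \<mu> ?act ?V)"
    by (rule torsion_subgroup_iso[OF group[OF BY.group_double_quotient] group[OF YB.group_double_quotient]
          BY.double_quotient_swap])
  also have "\<dots> \<cong> torsion_subgroup (?Q A B)"
    by (rule outer_graph_independent[OF YB.two_graphs_axioms AB.two_graphs_axioms])
  also have "\<dots> \<cong> torsion_subgroup (N_group G A B \<mu>)"
    using N_group_iso_double_quotient[OF assms(1,2,9)]
    by (intro torsion_subgroup_iso group[OF AB.group_double_quotient])
  finally show ?thesis unfolding T_group_def .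
qed

end
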